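(* Let $d>3$ and $0\le i\le j\le d-1$ be integers such that $j-i\le d-2$ if $d$ is even, and $j-i\le d-3$ if $d$ is odd. Then there exists a $d$-polytope that is not strongly $(i,j)$-scribable.
   Context: Let $\mathbb S^d=\{x\in\mathbb R^{d+1}:\|x\|_2=1\}$, with coordinates $x_0,\dots,x_d$. A spherical polytope is an intersection of finitely many closed hemispheres of $\mathbb S^d$ containing no two antipodal points; equivalently, $\mathcal P=\mathcal K\cap\mathbb S^d$ for a pointed polyhedral cone $\mathcal K\subset\mathbb R^{d+1}$. Its $k$-faces are the intersections with $\mathbb S^d$ of the $(k+1)$-dimensional faces of $\mathcal K$. A $d$-polytope is a polytope of dimension $d$. Every Euclidean $d$-polytope has the same face lattice as some spherical $d$-polytope and conversely. A realization of a combinatorial type of $d$-polytope is a spherical $d$-polytope in $\mathbb S^d$ with isomorphic face lattice. Let $\mathcal B=\{x\in\mathbb S^d: x_0\ge 0,\ -x_0^2+x_1^2+\dots+x_d^2\le 0\}$ (a spherical cap) and let $\mathcal S=\partial\mathcal B$. A supporting hyperplane of $\mathcal P$ is a hyperplane $H$ of $\mathbb S^d$ (intersection with a linear hyperplane) that meets $\mathcal P$ and such that $\mathcal P$ lies in one of the two closed hemispheres bounded by $H$, denoted $H^-$. A proper face $F$ of $\mathcal P$ strongly cuts $\mathcal S$ if $\operatorname{relint}(F)\cap\mathcal B\ne\emptyset$; it strongly avoids $\mathcal S$ if there is a supporting hyperplane $H$ of $\mathcal P$ with $F=H\cap\mathcal P$ and $\mathcal B\subset H^-$. For $0\le i\le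 j\le d-1$, $\mathcal P$ is strongly $(i,j)$-scribed if every $i$-face strongly avoids $\mathcal S$ and every $j$-face strongly cuts $\mathcal S$. A (combinatorial type of) $d$-polytope is strongly $(i,j)$-scribable if it has a strongly $(i,j)$-scribed realization. *)

theory Defs
  imports "HOL-Analysis.Analysis"
begin

section \<open>Spherical polytopes\<close>

definition great_sphere :: "'a::euclidean_space \<Rightarrow> 'a set" where
  "great_sphere a = {x \<in> sphere 0 1. a \<bullet> x = 0}"

definition hemisphere :: "'a::euclidean_space \<Rightarrow> 'a set" where
  "hemisphere a = {x \<in> sphere 0 1. a \<bullet> x \<le> 0}"

text \<open>The intersection with the sphere only matters for the empty family of hemispheres, whose
  intersection (the whole sphere) is then excluded by the condition on antipodal points.\<close>

definition spherical_polytope :: "'a::euclidean_space set \<Rightarrow> bool" where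
  "spherical_polytope P \<longleftrightarrow>
     (\<exists>A. finite A \<and> 0 \<notin> A \<and> P = sphere 0 1 \<inter> (\<Inter>a\<in>A. hemisphere a)) \<and>
     (\<forall>x\<in>P. - x \<notin> P)"

lemma convex_cone_hull_Int_sphere:
  fixes K :: "'a::euclidean_space set"
  assumes K: "convex_cone K"
  shows "convex_cone hull (K \<inter> sphere 0 1) = K"
proof
  show "convex_cone hull (K \<inter> sphere 0 1) \<subseteq> K"
    using K by (simp add: hull_minimal)
  show "K \<subseteq> convex_cone hull (K \<inter> sphere 0 1)"
  proof
    fix x assume x: "x \<in> K"
    show "x \<in> convex_cone hull (K \<inter> sphere 0 1)"
    proof (cases "x = 0")
      case True
      then show ?thesis by (simp add: convex_cone_hull_contains_0)
    next
      case False
      have "(1 / norm x) *\<^sub>R x \<in> K \<inter> sphere 0 1"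
        using False x K by (auto intro: convex_cone_scaleR)
      then have "norm x *\<^sub>R (1 / norm x) *\<^sub>R x \<in> convex_cone hull (K \<inter> sphere 0 1)"
        by (meson convex_cone_hull_mul hull_inc norm_ge_zero)
      then show ?thesis using False by simp
    qed
  qed
qed

text \<open>For a spherical polytope \<open>P\<close>, the set \<open>convex_cone hull P\<close> is the pointed polyhedral cone
  that cuts out \<open>P\<close> on the sphere (and it is \<open>{0}\<close> for \<open>P = {}\<close>).\<close>

lemma spherical_polytope_cone:
  fixes P :: "'a::euclidean_space set"
  assumes P: "spherical_polytope P"
  shows "polyhedron (convex_cone hull P)"
    and "convex_cone hull P \<inter> sphere 0 1 = P"
    and "x \<in> convex_cone hull P \<Longrightarrow> - x \<in> convex_cone hull P \<Longrightarrow> x = 0"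
proof -
  obtain A where A: "finite A" "0 \<notin> A" "P = sphere 0 1 \<inter> (\<Inter>a\<in>A. hemisphere a)"
    and anti: "\<forall>x\<in>P. - x \<notin> P"
    using P unfolding spherical_polytope_def by blast
  define K where "K = (\<Inter>a\<in>A. {x. a \<bullet> x \<le> 0})"
  have PK: "P = K \<inter> sphere 0 1"
    unfolding A(3) K_def hemisphere_def by auto
  have cK: "convex_cone K"
    unfolding K_def by (auto intro!: convex_cone_Inter convex_cone_halfspace_le)
  have hull: "convex_cone hull P = K"
    using convex_cone_hull_Int_sphere [OF cK] PK by simp
  show "convex_cone hull P \<inter> sphere 0 1 = P"
    using hull PK by simp
  show "polyhedron (convex_cone hull P)"
    unfolding hull K_def using A(1) by (auto intro!: polyhedron_Inter polyhedron_halfspace_le)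
  assume x: "x \<in> convex_cone hull P" "- x \<in> convex_cone hull P"
  show "x = 0"
  proof (rule ccontr)
    assume "x \<noteq> 0"
    have "(1 / norm x) *\<^sub>R x \<in> P" "(1 / norm x) *\<^sub>R (- x) \<in> P"
      using x [unfolded hull] \<open>x \<noteq> 0\<close> convex_cone_scaleR [OF cK, of "1 / norm x"]
      unfolding PK by (auto simp del: scaleR_minus_right)
    then show False using anti by auto
  qed
qed

definition spherical_dpolytope :: "nat \<Rightarrow> 'a::euclidean_space set \<Rightarrow> bool" where
  "spherical_dpolytope d P \<longleftrightarrow>
     spherical_polytope P \<and> aff_dim (convex_cone hull P) = int d + 1"

text \<open>All faces, including \<open>P\<close> itself and the empty face (which is cut out by the apex of the cone).\<close>

definition spherical_faces :: "'a::euclidean_space set \<Rightarrow> 'a set set" where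
  "spherical_faces P = {G \<inter> sphere 0 1 | G. G face_of (convex_cone hull P)}"

definition spherical_kfaces :: "nat \<Rightarrow> 'a::euclidean_space set \<Rightarrow> 'a set set" where
  "spherical_kfaces k P =
     {G \<inter> sphere 0 1 | G. G face_of (convex_cone hull P) \<and> aff_dim G = int k + 1}"

definition isomorphic_face_lattices ::
    "'a::euclidean_space set \<Rightarrow> 'b::euclidean_space set \<Rightarrow> bool" where
  "isomorphic_face_lattices P Q \<longleftrightarrow>
     (\<exists>f. bij_betw f (spherical_faces P) (spherical_faces Q) \<and>
          (\<forall>F\<in>spherical_faces P. \<forall>G\<in>spherical_faces P. F \<subseteq> G \<longleftrightarrow> f F \<subseteq> f G))"

definition spherical_relint :: "'a::euclidean_space set \<Rightarrow> 'a set" where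
  "spherical_relint F = rel_interior (convex_cone hull F) \<inter> sphere 0 1"

text \<open>On the sections of convex cones this is the topological interior relative to the great
  subsphere spanned by the set.\<close>

lemma spherical_relint_eq_interior:
  fixes K :: "'a::euclidean_space set"
  assumes K: "convex_cone K" and F: "F = K \<inter> sphere 0 1"
  shows "spherical_relint F = top_of_set (span F \<inter> sphere 0 1) interior_of F"
proof -
  have hull: "convex_cone hull F = K"
    using convex_cone_hull_Int_sphere [OF K] F by simp
  have "span K = span F"
  proof -
    have "K \<subseteq> span F"
      unfolding hull [symmetric]
      by (rule hull_minimal)
         (auto simp: convex_cone_iff span_base span_add span_scale span_zero)
    then show ?thesis
      using F by (intro antisym span_mono span_minimal) auto
  qed
  then have aff: "affine hull K = span F"
    using K convex_cone_contains_0 affine_hull_span_0 hull_inc by metis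
  show ?thesis
  proof (intro antisym subsetI)
    fix x assume "x \<in> spherical_relint F"
    then obtain T where T: "x \<in> K" "norm x = 1" "open T" "x \<in> T" "T \<inter> span F \<subseteq> K"
      unfolding spherical_relint_def hull by (auto simp: rel_interior aff)
    have "openin (top_of_set (span F \<inter> sphere 0 1)) (span F \<inter> sphere 0 1 \<inter> T)"
      using T(3) by (rule openin_open_Int)
    moreover have "x \<in> span F \<inter> sphere 0 1 \<inter> T"
      using T F by (auto intro: span_base)
    moreover have "span F \<inter> sphere 0 1 \<inter> T \<subseteq> F"
      using T F by auto
    ultimately show "x \<in> top_of_set (span F \<inter> sphere 0 1) interior_of F"
      unfolding interior_of_def by blast
  next
    fix x assume "x \<in> top_of_set (span F \<inter> sphere 0 1) interior_of F"
    then obtain T where T: "open T" "x \<in> T" "x \<in> span F" "norm x = 1"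
      "span F \<inter> sphere 0 1 \<inter> T \<subseteq> F"
      by (auto simp: interior_of_def openin_open)
    define g :: "'a \<Rightarrow> 'a" where "g = (\<lambda>y. (1 / norm y) *\<^sub>R y)"
    have "continuous_on (- {0}) g"
      unfolding g_def by (intro continuous_intros) auto
    then have op: "open (g -` T \<inter> - {0})"
      using T(1) by (meson continuous_on_open_vimage open_Compl closed_singleton)
    have "x \<in> F" using T by auto
    moreover have "x \<in> g -` T \<inter> - {0}"
      using T by (auto simp: g_def)
    moreover have "g -` T \<inter> - {0} \<inter> span F \<subseteq> K"
    proof
      fix y assume y: "y \<in> g -` T \<inter> - {0} \<inter> span F"
      then have "g y \<in> span F \<inter> sphere 0 1 \<inter> T"
        by (auto simp: g_def span_scale)
      then have "g y \<in> K" using T F by auto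
      then have "norm y *\<^sub>R g y \<in> K" using K by (simp add: convex_cone_scaleR)
      then show "y \<in> K" using y by (simp add: g_def)
    qed
    ultimately show "x \<in> spherical_relint F"
      unfolding spherical_relint_def hull using F op by (auto simp: rel_interior aff)
  qed
qed


section \<open>Strong scribability\<close>

text \<open>The ambient space of the \<open>d\<close>-sphere is \<open>real \<times> (real ^ 'n)\<close> with \<open>CARD('n) = d\<close>: the first
  component is the coordinate \<open>x\<^sub>0\<close>, the second one carries \<open>x\<^sub>1, \<dots>, x\<^sub>d\<close>.\<close>

definition light_cap :: "(real \<times> (real ^ 'n::finite)) set" where
  "light_cap = {x \<in> sphere 0 1. 0 \<le> fst x \<and> - (fst x)\<^sup>2 + (\<Sum>k\<in>UNIV. (snd x $ k)\<^sup>2) \<le> 0}"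

text \<open>A hyperplane of the sphere is given by a normal vector, oriented such that the
  hemisphere containing \<open>P\<close> is \<open>hemisphere a\<close>.\<close>

definition supporting_hyperplane :: "'a::euclidean_space \<Rightarrow> 'a set \<Rightarrow> bool" where
  "supporting_hyperplane a P \<longleftrightarrow>
     a \<noteq> 0 \<and> great_sphere a \<inter> P \<noteq> {} \<and> P \<subseteq> hemisphere a"

definition strongly_cuts :: "(real \<times> (real ^ 'n::finite)) set \<Rightarrow> bool" where
  "strongly_cuts F \<longleftrightarrow> spherical_relint F \<inter> light_cap \<noteq> {}"

definition strongly_avoids ::
    "(real \<times> (real ^ 'n::finite)) set \<Rightarrow> (real \<times> (real ^ 'n)) set \<Rightarrow> bool" where
  "strongly_avoids P F \<longleftrightarrow>
     (\<exists>a. supporting_hyperplane a P \<and> F = great_sphere a \<inter> P \<and> light_cap \<subseteq> hemisphere a)"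

definition strongly_scribed :: "nat \<Rightarrow> nat \<Rightarrow> (real \<times> (real ^ 'n::finite)) set \<Rightarrow> bool" where
  "strongly_scribed i j P \<longleftrightarrow>
     (\<forall>F\<in>spherical_kfaces i P. strongly_avoids P F) \<and>
     (\<forall>F\<in>spherical_kfaces j P. strongly_cuts F)"

definition strongly_scribable :: "nat \<Rightarrow> nat \<Rightarrow> (real \<times> (real ^ 'n::finite)) set \<Rightarrow> bool" where
  "strongly_scribable i j P \<longleftrightarrow>
     (\<exists>Q :: (real \<times> (real ^ 'n)) set.
        spherical_dpolytope CARD('n) Q \<and> isomorphic_face_lattices Q P \<and> strongly_scribed i j Q)"

end

theory Submission
  imports Defs "HOL-Computational_Algebra.Polynomial"
begin

text \<open>Let \<open>L\<close> be the self-dual Lorentz cone spanned by the cap. Polarity exchanges avoiding and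
  cutting, so it turns \<open>(i, j)\<close> into \<open>(d - 1 - j, d - 1 - i)\<close> for the dual polytope.

  For \<open>d = 2 k\<close> we may therefore assume \<open>j \<le> d - 2\<close>, and we take the dual \<open>P\<close> of the cyclic
  polytope with many vertices. Two facets of \<open>P\<close> always meet in a face of dimension \<open>d - 2 \<ge> j\<close>,
  which cuts \<open>L\<close>. Hence the caps that the facet hyperplanes cut out of \<open>L\<close> meet pairwise, and
  comparing all caps with a smallest one shows that a fixed proportion of them has a common point
  \<open>x\<close>. Group the facets, in their cyclic order, into blocks. If \<open>x\<close> lies in all caps of a block,
  then the supporting hyperplanes at two vertices of \<open>P\<close> with disjoint sets of facets in this block
  are both the tangent hyperplane of \<open>L\<close> at \<open>x\<close>, which is absurd. Otherwise \<open>x\<close>, as a functional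
  on the normals, changes sign between two adjacent normals of the block. From \<open>2 k + 1\<close> such
  blocks we obtain \<open>2 k + 1\<close> vectors in a space of dimension \<open>2 k\<close> which are nonnegative
  combinations of adjacent normals. By Gale's evenness condition any \<open>k\<close> of them are cut out by a
  vertex of \<open>P\<close>, which contradicts a linear relation among them.

  For odd \<open>d\<close> the pyramid over the dual cyclic polytope of dimension \<open>d - 1\<close> or its dual works.\<close>

section \<open>Caps that meet pairwise\<close>

text \<open>A realization is known only through its face lattice, so the number of facets must be
  fixed before the cone is given. Hence the constants \<open>N\<close> and \<open>m\<close> are
  quantified ahead of all vectors, subspaces and cones, and the geometry enters only through
  incidences, carried over by the lattice isomorphism, and through the self-duality of the Lorentz
  cone. A point of the dual cyclic cone is a polynomial of degree at most \<open>2 * k\<close> that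
  is nonnegative at \<open>0, ..., n - 1\<close>; the facet normals are the evaluations there. Two
  double roots need degree 4, whence \<open>k \<ge> 2\<close>, that is, \<open>d > 3\<close>. The
  tangent hyperplanes come from a squeeze: if \<open>x\<close> lies in the caps of all facets
  through a vertex, then \<open>- x\<close> points into the cone there, so a supporting normal is
  nonpositive at \<open>x\<close>; it is nonnegative at \<open>x\<close> because both lie in the
  Lorentz cone. Gale's pairs require an even dimension. For \<open>d = 2 * k + 1\<close> the base of
  the pyramid handles \<open>j \<le> d - 3\<close>, and the quotient by the apex handles
  \<open>1 \<le> i\<close>, \<open>j \<le> d - 2\<close>; this is the origin of the stronger bound
  on \<open>j - i\<close>.\<close>

lemma pigeonhole_in_scaled_ball:
  fixes R \<epsilon> :: real
  assumes "0 < \<epsilon>"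
  shows "\<exists>N::nat. \<forall>(q::'b \<Rightarrow> 'a::euclidean_space) I m g r.
    finite I \<and> N * m < card I \<and> 0 < r \<and> (\<forall>i\<in>I. dist (q i) g \<le> R * r) \<longrightarrow>
    (\<exists>j\<in>I. m < card {i\<in>I. dist (q i) (q j) \<le> \<epsilon> * r})"
proof -
  \<comment> \<open>The number of small balls that cover one fixed ball serves every centre
    \<open>g\<close> and every scale \<open>r\<close> after rescaling.\<close>
  obtain C where C: "finite C" "cball (0::'a) R \<subseteq> (\<Union>c\<in>C. ball c (\<epsilon>/2))"
    using compact_cball[of "0::'a" R] assms unfolding compact_eq_totally_bounded
    by (meson half_gt_zero)
  show ?thesis
  proof (intro exI[of _ "card C"] allI impI, elim conjE)
    fix q :: "'b \<Rightarrow> 'a" and I m g and r :: real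
    assume I: "finite I" "card C * m < card I" and r: "0 < r"
      and q: "\<forall>i\<in>I. dist (q i) g \<le> R * r"
    define I' where "I' c = {i\<in>I. dist ((1/r) *\<^sub>R (q i - g)) c < \<epsilon>/2}" for c
    have "I \<subseteq> (\<Union>c\<in>C. I' c)"
    proof
      fix i assume i: "i \<in> I"
      have "(1/r) *\<^sub>R (q i - g) \<in> cball 0 R"
      proof -
        have "dist (q i) g \<le> R * r" using q i by blast
        then show ?thesis using r by (simp add: dist_norm pos_divide_le_eq)
      qed
      then obtain c where "c \<in> C" "(1/r) *\<^sub>R (q i - g) \<in> ball c (\<epsilon>/2)"
        using C(2) by blast
      then show "i \<in> (\<Union>c\<in>C. I' c)"
        using i by (auto simp: I'_def dist_commute[of c])
    qed
    moreover have "finite (\<Union>c\<in>C. I' c)" using C(1) I(1) by (simp add: I'_def)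
    ultimately have "card I \<le> card (\<Union>c\<in>C. I' c)" by (intro card_mono)
    also have "\<dots> \<le> (\<Sum>c\<in>C. card (I' c))" by (rule card_UN_le[OF C(1)])
    finally have "card I \<le> (\<Sum>c\<in>C. card (I' c))" .
    then have "\<not> (\<forall>c\<in>C. card (I' c) \<le> m)"
      using sum_bounded_above[of C "\<lambda>c. card (I' c)" m] I(2) by auto
    then obtain c where c: "c \<in> C" "m < card (I' c)" by (auto simp: not_le)
    then obtain j where j: "j \<in> I' c" by (metis card.empty equals0I not_less0)
    have "I' c \<subseteq> {i\<in>I. dist (q i) (q j) \<le> \<epsilon> * r}"
    proof
      fix i assume i: "i \<in> I' c"
      have "dist ((1/r) *\<^sub>R (q i - g)) ((1/r) *\<^sub>R (q j - g)) \<le> \<epsilon>"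
        using i j dist_triangle_half_r[of c "(1/r) *\<^sub>R (q i - g)" \<epsilon> "(1/r) *\<^sub>R (q j - g)"]
        unfolding I'_def by (metis (no_types, lifting) dist_commute less_imp_le mem_Collect_eq)
      moreover have "dist ((1/r) *\<^sub>R (q i - g)) ((1/r) *\<^sub>R (q j - g)) = dist (q i) (q j) / r"
      proof -
        have "(1/r) *\<^sub>R (q i - g) - (1/r) *\<^sub>R (q j - g) = (1/r) *\<^sub>R (q i - q j)"
          by (simp add: scaleR_diff_right)
        then show ?thesis using r by (simp add: dist_norm)
      qed
      ultimately show "i \<in> {i\<in>I. dist (q i) (q j) \<le> \<epsilon> * r}"
        using i r by (simp add: I'_def pos_divide_le_eq)
    qed
    then have "m < card {i\<in>I. dist (q i) (q j) \<le> \<epsilon> * r}"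
      using c(2) card_mono[of "{i\<in>I. dist (q i) (q j) \<le> \<epsilon> * r}" "I' c"] I(1) by simp
    then show "\<exists>j\<in>I. m < card {i\<in>I. dist (q i) (q j) \<le> \<epsilon> * r}"
      using j by (auto simp: I'_def)
  qed
qed

text \<open>Moving from \<open>p\<close> towards the centre \<open>g\<close> by the fraction
  \<open>r / s\<close> gains depth \<open>r\<close> in the cap, and the projection back to the
  sphere costs at most 7/8 of it. As \<open>s\<^sup>2 \<le> 2\<close> keeps the cap within a
  hemisphere, the chord from \<open>p\<close> to \<open>g\<close> stays away from the
  origin.\<close>

lemma cap_inner_fattening:
  fixes p g :: "'a::euclidean_space"
  assumes p: "norm p = 1" and g: "norm g = 1" and pg: "dist p g \<le> s" "s\<^sup>2 \<le> 2"
    and r: "0 < r" "r \<le> s"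
  obtains q where "norm q = 1" "q \<in> span {p, g}" "dist q p \<le> 2 * r"
    "\<And>x. dist x q \<le> r / 8 \<Longrightarrow> dist x g \<le> s"
proof -
  define t where "t = r / s"
  have t: "0 < t" "t \<le> 1" "t * s = r" using r by (auto simp: t_def)
  define c where "c = p + t *\<^sub>R (g - p)"
  define l where "l = dist p g"
  have l: "0 \<le> l" "l \<le> s" using pg by (auto simp: l_def)
  have l2: "l\<^sup>2 \<le> 2" using pg(2) l power_mono[of l s 2] by linarith
  have gp: "l\<^sup>2 = 2 - 2 * (p \<bullet> g)"
    unfolding l_def dist_norm power2_norm_eq_inner
    using p g by (simp add: inner_diff inner_commute norm_eq_1)
  have nc: "(norm c)\<^sup>2 = 1 - t * (1 - t) * l\<^sup>2"
    unfolding gp unfolding c_def power2_norm_eq_inner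
    using p g by (simp add: inner_simps inner_commute norm_eq_1 algebra_simps)
  have "t * (1 - t) \<le> 1/4"
    using zero_le_power2[of "t - 1/2"] by (simp add: power2_eq_square algebra_simps)
  then have "t * (1 - t) * l\<^sup>2 \<le> 1/4 * 2" using l2 t by (intro mult_mono) auto
  then have "(norm c)\<^sup>2 \<ge> (7/10)\<^sup>2" using nc by (simp add: power2_eq_square)
  then have c7: "norm c \<ge> 7/10" by (rule power2_le_imp_le) simp
  \<comment> \<open>A rational upper bound for the square root of 2. Divided by the lower bound
    17/10 for \<open>1 + norm c\<close>, it gives the factor 7/8 below.\<close>
  have s: "s \<le> 142/100"
    by (rule power2_le_imp_le) (use pg(2) in \<open>auto simp: power2_eq_square\<close>)
  have "t * (1 - t) * l\<^sup>2 \<le> t * 1 * s\<^sup>2"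
    using l t by (intro mult_mono power_mono) auto
  also have "\<dots> = r * s" using t(3) by (simp add: power2_eq_square)
  also have "\<dots> \<le> r * (142/100)" using s r by (intro mult_left_mono) auto
  finally have "1 - (norm c)\<^sup>2 \<le> 142/100 * r" using nc by simp
  moreover have "1 - (norm c)\<^sup>2 = (1 - norm c) * (1 + norm c)" by (simp add: power2_eq_square algebra_simps)
  ultimately have e1: "(1 - norm c) * (1 + norm c) \<le> 142/100 * r" by simp
  have c1: "norm c \<le> 1"
  proof (rule power2_le_imp_le)
    show "(norm c)\<^sup>2 \<le> 1\<^sup>2" using nc t by simp
  qed simp
  have "(1 - norm c) * (17/10) \<le> (1 - norm c) * (1 + norm c)"
    using c7 c1 by (intro mult_left_mono) auto
  then have "(1 - norm c) * (17/10) \<le> 142/100 * r" using e1 by (rule order_trans)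
  then have d: "1 - norm c \<le> 7/8 * r" using r(1) by argo
  define q where "q = (1 / norm c) *\<^sub>R c"
  have "q - c = (1 / norm c - 1) *\<^sub>R c" by (simp add: q_def algebra_simps)
  then have "norm (q - c) = \<bar>1 / norm c - 1\<bar> * norm c" by simp
  also have "\<dots> = 1 - norm c" using c7 c1 by (cases "c = 0") (auto simp: abs_if field_simps)
  finally have qc: "dist q c \<le> 7/8 * r" using d by (simp add: dist_norm)
  have cp: "dist c p \<le> r"
  proof -
    have "dist c p = t * l" using t by (simp add: c_def l_def dist_norm norm_minus_commute)
    also have "\<dots> \<le> r" using t l mult_left_mono[of l s t] by auto
    finally show ?thesis .
  qed
  have cg: "dist c g \<le> s - r"
  proof -
    have "c - g = (1 - t) *\<^sub>R (p - g)" by (simp add: c_def algebra_simps)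
    then have "dist c g = (1 - t) * l" using t by (simp add: l_def dist_norm)
    also have "\<dots> \<le> (1 - t) * s" using t l by (intro mult_left_mono) auto
    finally show ?thesis using t by (simp add: algebra_simps)
  qed
  show ?thesis
  proof
    show "norm q = 1" using c7 by (auto simp: q_def)
    show "q \<in> span {p, g}" unfolding q_def c_def
      by (intro span_scale span_add span_diff span_base) auto
    show "dist q p \<le> 2 * r" using qc cp dist_triangle[of q p c] r by (simp add: dist_commute)
    show "dist x g \<le> s" if "dist x q \<le> r / 8" for x
      using that qc cg dist_triangle[of x g q] dist_triangle[of q g c] by linarith
  qed
qed

lemma inner_sphere_eq_dist:
  fixes x g :: "'a::real_inner"
  assumes "norm x = 1" "norm g = 1"
  shows "g \<bullet> x = 1 - (dist x g)\<^sup>2 / 2"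
  using assms by (simp add: dist_norm power2_norm_eq_inner inner_diff inner_commute norm_eq_1 field_simps)

text \<open>A smallest cap meets all the others, and after a slight shift every other cap contains a
  ball of a comparable radius near it, so a bounded number of points pierces all the caps.\<close>

lemma pairwise_meeting_caps:
  "\<exists>N::nat. \<forall>(V::'a::euclidean_space set) (w::'b \<Rightarrow> 'a) \<alpha> I m.
    subspace V \<and> finite I \<and> N * m < card I \<and> w ` I \<subseteq> V \<and>
    (\<forall>i\<in>I. \<forall>j\<in>I. \<exists>t\<in>V. norm t \<le> 1 \<and> \<alpha> i + w i \<bullet> t \<le> 0 \<and> \<alpha> j + w j \<bullet> t \<le> 0) \<longrightarrow>
    (\<exists>t\<in>V. norm t \<le> 1 \<and> m < card {i\<in>I. \<alpha> i + w i \<bullet> t \<le> 0})"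
proof -
  \<comment> \<open>The ratio 3 adds the shift of at most two radii to the distance of at most one
    radius from \<open>p i\<close> to the centre of the smallest cap; 1/8 is the constant of
    \<open>cap_inner_fattening\<close>.\<close>
  obtain N :: nat where N: "\<forall>(q::'b \<Rightarrow> 'a) I m g r.
    finite I \<and> N * m < card I \<and> 0 < r \<and> (\<forall>i\<in>I. dist (q i) g \<le> 3 * r) \<longrightarrow>
    (\<exists>j\<in>I. m < card {i\<in>I. dist (q i) (q j) \<le> 1/8 * r})"
    using pigeonhole_in_scaled_ball[of "1/8" 3, where 'a='a and 'b='b] zero_less_divide_1_iff[of "8::real"]
      zero_less_numeral by blast
  show ?thesis
  \<comment> \<open>At most \<open>m\<close> indices are lost to \<open>I0\<close>. The remaining
    factor \<open>N + 1\<close> covers both the pigeonhole bound \<open>N * m\<close> and the bound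
    \<open>m\<close> for a smallest cap that is a single point.\<close>
  proof (intro exI[of _ "N + 2"] allI impI, elim conjE)
    fix V :: "'a set" and w :: "'b \<Rightarrow> 'a" and \<alpha> I m
    assume V: "subspace V" and I: "finite I" "(N + 2) * m < card I" and wV: "w ` I \<subseteq> V"
      and pw: "\<forall>i\<in>I. \<forall>j\<in>I. \<exists>t\<in>V. norm t \<le> 1 \<and> \<alpha> i + w i \<bullet> t \<le> 0 \<and> \<alpha> j + w j \<bullet> t \<le> 0"
    \<comment> \<open>Half-spaces with \<open>\<alpha> i \<le> 0\<close> contain the origin, so
      \<open>t = 0\<close> settles the case of many of them. The others meet the unit sphere in caps
      smaller than a hemisphere.\<close>
    define I0 where "I0 = {i\<in>I. \<alpha> i \<le> 0}"
    define I1 where "I1 = {i\<in>I. 0 < \<alpha> i}"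
    show "\<exists>t\<in>V. norm t \<le> 1 \<and> m < card {i\<in>I. \<alpha> i + w i \<bullet> t \<le> 0}"
    proof (cases "m < card I0")
      case True
      then show ?thesis using V by (intro bexI[of _ 0]) (auto simp: I0_def subspace_0)
    next
      case False
      have "I = I0 \<union> I1" "I0 \<inter> I1 = {}" by (auto simp: I0_def I1_def)
      then have "card I = card I0 + card I1" using I(1) by (metis card_Un_disjoint finite_Un)
      then have I1: "(N + 1) * m < card I1" "finite I1" "I1 \<subseteq> I"
        using False I by (auto simp: I1_def)
      define g where "g i = - (1 / norm (w i)) *\<^sub>R w i" for i
      define h where "h i = \<alpha> i / norm (w i)" for i
      have w0: "w i \<noteq> 0" if "i \<in> I1" for i
        using that pw I1(3) by (fastforce simp: I1_def)
      have hs: "\<alpha> i + w i \<bullet> t \<le> 0 \<longleftrightarrow> h i \<le> g i \<bullet> t" if "i \<in> I1" for i t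
        using w0[OF that] by (auto simp: g_def h_def field_simps)
      have g: "norm (g i) = 1" "g i \<in> V" if "i \<in> I1" for i
        using w0[OF that] wV that I1(3) V by (auto simp: g_def intro!: subspace_scale subspace_neg)
      have h: "0 < h i" "h i \<le> 1" if i: "i \<in> I1" for i
      proof -
        show "0 < h i" using i w0[OF i] by (auto simp: h_def I1_def)
        obtain t where "norm t \<le> 1" "\<alpha> i + w i \<bullet> t \<le> 0" using pw i I1(3) by blast
        then have "h i \<le> g i \<bullet> t" "norm t \<le> 1" using hs[OF i] by auto
        then show "h i \<le> 1" using norm_cauchy_schwarz[of "g i" t] g(1)[OF i] by auto
      qed
      define s where "s i = sqrt (2 - 2 * h i)" for i
      have s: "0 \<le> s i" "(s i)\<^sup>2 = 2 - 2 * h i" if "i \<in> I1" for i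
        using h[OF that] by (auto simp: s_def)
      have cap: "h i \<le> g i \<bullet> x \<longleftrightarrow> dist x (g i) \<le> s i" if "i \<in> I1" "norm x = 1" for i x
      proof -
        have "h i \<le> g i \<bullet> x \<longleftrightarrow> (dist x (g i))\<^sup>2 \<le> (s i)\<^sup>2"
          using inner_sphere_eq_dist[OF that(2) g(1)[OF that(1)]] s(2)[OF that(1)] by auto
        also have "\<dots> \<longleftrightarrow> dist x (g i) \<le> s i" using s(1)[OF that(1)] by simp
        finally show ?thesis .
      qed
      have "I1 \<noteq> {}" using I1 by auto
      define o' where "o' = arg_min_on s I1"
      have o: "o' \<in> I1" "\<And>i. i \<in> I1 \<Longrightarrow> s o' \<le> s i"
        unfolding o'_def using arg_min_if_finite(1)[OF I1(2) \<open>I1 \<noteq> {}\<close>] arg_min_least[OF I1(2) \<open>I1 \<noteq> {}\<close>]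
        by blast+
      have "\<exists>p\<in>V. norm p = 1 \<and> dist p (g o') \<le> s o' \<and> dist p (g i) \<le> s i" if i: "i \<in> I1" for i
      proof -
        obtain t where t: "t \<in> V" "norm t \<le> 1" "h i \<le> g i \<bullet> t" "h o' \<le> g o' \<bullet> t"
          using pw i o(1) I1(3) hs by blast
        have nt: "t \<noteq> 0" using t h[OF i] by auto
        \<comment> \<open>As \<open>h l\<close> is positive and \<open>norm t \<le> 1\<close>,
          pushing \<open>t\<close> out to the sphere does not leave the half-spaces.\<close>
        define p where "p = (1 / norm t) *\<^sub>R t"
        have p: "p \<in> V" "norm p = 1" using nt t V by (auto simp: p_def subspace_scale)
        have "h l \<le> g l \<bullet> p" if "l \<in> I1" "h l \<le> g l \<bullet> t" for l
        proof -
          have "h l * norm t \<le> h l * 1" using h[OF that(1)] t by (intro mult_left_mono) auto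
          also have "\<dots> \<le> g l \<bullet> t" using that by simp
          finally show ?thesis using nt by (simp add: p_def field_simps)
        qed
        then show ?thesis using p cap i o(1) t by blast
      qed
      then have "\<forall>i\<in>I1. \<exists>p. p \<in> V \<and> norm p = 1 \<and> dist p (g o') \<le> s o' \<and> dist p (g i) \<le> s i"
        by blast
      then obtain p where p: "\<And>i. i \<in> I1 \<Longrightarrow> p i \<in> V" "\<And>i. i \<in> I1 \<Longrightarrow> norm (p i) = 1"
        "\<And>i. i \<in> I1 \<Longrightarrow> dist (p i) (g o') \<le> s o'" "\<And>i. i \<in> I1 \<Longrightarrow> dist (p i) (g i) \<le> s i"
        by metis
      have concl: ?thesis if x: "x \<in> V" "norm x = 1" "J \<subseteq> {i\<in>I1. dist x (g i) \<le> s i}" "m < card J" for x J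
      proof -
        have "J \<subseteq> {i\<in>I. \<alpha> i + w i \<bullet> x \<le> 0}"
          using x(3) I1(3) cap[OF _ x(2)] hs by blast
        then have "m < card {i\<in>I. \<alpha> i + w i \<bullet> x \<le> 0}"
          using x(4) card_mono[of "{i\<in>I. \<alpha> i + w i \<bullet> x \<le> 0}" J] I(1) by simp
        then show ?thesis by (intro bexI[OF _ x(1)]) (simp add: x(2))
      qed
      show ?thesis
      proof (cases "s o' = 0")
        case True
        then have "p i = g o'" if "i \<in> I1" for i using p(3)[OF that] by simp
        then have "I1 \<subseteq> {i\<in>I1. dist (g o') (g i) \<le> s i}" using p(4) by fastforce
        then show ?thesis using concl[of "g o'" I1] g[OF o(1)] I1 by simp
      next
        case False
        then have so: "0 < s o'" using s(1)[OF o(1)] by simp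
        have "\<exists>q. norm q = 1 \<and> q \<in> V \<and> dist q (p i) \<le> 2 * s o' \<and>
              (\<forall>x. dist x q \<le> s o' / 8 \<longrightarrow> dist x (g i) \<le> s i)" if i: "i \<in> I1" for i
        proof -
          have s2: "(s i)\<^sup>2 \<le> 2" using s(2)[OF i] h[OF i] by simp
          obtain q where q: "norm q = 1" "q \<in> span {p i, g i}" "dist q (p i) \<le> 2 * s o'"
            "\<And>x. dist x q \<le> s o' / 8 \<Longrightarrow> dist x (g i) \<le> s i"
            using cap_inner_fattening[OF p(2)[OF i] g(1)[OF i] p(4)[OF i] s2 so o(2)[OF i]] by metis
          have "q \<in> V" using q(2) span_minimal[of "{p i, g i}" V] p(1)[OF i] g(2)[OF i] V by auto
          then show ?thesis using q by blast
        qed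
        then have "\<forall>i\<in>I1. \<exists>q. norm q = 1 \<and> q \<in> V \<and> dist q (p i) \<le> 2 * s o' \<and>
              (\<forall>x. dist x q \<le> s o' / 8 \<longrightarrow> dist x (g i) \<le> s i)" by blast
        then obtain q where q: "\<And>i. i \<in> I1 \<Longrightarrow> norm (q i) = 1" "\<And>i. i \<in> I1 \<Longrightarrow> q i \<in> V"
          "\<And>i. i \<in> I1 \<Longrightarrow> dist (q i) (p i) \<le> 2 * s o'"
          "\<And>i x. i \<in> I1 \<Longrightarrow> dist x (q i) \<le> s o' / 8 \<Longrightarrow> dist x (g i) \<le> s i"
          by metis
        have "\<forall>i\<in>I1. dist (q i) (g o') \<le> 3 * s o'"
        proof
          fix i assume "i \<in> I1"
          then show "dist (q i) (g o') \<le> 3 * s o'"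
            using q(3)[of i] p(3)[of i] dist_triangle[of "q i" "g o'" "p i"] by linarith
        qed
        moreover have "N * m < card I1" using I1(1) by simp
        ultimately obtain j where j: "j \<in> I1" "m < card {i\<in>I1. dist (q i) (q j) \<le> 1/8 * s o'}"
          using N[rule_format, of I1 m "s o'" q "g o'"] I1(2) so by blast
        have "{i\<in>I1. dist (q i) (q j) \<le> 1/8 * s o'} \<subseteq> {i\<in>I1. dist (q j) (g i) \<le> s i}"
          using q(4)[of _ "q j"] by (auto simp: dist_commute[of "q j"])
        then show ?thesis using concl[OF q(2)[OF j(1)] q(1)[OF j(1)]] j(2) by blast
      qed
    qed
  qed
qed

section \<open>The Lorentz cone\<close>

definition lorentz_cone :: "(real \<times> 'a::real_inner) set" where
  "lorentz_cone = {x. norm (snd x) \<le> fst x}"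

lemma lorentz_cone_inner_nonneg:
  assumes "a \<in> lorentz_cone" "x \<in> lorentz_cone"
  shows "0 \<le> a \<bullet> x"
proof -
  have "norm (snd a) * norm (snd x) \<le> fst a * fst x"
    using assms by (intro mult_mono) (auto simp: lorentz_cone_def intro: order_trans[OF norm_ge_zero])
  then show ?thesis
    using Cauchy_Schwarz_ineq2[of "snd a" "snd x"] by (simp add: inner_prod_def abs_le_iff)
qed

lemma lorentz_cone_fst_pos:
  assumes "x \<in> lorentz_cone" "x \<noteq> 0"
  shows "0 < fst x"
proof (rule ccontr)
  assume "\<not> 0 < fst x"
  moreover have le: "norm (snd x) \<le> fst x" using assms(1) by (simp add: lorentz_cone_def)
  ultimately have "fst x = 0" using norm_ge_zero[of "snd x"] by linarith
  then show False using le assms(2) by (simp add: prod_eq_iff)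
qed

text \<open>Equality case of Cauchy-Schwarz: a nonzero point of the cone orthogonal to
  \<open>x\<close> is a positive multiple of the reflection \<open>(fst x, - snd x)\<close>.\<close>

lemma lorentz_cone_orthogonal_unique:
  assumes a: "a \<in> lorentz_cone" "a \<noteq> 0" and b: "b \<in> lorentz_cone" "b \<noteq> 0"
    and x: "x \<in> lorentz_cone" "x \<noteq> 0" and "a \<bullet> x = 0" "b \<bullet> x = 0"
  shows "\<exists>c>0. b = c *\<^sub>R a"
proof -
  have *: "snd y = (- fst y / fst x) *\<^sub>R snd x" if y: "y \<in> lorentz_cone" "y \<noteq> 0" "y \<bullet> x = 0" for y
  proof -
    have pos: "0 < fst y" "0 < fst x" using lorentz_cone_fst_pos x y by blast+
    have le: "norm (snd y) \<le> fst y" "norm (snd x) \<le> fst x" using x y by (auto simp: lorentz_cone_def)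
    have e: "fst y * fst x = - snd y \<bullet> snd x" using y(3) by (simp add: inner_prod_def)
    have cs: "- snd y \<bullet> snd x \<le> norm (snd y) * norm (snd x)"
      using norm_cauchy_schwarz[of "- snd y" "snd x"] by simp
    have "norm (snd y) * norm (snd x) \<le> fst y * norm (snd x)"
      using le by (intro mult_right_mono) auto
    then have "fst y * fst x \<le> fst y * norm (snd x)" using e cs by linarith
    then have nx: "norm (snd x) = fst x" using pos le by simp
    have "fst x * fst y \<le> fst x * norm (snd y)" using e cs nx by (simp add: mult.commute)
    then have ny: "norm (snd y) = fst y" using pos le by simp
    have "- snd y \<bullet> snd x = norm (- snd y) * norm (snd x)" using e nx ny by simp
    then have "norm (- snd y) *\<^sub>R snd x = norm (snd x) *\<^sub>R (- snd y)"
      by (simp only: norm_cauchy_schwarz_eq)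
    then have "fst y *\<^sub>R snd x = - (fst x *\<^sub>R snd y)" using nx ny by simp
    then have "fst x *\<^sub>R snd y = fst x *\<^sub>R ((- fst y / fst x) *\<^sub>R snd x)" using pos by simp
    then show ?thesis using pos by (metis less_irrefl scaleR_left_imp_eq)
  qed
  have pos: "0 < fst a" "0 < fst b" using lorentz_cone_fst_pos a b by blast+
  have "b = (fst b / fst a) *\<^sub>R a"
    using *[OF a assms(7)] *[OF b assms(8)] pos by (simp add: prod_eq_iff)
  then show ?thesis using pos by (metis divide_pos_pos)
qed

text \<open>The slice of the cone and \<open>U\<close> at height \<open>fst = 1\<close> is a ball in
  an affine subspace, so \<open>pairwise_meeting_caps\<close> applies in the direction space
  \<open>V\<close> of this slice after a translation and a scaling.\<close>

lemma lorentz_cone_Int_subspace_pierced: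
  "\<exists>N::nat. \<forall>(U::(real \<times> 'a::euclidean_space) set) (v::'b \<Rightarrow> real \<times> 'a) I m.
    subspace U \<and> finite I \<and> N * m < card I \<and>
    (\<forall>i\<in>I. \<forall>j\<in>I. \<exists>y\<in>lorentz_cone \<inter> U. y \<noteq> 0 \<and> v i \<bullet> y \<le> 0 \<and> v j \<bullet> y \<le> 0) \<longrightarrow>
    (\<exists>x\<in>lorentz_cone \<inter> U. x \<noteq> 0 \<and> m < card {i\<in>I. v i \<bullet> x \<le> 0})"
proof -
  obtain N :: nat where N: "\<forall>(V::'a set) (w::'b \<Rightarrow> 'a) \<alpha> I m.
    subspace V \<and> finite I \<and> N * m < card I \<and> w ` I \<subseteq> V \<and>
    (\<forall>i\<in>I. \<forall>j\<in>I. \<exists>t\<in>V. norm t \<le> 1 \<and> \<alpha> i + w i \<bullet> t \<le> 0 \<and> \<alpha> j + w j \<bullet> t \<le> 0) \<longrightarrow>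
    (\<exists>t\<in>V. norm t \<le> 1 \<and> m < card {i\<in>I. \<alpha> i + w i \<bullet> t \<le> 0})"
    using pairwise_meeting_caps[where 'a='a and 'b='b] by blast
  show ?thesis
  proof (intro exI[of _ N] allI impI, elim conjE)
    fix U :: "(real \<times> 'a) set" and v :: "'b \<Rightarrow> real \<times> 'a" and I m
    assume U: "subspace U" and I: "finite I" "N * m < card I"
      and pw: "\<forall>i\<in>I. \<forall>j\<in>I. \<exists>y\<in>lorentz_cone \<inter> U. y \<noteq> 0 \<and> v i \<bullet> y \<le> 0 \<and> v j \<bullet> y \<le> 0"
    define V where "V = {t. (0, t) \<in> U}"
    have V: "subspace V"
      unfolding subspace_def V_def
      using subspace_0[OF U] subspace_add[OF U] subspace_scale[OF U]
      by (auto simp: zero_prod_def) (metis add_0 add_Pair, metis mult_zero_right scaleR_Pair real_scaleR_def)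
    have pw1: "\<exists>s. norm s \<le> 1 \<and> (1, s) \<in> U \<and> v i \<bullet> (1, s) \<le> 0 \<and> v j \<bullet> (1, s) \<le> 0"
      if ij: "i \<in> I" "j \<in> I" for i j
    proof -
      obtain y where y: "y \<in> lorentz_cone" "y \<in> U" "y \<noteq> 0" "v i \<bullet> y \<le> 0" "v j \<bullet> y \<le> 0"
        using pw ij by blast
      have pos: "0 < fst y" using lorentz_cone_fst_pos y by blast
      define s where "s = (1 / fst y) *\<^sub>R snd y"
      have e: "(1, s) = (1 / fst y) *\<^sub>R y" using pos by (simp add: s_def prod_eq_iff)
      have "norm s \<le> 1" using pos y(1) by (auto simp: s_def lorentz_cone_def)
      moreover have "(1, s) \<in> U" unfolding e using U y by (simp add: subspace_scale)
      moreover have "v l \<bullet> (1, s) \<le> 0" if "v l \<bullet> y \<le> 0" for l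
        unfolding e using pos that by (simp add: divide_nonpos_pos)
      ultimately show ?thesis using y by blast
    qed
    have "I \<noteq> {}" using I by auto
    then obtain s1 where s1: "norm s1 \<le> 1" "(1, s1) \<in> U" using pw1 by blast
    \<comment> \<open>The component \<open>s0\<close> orthogonal to \<open>V\<close> is the centre
      of the slice; Pythagoras then yields its radius.\<close>
    obtain s0 s2 where s02: "s2 \<in> span V" "\<And>t. t \<in> span V \<Longrightarrow> orthogonal s0 t" "s1 = s2 + s0"
      using orthogonal_subspace_decomp_exists[of V s1] by metis
    have spV: "span V = V" using V by (simp add: span_eq_iff)
    have s0U: "(1, s0) \<in> U"
    proof -
      have "(1, s1) - (0, s2) \<in> U"
        using s1 s02(1)[unfolded spV] U by (intro subspace_diff) (auto simp: V_def)
      then show ?thesis using s02(3) by simp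
    qed
    have dec: "(norm (s0 + t))\<^sup>2 = (norm s0)\<^sup>2 + (norm t)\<^sup>2" if "t \<in> V" for t
      using s02(2) that spV by (intro norm_add_Pythagorean) auto
    have ns0: "(norm s0)\<^sup>2 \<le> 1"
    proof -
      have "(norm s0)\<^sup>2 \<le> (norm s1)\<^sup>2" using dec[of s2] s02 spV by (simp add: add.commute)
      also have "\<dots> \<le> 1" using s1 by (simp add: power_le_one)
      finally show ?thesis .
    qed
    \<comment> \<open>The radius may be 0; the slice is then a single point, parametrized by
      \<open>t = 0\<close>.\<close>
    define \<rho> where "\<rho> = sqrt (1 - (norm s0)\<^sup>2)"
    have \<rho>: "0 \<le> \<rho>" "\<rho>\<^sup>2 = 1 - (norm s0)\<^sup>2" using ns0 by (auto simp: \<rho>_def)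
    have param: "\<exists>t\<in>V. norm t \<le> 1 \<and> s = s0 + \<rho> *\<^sub>R t" if s: "norm s \<le> 1" "(1, s) \<in> U" for s
    proof -
      have "(1, s) - (1, s0) \<in> U" using s s0U U by (intro subspace_diff) auto
      then have d: "s - s0 \<in> V" by (simp add: V_def)
      have "(norm s)\<^sup>2 = (norm s0)\<^sup>2 + (norm (s - s0))\<^sup>2" using dec[OF d] by simp
      moreover have "(norm s)\<^sup>2 \<le> 1" using s(1) by (simp add: power_le_one)
      ultimately have "(norm (s - s0))\<^sup>2 \<le> \<rho>\<^sup>2" using \<rho> by simp
      then have nd: "norm (s - s0) \<le> \<rho>" using \<rho>(1) by (rule power2_le_imp_le)
      show ?thesis
      proof (cases "\<rho> = 0")
        case True
        then show ?thesis using nd V by (intro bexI[of _ 0]) (auto simp: subspace_0)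
      next
        case False
        then show ?thesis using nd d V \<rho>(1)
          by (intro bexI[of _ "(1/\<rho>) *\<^sub>R (s - s0)"]) (auto simp: subspace_scale)
      qed
    qed
    \<comment> \<open>The normals have to lie in \<open>V\<close>; projecting them orthogonally does
      not change their values there.\<close>
    have "\<exists>w'\<in>V. \<forall>t\<in>V. snd (v i) \<bullet> t = w' \<bullet> t" for i
    proof -
      obtain w' w'' where "w' \<in> span V" "\<And>t. t \<in> span V \<Longrightarrow> orthogonal w'' t" "snd (v i) = w' + w''"
        using orthogonal_subspace_decomp_exists[of V "snd (v i)"] by metis
      then show ?thesis unfolding spV
        by (intro bexI[of _ w']) (auto simp: inner_add_left orthogonal_def)
    qed
    then obtain w' where w': "\<And>i. w' i \<in> V" "\<And>i t. t \<in> V \<Longrightarrow> snd (v i) \<bullet> t = w' i \<bullet> t" by metis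
    define w where "w i = \<rho> *\<^sub>R w' i" for i
    define \<alpha> where "\<alpha> i = v i \<bullet> (1, s0)" for i
    have ev: "v i \<bullet> (1, s0 + \<rho> *\<^sub>R t) = \<alpha> i + w i \<bullet> t" if "t \<in> V" for i t
      using w'(2)[OF that, of i] by (simp add: w_def \<alpha>_def inner_prod_def inner_add_right)
    have "\<exists>t\<in>V. norm t \<le> 1 \<and> m < card {i\<in>I. \<alpha> i + w i \<bullet> t \<le> 0}"
    proof (rule N[rule_format], intro conjI)
      show "subspace V" "finite I" "N * m < card I" by (fact V I)+
      show "w ` I \<subseteq> V" using w'(1) V by (auto simp: w_def subspace_scale)
      show "\<forall>i\<in>I. \<forall>j\<in>I. \<exists>t\<in>V. norm t \<le> 1 \<and> \<alpha> i + w i \<bullet> t \<le> 0 \<and> \<alpha> j + w j \<bullet> t \<le> 0"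
      proof (intro ballI)
        fix i j assume "i \<in> I" "j \<in> I"
        then obtain s where s: "norm s \<le> 1" "(1, s) \<in> U" "v i \<bullet> (1, s) \<le> 0" "v j \<bullet> (1, s) \<le> 0"
          using pw1 by blast
        obtain t where t: "t \<in> V" "norm t \<le> 1" "s = s0 + \<rho> *\<^sub>R t" using param[OF s(1,2)] by blast
        show "\<exists>t\<in>V. norm t \<le> 1 \<and> \<alpha> i + w i \<bullet> t \<le> 0 \<and> \<alpha> j + w j \<bullet> t \<le> 0"
          using s(3,4) t(2) ev[OF t(1)] unfolding t(3) by (intro bexI[OF _ t(1)]) simp
      qed
    qed
    then obtain t where t: "t \<in> V" "norm t \<le> 1" "m < card {i\<in>I. \<alpha> i + w i \<bullet> t \<le> 0}" by blast
    define x where "x = (1::real, s0 + \<rho> *\<^sub>R t)"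
    have "(1, s0) + \<rho> *\<^sub>R (0, t) \<in> U"
      using t(1) s0U U unfolding V_def by (intro subspace_add subspace_scale) auto
    then have "x \<in> U" by (simp add: x_def)
    moreover have "norm (s0 + \<rho> *\<^sub>R t) \<le> 1"
    proof (rule power2_le_imp_le)
      have "(norm (s0 + \<rho> *\<^sub>R t))\<^sup>2 = (norm s0)\<^sup>2 + \<rho>\<^sup>2 * (norm t)\<^sup>2"
        using dec[of "\<rho> *\<^sub>R t"] t(1) V by (simp add: subspace_scale power_mult_distrib)
      also have "\<dots> \<le> (norm s0)\<^sup>2 + \<rho>\<^sup>2 * 1"
        using t(2) by (intro add_left_mono mult_left_mono) (auto simp: power_le_one)
      finally show "(norm (s0 + \<rho> *\<^sub>R t))\<^sup>2 \<le> 1\<^sup>2" using \<rho> by simp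
    qed simp
    then have "x \<in> lorentz_cone" by (simp add: x_def lorentz_cone_def)
    moreover have "x \<noteq> 0" by (simp add: x_def zero_prod_def)
    moreover have "m < card {i\<in>I. v i \<bullet> x \<le> 0}" using t(3) ev[OF t(1)] by (simp add: x_def)
    ultimately show "\<exists>x\<in>lorentz_cone \<inter> U. x \<noteq> 0 \<and> m < card {i\<in>I. v i \<bullet> x \<le> 0}" by blast
  qed
qed

section \<open>Neighborly vector configurations\<close>

definition pair_cover :: "nat set \<Rightarrow> nat set" where
  "pair_cover A = A \<union> Suc ` A"

text \<open>Gale's evenness condition: \<open>A\<close> holds the smaller elements of
  \<open>k\<close> disjoint pairs of consecutive indices below \<open>n\<close>, and such pairs form
  a facet of the cyclic polytope of dimension \<open>2 * k\<close>.\<close>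

definition pair_set :: "nat \<Rightarrow> nat \<Rightarrow> nat set \<Rightarrow> bool" where
  "pair_set k n A \<longleftrightarrow> card A = k \<and> finite A \<and> (\<forall>s\<in>A. Suc s < n \<and> Suc s \<notin> A)"

lemma sign_change_adjacent:
  fixes f :: "nat \<Rightarrow> real"
  assumes "f a \<le> 0" "0 < f b" "a \<in> {l..<u}" "b \<in> {l..<u}"
  obtains s where "l \<le> s" "Suc s < u"
    "f s \<le> 0 \<and> 0 < f (Suc s) \<or> 0 < f s \<and> f (Suc s) \<le> 0"
proof -
  have "\<exists>s. l \<le> s \<and> Suc s < u \<and> (f s \<le> 0 \<and> 0 < f (Suc s) \<or> 0 < f s \<and> f (Suc s) \<le> 0)"
  proof (rule ccontr)
    assume no: "\<not> ?thesis"
    have step: "f (Suc s) \<le> 0 \<longleftrightarrow> f s \<le> 0" if "l \<le> s" "Suc s < u" for s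
      using no that by (metis not_less)
    have "f t \<le> 0 \<longleftrightarrow> f l \<le> 0" if "l \<le> t" "t < u" for t
      using that by (induction t rule: dec_induct) (auto simp: step)
    then show False using assms by (metis atLeastLessThan_iff not_less)
  qed
  then show ?thesis using that by blast
qed

text \<open>The family may repeat a vector; two equal members then provide the relation.\<close>

lemma linear_relation_exists:
  fixes q :: "nat \<Rightarrow> 'a::euclidean_space"
  assumes "finite B" "q ` B \<subseteq> H" "subspace H" "dim H < card B"
  obtains c where "(\<Sum>b\<in>B. c b *\<^sub>R q b) = 0" "\<exists>b\<in>B. c b \<noteq> 0"
proof (cases "inj_on q B")
  case True
  have "dependent (q ` B)"
    using assms dependent_biggerset_general[of "q ` B"] dim_subset[OF assms(2)] card_image[OF True] by auto
  then obtain w where w: "(\<Sum>x\<in>q ` B. w x *\<^sub>R x) = 0" "\<exists>x\<in>q ` B. w x \<noteq> 0"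
    using dependent_finite[of "q ` B"] assms(1) by auto
  have "(\<Sum>b\<in>B. w (q b) *\<^sub>R q b) = 0" using w(1) by (simp add: sum.reindex[OF True])
  then show ?thesis using that[of "\<lambda>b. w (q b)"] w(2) by blast
next
  case False
  then obtain a b where ab: "a \<in> B" "b \<in> B" "a \<noteq> b" "q a = q b" by (auto simp: inj_on_def)
  define c where "c i = (if i = a then 1 else if i = b then -1 else (0::real))" for i
  have "(\<Sum>i\<in>B. c i *\<^sub>R q i) = (\<Sum>i\<in>{a,b}. c i *\<^sub>R q i)"
    using ab assms(1) by (intro sum.mono_neutral_right) (auto simp: c_def)
  also have "\<dots> = 0" using ab by (simp add: c_def)
  finally have "(\<Sum>i\<in>B. c i *\<^sub>R q i) = 0" .
  moreover have "c a \<noteq> 0" by (simp add: c_def)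
  ultimately show ?thesis using that[of c] ab(1) by blast
qed

text \<open>A linear relation among at most \<open>2 * k + 1\<close> vectors has at most \<open>k\<close> coefficients of one
  sign, and these can be killed by a functional that is positive on the remaining vectors.\<close>

lemma no_relation_if_neighborly:
  fixes q :: "nat \<Rightarrow> 'a::euclidean_space"
  assumes B: "finite B" "card B = 2 * k + 1" and H: "q ` B \<subseteq> H" "subspace H" "dim H \<le> 2 * k"
    and z: "\<And>T. T \<subseteq> B \<Longrightarrow> card T = k \<Longrightarrow>
      \<exists>z. (\<forall>b\<in>T. q b \<bullet> z = 0) \<and> (\<forall>b\<in>B - T. 0 < q b \<bullet> z)"
  shows False
proof -
  obtain c0 where c0: "(\<Sum>b\<in>B. c0 b *\<^sub>R q b) = 0" "\<exists>b\<in>B. c0 b \<noteq> 0"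
    using linear_relation_exists[OF B(1) H(1,2)] B(2) H(3) by (metis le_imp_less_Suc Suc_eq_plus1)
  have "\<exists>c. (\<Sum>b\<in>B. c b *\<^sub>R q b) = 0 \<and> card {b\<in>B. 0 < c b} \<le> k \<and> (\<exists>b\<in>B. c b < (0::real))"
  proof -
    define P M where "P = {b\<in>B. 0 < c0 b}" and "M = {b\<in>B. c0 b < 0}"
    have "card P + card M = card (P \<union> M)"
      using B(1) by (subst card_Un_disjoint) (auto simp: P_def M_def)
    also have "\<dots> \<le> 2 * k + 1" unfolding B(2)[symmetric] by (rule card_mono) (auto simp: P_def M_def B(1))
    finally have PM: "card P + card M \<le> 2 * k + 1" .
    have neg: "(\<Sum>b\<in>B. (- c0 b) *\<^sub>R q b) = 0" using c0(1) by (simp add: sum_negf)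
    have fin: "finite P" "finite M" using B(1) by (auto simp: P_def M_def)
    have PM0: "P \<noteq> {} \<or> M \<noteq> {}"
      using c0(2) by (auto simp: P_def M_def) (metis linorder_neqE_linordered_idom)
    consider "card P \<le> k" "M \<noteq> {}" | "card M \<le> k" "P \<noteq> {}"
      using PM PM0 fin by (cases "M = {}"; cases "P = {}") (auto, linarith)
    then show ?thesis
    proof cases
      case 1
      then show ?thesis using c0(1) by (intro exI[of _ c0]) (auto simp: P_def M_def)
    next
      case 2
      then show ?thesis using neg by (intro exI[of _ "\<lambda>b. - c0 b"]) (auto simp: P_def M_def)
    qed
  qed
  then obtain c b0 where c: "(\<Sum>b\<in>B. c b *\<^sub>R q b) = 0" "card {b\<in>B. 0 < c b} \<le> k" and b0: "b0 \<in> B" "c b0 < 0"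
    by blast
  \<comment> \<open>The positive indices are filled up to exactly \<open>k\<close> elements but
    without \<open>b0\<close>, whose strictly negative term then survives.\<close>
  have "{b\<in>B. 0 < c b} \<subseteq> B - {b0}" using b0 by auto
  moreover have "k \<le> card (B - {b0})" using B b0 by simp
  ultimately obtain T where T: "{b\<in>B. 0 < c b} \<subseteq> T" "T \<subseteq> B - {b0}" "card T = k"
    using exists_subset_between[of "{b\<in>B. 0 < c b}" k "B - {b0}"] c(2) B(1) by auto
  obtain z0 where z0: "\<And>b. b \<in> T \<Longrightarrow> q b \<bullet> z0 = 0" "\<And>b. b \<in> B - T \<Longrightarrow> 0 < q b \<bullet> z0"
    using z[of T] T by blast
  have "(\<Sum>b\<in>B. c b * (q b \<bullet> z0)) = (\<Sum>b\<in>B. c b *\<^sub>R q b) \<bullet> z0" by (simp add: inner_sum_left)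
  also have "\<dots> = 0" using c(1) by simp
  finally have "(\<Sum>b\<in>B. c b * (q b \<bullet> z0)) = 0" .
  moreover have "(\<Sum>b\<in>B. c b * (q b \<bullet> z0)) < 0"
  proof -
    have le: "c b * (q b \<bullet> z0) \<le> 0" if "b \<in> B" for b
      using that T(1) z0[of b] by (cases "b \<in> T") (auto intro!: mult_nonpos_nonneg)
    have "0 < q b0 \<bullet> z0" using z0(2)[of b0] b0 T(2) by blast
    then have "c b0 * (q b0 \<bullet> z0) < 0" using b0 by (simp add: mult_neg_pos)
    then show ?thesis using sum_strict_mono_ex1[of B "\<lambda>b. c b * (q b \<bullet> z0)" "\<lambda>_. 0"] le B(1) b0(1) by auto
  qed
  ultimately show False by simp
qed

lemma dim_Int_hyperplane_less:
  fixes H :: "'a::euclidean_space set"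
  assumes "subspace H" "v \<in> H" "v \<bullet> x \<noteq> 0"
  shows "dim (H \<inter> {y. y \<bullet> x = 0}) < dim H"
proof -
  have "subspace {y. y \<bullet> x = 0}" by (auto simp: subspace_def inner_add_left)
  then have "span (H \<inter> {y. y \<bullet> x = 0}) = H \<inter> {y. y \<bullet> x = 0}"
    using assms(1) by (simp only: span_eq_iff subspace_inter)
  moreover have "span H = H" using assms(1) by (simp only: span_eq_iff)
  moreover have "H \<inter> {y. y \<bullet> x = 0} \<subset> H" using assms(2,3) by blast
  ultimately have "span (H \<inter> {y. y \<bullet> x = 0}) \<subset> span H" by (simp only:)
  then show ?thesis by (rule dim_psubset)
qed

lemma card_pair_cover:
  assumes "pair_set k n A"
  shows "card (pair_cover A) = 2 * k"
proof -
  have "A \<inter> Suc ` A = {}" "finite A" "card A = k" using assms by (auto simp: pair_set_def)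
  then show ?thesis unfolding pair_cover_def by (simp add: card_Un_disjoint card_image)
qed

lemma pair_set_interval:
  assumes "l + 2 * k \<le> n" "0 < k"
  shows "pair_set k n ((\<lambda>r. l + 2 * r) ` {..<k})"
    and "pair_cover ((\<lambda>r. l + 2 * r) ` {..<k}) = {l..<l + 2 * k}"
proof -
  have "inj_on (\<lambda>r. l + 2 * r) {..<k}" by (auto simp: inj_on_def)
  then show "pair_set k n ((\<lambda>r. l + 2 * r) ` {..<k})"
    using assms by (auto simp: pair_set_def card_image) presburger
  show "pair_cover ((\<lambda>r. l + 2 * r) ` {..<k}) = {l..<l + 2 * k}"
  proof (intro equalityI subsetI)
    fix t assume t: "t \<in> {l..<l + 2 * k}"
    have "t = l + 2 * ((t - l) div 2) \<or> t = Suc (l + 2 * ((t - l) div 2))" using t by auto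
    moreover have "(t - l) div 2 < k" using t by auto
    ultimately show "t \<in> pair_cover ((\<lambda>r. l + 2 * r) ` {..<k})" unfolding pair_cover_def by blast
  qed (auto simp: pair_cover_def)
qed

text \<open>Finitely many constraints with slack tolerate a small step in any direction, so only the
  active ones restrict it.\<close>

lemma small_perturbation_nonneg:
  fixes f g :: "'b \<Rightarrow> real"
  assumes "finite J" "\<And>i. i \<in> J \<Longrightarrow> 0 \<le> f i" "\<And>i. i \<in> J \<Longrightarrow> f i = 0 \<Longrightarrow> 0 \<le> g i"
  obtains \<epsilon> where "0 < \<epsilon>" "\<And>i. i \<in> J \<Longrightarrow> 0 \<le> f i + \<epsilon> * g i"
proof -
  have "\<exists>\<epsilon>>0. \<forall>i\<in>J. 0 \<le> f i + \<epsilon> * g i"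
    using assms
  proof (induction J rule: finite_induct)
    case empty
    then show ?case by (intro exI[of _ 1]) auto
  next
    case (insert l J)
    then obtain \<epsilon> where \<epsilon>: "0 < \<epsilon>" "\<forall>i\<in>J. 0 \<le> f i + \<epsilon> * g i" by auto
    have shrink: "0 \<le> f i + \<delta> * g i" if "i \<in> J" "0 < \<delta>" "\<delta> \<le> \<epsilon>" for i \<delta>
    proof (cases "0 \<le> g i")
      case True
      then show ?thesis using insert.prems(1)[of i] that by simp
    next
      case False
      then have "\<epsilon> * g i \<le> \<delta> * g i" using that by (intro mult_right_mono_neg) auto
      then show ?thesis using \<epsilon>(2) that(1) by fastforce
    qed
    show ?case
    proof (cases "f l = 0")
      case True
      then show ?thesis using \<epsilon> insert.prems(2)[of l] by (intro exI[of _ \<epsilon>]) auto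
    next
      case False
      then have fl: "0 < f l" using insert.prems(1)[of l] by simp
      define \<delta> where "\<delta> = min \<epsilon> (f l / (\<bar>g l\<bar> + 1))"
      have \<delta>: "0 < \<delta>" "\<delta> \<le> \<epsilon>" "\<delta> \<le> f l / (\<bar>g l\<bar> + 1)"
        using \<epsilon>(1) fl by (auto simp: \<delta>_def intro!: divide_pos_pos)
      have "\<delta> * (\<bar>g l\<bar> + 1) \<le> f l" using \<delta>(3) by (subst (asm) pos_le_divide_eq) auto
      then have "\<delta> * \<bar>g l\<bar> \<le> f l" using \<delta>(1) by (simp add: algebra_simps)
      moreover have "- (\<delta> * \<bar>g l\<bar>) \<le> \<delta> * g l"
        using \<delta>(1) mult_left_mono[of "- \<bar>g l\<bar>" "g l" \<delta>] by simp
      ultimately have "0 \<le> f l + \<delta> * g l" by linarith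
      then show ?thesis using \<delta> shrink by (intro exI[of _ \<delta>]) auto
    qed
  qed
  then show ?thesis using that by blast
qed

text \<open>Read \<open>v\<close> as the facet normals of a dual cyclic cone with vertices \<open>z A\<close>, and \<open>a A\<close> as the
  normal of a hyperplane that supports it at \<open>z A\<close> and avoids the Lorentz cone. The last hypothesis
  says that the intersection of any two facets cuts it. The indices are divided into \<open>m\<close> blocks of
  length \<open>4 * k\<close>, since a block is to contain two disjoint sets of \<open>2 * k\<close> consecutive ones.\<close>

lemma lorentz_cone_obstruction:
  fixes k :: nat
  assumes k: "0 < k"
  shows "\<exists>m::nat>0. \<forall>(U::(real \<times> 'a::euclidean_space) set) H v z a.
    \<not> (subspace U \<and> subspace H \<and> dim H \<le> 2 * k + 1 \<and>
      (\<forall>i<m * (4 * k). v i \<in> H) \<and>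
      (\<forall>A. pair_set k (m * (4 * k)) A \<longrightarrow>
        z A \<in> U \<and> (\<forall>i<m * (4 * k). if i \<in> pair_cover A then v i \<bullet> z A = 0 else 0 < v i \<bullet> z A) \<and>
        a A \<in> lorentz_cone \<and> (\<exists>x\<in>U. a A \<bullet> x \<noteq> 0) \<and>
        (\<forall>x\<in>U. (\<forall>i\<in>pair_cover A. 0 \<le> v i \<bullet> x) \<longrightarrow> 0 \<le> a A \<bullet> x)) \<and>
      (\<forall>i<m * (4 * k). \<forall>j<m * (4 * k). \<exists>y\<in>lorentz_cone \<inter> U. y \<noteq> 0 \<and> v i \<bullet> y = 0 \<and> v j \<bullet> y = 0))"
proof -
  obtain N :: nat where N: "\<forall>(U::(real \<times> 'a) set) (v::nat \<Rightarrow> real \<times> 'a) I m.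
    subspace U \<and> finite I \<and> N * m < card I \<and>
    (\<forall>i\<in>I. \<forall>j\<in>I. \<exists>y\<in>lorentz_cone \<inter> U. y \<noteq> 0 \<and> v i \<bullet> y \<le> 0 \<and> v j \<bullet> y \<le> 0) \<longrightarrow>
    (\<exists>x\<in>lorentz_cone \<inter> U. x \<noteq> 0 \<and> m < card {i\<in>I. v i \<bullet> x \<le> 0})"
    using lorentz_cone_Int_subspace_pierced[where 'a='a and 'b=nat] by blast
  \<comment> \<open>With one facet from each block, piercing more than \<open>2 * k\<close> caps
    leaves the \<open>2 * k + 1\<close> blocks needed for a linear relation.\<close>
  define m where "m = N * (2 * k) + 1"
  define n where "n = m * (4 * k)"
  have False
    if core: "\<forall>A. pair_set k n A \<longrightarrow>
        z A \<in> U \<and> (\<forall>i<n. if i \<in> pair_cover A then v i \<bullet> z A = 0 else 0 < v i \<bullet> z A) \<and>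
        a A \<in> lorentz_cone \<and> (\<exists>x\<in>U. a A \<bullet> x \<noteq> 0) \<and>
        (\<forall>x\<in>U. (\<forall>i\<in>pair_cover A. 0 \<le> v i \<bullet> x) \<longrightarrow> 0 \<le> a A \<bullet> x)"
      and H: "dim H \<le> 2 * k + 1" "subspace H" and vH': "\<forall>i<n. v i \<in> H" and U: "subspace U"
      and y': "\<forall>i<n. \<forall>j<n. \<exists>y\<in>lorentz_cone \<inter> U. y \<noteq> 0 \<and> v i \<bullet> y = 0 \<and> v j \<bullet> y = 0"
    for U H :: "(real \<times> 'a) set" and v :: "nat \<Rightarrow> real \<times> 'a" and z a :: "nat set \<Rightarrow> real \<times> 'a"
  proof -
    note vH = vH'[rule_format] and y = y'[rule_format]
    have zU: "z A \<in> U"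
      and vz: "i < n \<Longrightarrow> if i \<in> pair_cover A then v i \<bullet> z A = 0 else 0 < v i \<bullet> z A"
      and aL: "a A \<in> lorentz_cone" and aU: "\<exists>x\<in>U. a A \<bullet> x \<noteq> 0"
      and ax: "x \<in> U \<Longrightarrow> (\<forall>i\<in>pair_cover A. 0 \<le> v i \<bullet> x) \<Longrightarrow> 0 \<le> a A \<bullet> x"
      if "pair_set k n A" for A i x
      using core[THEN spec, THEN mp, OF that] by blast+
    \<comment> \<open>Only the first facet of each block is used for the piercing; it also provides
      the nonpositive end of the sign change.\<close>
    define w where "w b = b * (4 * k)" for b
    have blk: "b * (4 * k) + 4 * k \<le> n" if "b < m" for b
    proof -
      have "Suc b * (4 * k) \<le> m * (4 * k)" using that by (intro mult_le_mono1) auto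
      then show ?thesis by (simp add: n_def)
    qed
    have wn: "w b < n" if "b < m" for b using blk[OF that] k by (simp add: w_def)
    have "\<exists>x\<in>lorentz_cone \<inter> U. x \<noteq> 0 \<and> 2 * k < card {b\<in>{..<m}. v (w b) \<bullet> x \<le> 0}"
    proof (rule N[rule_format, of U "{..<m}" "2 * k" "\<lambda>b. v (w b)"], intro conjI ballI)
      fix b b' assume "b \<in> {..<m}" "b' \<in> {..<m}"
      then show "\<exists>y\<in>lorentz_cone \<inter> U. y \<noteq> 0 \<and> v (w b) \<bullet> y \<le> 0 \<and> v (w b') \<bullet> y \<le> 0"
        using y[of "w b" "w b'"] wn by fastforce
    qed (use U in \<open>auto simp: m_def\<close>)
    then obtain x where x: "x \<in> lorentz_cone" "x \<in> U" "x \<noteq> 0"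
      and xc: "2 * k < card {b\<in>{..<m}. v (w b) \<bullet> x \<le> 0}" by blast
    obtain B where B: "B \<subseteq> {b\<in>{..<m}. v (w b) \<bullet> x \<le> 0}" "card B = 2 * k + 1" "finite B"
      using obtain_subset_with_card_n[of "2 * k + 1" "{b\<in>{..<m}. v (w b) \<bullet> x \<le> 0}"] xc by auto
    have ax0: "a A \<bullet> x = 0" if A: "pair_set k n A" and neg: "\<forall>i\<in>pair_cover A. v i \<bullet> x \<le> 0" for A
    proof -
      have "0 \<le> a A \<bullet> (- x)" using ax[OF A, of "- x"] x(2) U neg by (simp add: subspace_neg)
      then show ?thesis using lorentz_cone_inner_nonneg[OF aL[OF A] x(1)] by simp
    qed
    have blkpos: "\<exists>i\<in>{b * (4 * k)..<b * (4 * k) + 4 * k}. 0 < v i \<bullet> x" if b: "b < m" for b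
    proof (rule ccontr)
      assume "\<not> ?thesis"
      then have neg: "v i \<bullet> x \<le> 0" if "i \<in> {w b..<w b + 4 * k}" for i using that by (auto simp: w_def not_less)
      define A1 A2 where "A1 = (\<lambda>r. w b + 2 * r) ` {..<k}" and "A2 = (\<lambda>r. (w b + 2 * k) + 2 * r) ` {..<k}"
      have A1: "pair_set k n A1" "pair_cover A1 = {w b..<w b + 2 * k}"
        using pair_set_interval[of "w b" k n] k blk[OF b] by (auto simp: A1_def w_def)
      have A2: "pair_set k n A2" "pair_cover A2 = {w b + 2 * k..<w b + 2 * k + 2 * k}"
        using pair_set_interval[of "w b + 2 * k" k n] k blk[OF b] by (auto simp: A2_def w_def)
      have z1: "v i \<bullet> z A1 = 0" if "i \<in> pair_cover A1" for i
        using vz[OF A1(1), of i] that A1(2) blk[OF b] k by (auto simp: w_def)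
      have z2: "0 < v i \<bullet> z A1" if "i \<in> pair_cover A2" for i
        using vz[OF A1(1), of i] that A1(2) A2(2) blk[OF b] k by (auto simp: w_def)
      have nz: "a A1 \<noteq> 0" "a A2 \<noteq> 0" using aU[OF A1(1)] aU[OF A2(1)] by auto
      have "a A1 \<bullet> x = 0" "a A2 \<bullet> x = 0"
        using ax0[OF A1(1)] ax0[OF A2(1)] neg A1(2) A2(2) by auto
      then obtain c where c: "a A2 = c *\<^sub>R a A1"
        using lorentz_cone_orthogonal_unique[OF aL[OF A1(1)] nz(1) aL[OF A2(1)] nz(2) x(1,3)] by blast
      have "0 \<le> a A1 \<bullet> z A1" "0 \<le> a A1 \<bullet> (- z A1)"
        using ax[OF A1(1), of "z A1"] ax[OF A1(1), of "- z A1"] z1 zU[OF A1(1)] U by (auto simp: subspace_neg)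
      then have az: "a A2 \<bullet> z A1 = 0" using c by simp
      \<comment> \<open>At the vertex \<open>z A1\<close> all constraints in \<open>A2\<close> are
        strict. The functional \<open>a A2\<close> vanishes there and is nonnegative nearby in
        \<open>U\<close>, hence it is zero on \<open>U\<close>.\<close>
      have "0 \<le> a A2 \<bullet> e" if e: "e \<in> U" for e
      proof -
        have "finite (pair_cover A2)" using A2(2) by simp
        then obtain \<epsilon> where eps: "0 < \<epsilon>"
          and nonneg: "\<And>i. i \<in> pair_cover A2 \<Longrightarrow> 0 \<le> v i \<bullet> z A1 + \<epsilon> * (v i \<bullet> e)"
          using small_perturbation_nonneg[of "pair_cover A2" "\<lambda>i. v i \<bullet> z A1" "\<lambda>i. v i \<bullet> e"]
            z2 less_imp_le less_irrefl by metis
        then have "\<forall>i\<in>pair_cover A2. 0 \<le> v i \<bullet> (z A1 + \<epsilon> *\<^sub>R e)"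
          by (simp add: inner_add_right)
        then have "0 \<le> a A2 \<bullet> (z A1 + \<epsilon> *\<^sub>R e)"
          using ax[OF A2(1)] zU[OF A1(1)] e U by (simp add: subspace_add subspace_scale)
        then show ?thesis using az eps by (simp add: inner_add_right zero_le_mult_iff)
      qed
      then have "a A2 \<bullet> e = 0" if "e \<in> U" for e
        using that U subspace_neg[OF U that] by (metis inner_minus_right neg_0_le_iff_le order_antisym)
      then show False using aU[OF A2(1)] by blast
    qed
    have "\<exists>s. w b \<le> s \<and> Suc s < w b + 4 * k \<and>
        (v s \<bullet> x \<le> 0 \<and> 0 < v (Suc s) \<bullet> x \<or> 0 < v s \<bullet> x \<and> v (Suc s) \<bullet> x \<le> 0)" if b: "b \<in> B" for b
    proof -
      obtain i where i: "i \<in> {w b..<w b + 4 * k}" "0 < v i \<bullet> x"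
      proof -
        have "b < m" using b B(1) by auto
        then show ?thesis using blkpos[of b] that unfolding w_def by blast
      qed
      have "v (w b) \<bullet> x \<le> 0" "w b \<in> {w b..<w b + 4 * k}" using b B(1) k by auto
      then show ?thesis using sign_change_adjacent[of "\<lambda>i. v i \<bullet> x" "w b" i "w b" "w b + 4 * k"] i by metis
    qed
    then obtain s where s: "\<And>b. b \<in> B \<Longrightarrow> w b \<le> s b" "\<And>b. b \<in> B \<Longrightarrow> Suc (s b) < w b + 4 * k"
      "\<And>b. b \<in> B \<Longrightarrow> v (s b) \<bullet> x \<le> 0 \<and> 0 < v (Suc (s b)) \<bullet> x \<or> 0 < v (s b) \<bullet> x \<and> v (Suc (s b)) \<bullet> x \<le> 0"
      by metis
    \<comment> \<open>Crossing the two absolute values makes the combination orthogonal to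
      \<open>x\<close>, as the signs differ; at least one weight is positive.\<close>
    define q where "q b = \<bar>v (Suc (s b)) \<bullet> x\<bar> *\<^sub>R v (s b) + \<bar>v (s b) \<bullet> x\<bar> *\<^sub>R v (Suc (s b))" for b
    have sn: "Suc (s b) < n" if "b \<in> B" for b
      using s(2)[OF that] blk[of b] that B(1) by (auto simp: w_def)
    have qx: "q b \<bullet> x = 0" if "b \<in> B" for b
      using s(3)[OF that] by (auto simp: q_def inner_add_left)
    have qH: "q b \<in> H" if "b \<in> B" for b
      unfolding q_def using sn[OF that] vH H(2) by (intro subspace_add subspace_scale) auto
    \<comment> \<open>Pairs from distinct blocks are disjoint, so any \<open>k\<close> of them form
      a \<open>pair_set\<close>.\<close>
    have sep: "Suc (s b) < s b'" if "b \<in> B" "b' \<in> B" "b < b'" for b b'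
    proof -
      have "Suc b * (4 * k) \<le> b' * (4 * k)" using that by (intro mult_le_mono1) auto
      then have "w b + 4 * k \<le> w b'" by (simp add: w_def)
      then show ?thesis using s(1)[OF that(2)] s(2)[OF that(1)] by linarith
    qed
    have sep': "s b \<noteq> s b'" "Suc (s b) \<noteq> s b'" if "b \<in> B" "b' \<in> B" "b \<noteq> b'" for b b'
      using sep[of b b'] sep[of b' b] that by (cases "b < b'"; force)+
    show False
    proof (rule no_relation_if_neighborly[OF B(3,2)])
      show "q ` B \<subseteq> H \<inter> {y. y \<bullet> x = 0}" using qH qx by auto
      have "subspace {y. y \<bullet> x = 0}" by (auto simp: subspace_def inner_add_left)
      then show "subspace (H \<inter> {y. y \<bullet> x = 0})" using H(2) by (rule subspace_inter[rotated])
      \<comment> \<open>Some normal is positive at \<open>x\<close>, so the hyperplane orthogonal to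
        \<open>x\<close> cuts the dimension of \<open>H\<close> down to
        \<open>2 * k\<close>.\<close>
      obtain b where b: "b \<in> B" using B(2) by fastforce
      then obtain i where "i < n" "0 < v i \<bullet> x" using s(3)[OF b] sn[OF b] by (metis Suc_lessD)
      then show "dim (H \<inter> {y. y \<bullet> x = 0}) \<le> 2 * k"
        using dim_Int_hyperplane_less[OF H(2) vH[of i], of x] H(1) by auto
      fix T assume T: "T \<subseteq> B" "card T = k"
      define A where "A = s ` T"
      have "inj_on s T" using sep'(1) T(1) by (meson inj_onI subsetD)
      then have A: "pair_set k n A"
        using T sn sep'(2) finite_subset[OF T(1) B(3)] unfolding pair_set_def A_def
        by (auto simp: card_image subset_iff) (metis n_not_Suc_n)
      have "q b \<bullet> z A = 0" if "b \<in> T" for b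
        using vz[OF A, of "s b"] vz[OF A, of "Suc (s b)"] that sn[of b] T(1)
        by (auto simp: q_def inner_add_left pair_cover_def A_def subset_iff)
      moreover have "0 < q b \<bullet> z A" if b: "b \<in> B - T" for b
      proof -
        have n1: "s b \<notin> pair_cover A" "Suc (s b) \<notin> pair_cover A"
          using sep' b T(1) by (auto simp: pair_cover_def A_def) (metis subsetD)+
        then have p: "0 < v (s b) \<bullet> z A" "0 < v (Suc (s b)) \<bullet> z A"
          using vz[OF A, of "s b"] vz[OF A, of "Suc (s b)"] b sn[of b] by auto
        have "v (s b) \<bullet> x \<le> 0 \<and> 0 < v (Suc (s b)) \<bullet> x \<or> 0 < v (s b) \<bullet> x \<and> v (Suc (s b)) \<bullet> x \<le> 0"
          using s(3)[of b] b by blast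
        then show ?thesis
        proof (elim disjE conjE)
          assume "0 < v (Suc (s b)) \<bullet> x"
          then show ?thesis using p unfolding q_def inner_add_left inner_scaleR_left
            by (intro add_pos_nonneg mult_pos_pos mult_nonneg_nonneg) auto
        next
          assume "0 < v (s b) \<bullet> x"
          then show ?thesis using p unfolding q_def inner_add_left inner_scaleR_left
            by (intro add_nonneg_pos mult_pos_pos mult_nonneg_nonneg) auto
        qed
      qed
      ultimately show "\<exists>z. (\<forall>b\<in>T. q b \<bullet> z = 0) \<and> (\<forall>b\<in>B - T. 0 < q b \<bullet> z)" by blast
    qed
  qed
  note main = this
  have "0 < m" by (simp add: m_def)
  then show ?thesis
    by (intro exI[of _ m] conjI allI notI, assumption, fold n_def, elim conjE) (rule main; assumption)
qed

section \<open>Faces and duals of polyhedral cones\<close>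

text \<open>The empty face is left out because it has the same trace on the sphere as the apex
  \<open>{0}\<close>; the remaining faces of a pointed cone match the spherical ones
  bijectively.\<close>

definition cone_faces :: "'a::euclidean_space set \<Rightarrow> 'a set set" where
  "cone_faces K = {G. G face_of K \<and> G \<noteq> {}}"

definition dual_cone :: "'a::euclidean_space set \<Rightarrow> 'a set" where
  "dual_cone K = {a. \<forall>z\<in>K. 0 \<le> a \<bullet> z}"

definition dual_face :: "'a::euclidean_space set \<Rightarrow> 'a set \<Rightarrow> 'a set" where
  "dual_face K F = {a \<in> dual_cone K. \<forall>z\<in>F. a \<bullet> z = 0}"

definition proper_cone :: "'a::euclidean_space set \<Rightarrow> bool" where
  "proper_cone K \<longleftrightarrow> polyhedron K \<and> convex_cone K \<and> (\<forall>x\<in>K. - x \<in> K \<longrightarrow> x = 0) \<and> interior K \<noteq> {}"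

definition face_isomorphic :: "'a::euclidean_space set \<Rightarrow> 'b::euclidean_space set \<Rightarrow> bool" where
  "face_isomorphic K L \<longleftrightarrow> (\<exists>\<phi>. bij_betw \<phi> (cone_faces K) (cone_faces L) \<and>
     (\<forall>F\<in>cone_faces K. \<forall>G\<in>cone_faces K. F \<subseteq> G \<longleftrightarrow> \<phi> F \<subseteq> \<phi> G))"

text \<open>Passing to a facet that contains \<open>F\<close> lowers the dimension by one. This
  provides the \<open>i\<close>-faces through a given vertex and the \<open>j\<close>-faces inside
  an intersection of facets.\<close>

lemma polyhedron_face_of_intermediate_dim:
  fixes K :: "'a::euclidean_space set"
  assumes "polyhedron K" "F face_of K" "F \<noteq> {}" "aff_dim F \<le> m" "m \<le> aff_dim K"
  obtains M where "M face_of K" "F \<subseteq> M" "aff_dim M = m"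
proof -
  have "\<exists>M. M face_of K \<and> F \<subseteq> M \<and> aff_dim M = m"
    using assms
  proof (induction "nat (aff_dim K - m)" arbitrary: K)
    case 0
    then have "aff_dim K = m" by linarith
    then show ?case using 0 face_of_refl[OF polyhedron_imp_convex[of K]] face_of_imp_subset[of F K]
      by (intro exI[of _ K]) simp
  next
    case (Suc r)
    have "F \<noteq> K" using Suc by auto
    then obtain G where G: "G facet_of K" "F \<subseteq> G"
      using face_of_polyhedron_subset_facet Suc.prems by metis
    have GK: "G face_of K" "aff_dim G = aff_dim K - 1" using G(1) by (auto simp: facet_of_def)
    have "F face_of G" using Suc.prems(2) G(2) GK(1) by (simp add: face_of_face)
    moreover have "polyhedron G" using Suc.prems(1) GK(1) by (rule face_of_polyhedron_polyhedron)
    ultimately obtain M where "M face_of G" "F \<subseteq> M" "aff_dim M = m"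
    proof -
      assume PG: "F face_of G" "polyhedron G"
      have "r = nat (aff_dim G - m)" "m \<le> aff_dim G" using Suc.hyps(2) GK(2) by linarith+
      then show ?thesis using Suc.hyps(1)[of G] PG Suc.prems(3,4) that by blast
    qed
    then show ?case using GK(1) face_of_trans by blast
  qed
  then show ?thesis using that by blast
qed

lemma cone_face_convex_cone:
  assumes "convex_cone K" "F \<in> cone_faces K"
  shows "convex_cone F"
  using assms face_of_conic[of K F] face_of_imp_convex[of F K]
  by (auto simp: convex_cone_def cone_faces_def)

lemma zero_mem_cone_face:
  assumes "convex_cone K" "F \<in> cone_faces K"
  shows "0 \<in> F"
  using cone_face_convex_cone[OF assms] by (rule convex_cone_contains_0)

lemma dual_cone_face:
  assumes "convex_cone K" "a \<in> dual_cone K"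
  shows "K \<inter> {x. a \<bullet> x = 0} \<in> cone_faces K"
  using assms face_of_Int_supporting_hyperplane_ge[where S=K and a=a and b=0] convex_cone_contains_0[OF assms(1)]
  by (auto simp: cone_faces_def dual_cone_def convex_cone_def)

lemma cone_face_exposed:
  assumes K: "polyhedron K" "convex_cone K" and F: "F \<in> cone_faces K"
  obtains a where "a \<in> dual_cone K" "F = K \<inter> {x. a \<bullet> x = 0}"
proof -
  have "F exposed_face_of K" using exposed_face_of_polyhedron[OF K(1)] F by (auto simp: cone_faces_def)
  then obtain a b where ab: "K \<subseteq> {x. a \<bullet> x \<le> b}" "F = K \<inter> {x. a \<bullet> x = b}"
    unfolding exposed_face_of_def by blast
  have "b = 0" using zero_mem_cone_face[OF K(2) F] ab(2) by auto
  then show ?thesis using that[of "- a"] ab by (auto simp: dual_cone_def)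
qed

lemma zero_cone_face:
  assumes "proper_cone K"
  shows "{0} \<in> cone_faces K"
proof -
  have K: "convex_cone K" and pt: "\<And>x. x \<in> K \<Longrightarrow> - x \<in> K \<Longrightarrow> x = 0"
    using assms by (auto simp: proper_cone_def)
  have "{0} face_of K"
    unfolding face_of_def
  proof (intro conjI ballI impI)
    show "{0} \<subseteq> K" using convex_cone_contains_0[OF K] by simp
    fix a b x assume ab: "a \<in> K" "b \<in> K" "x \<in> {0}" "x \<in> open_segment a b"
    then obtain u where u: "0 < u" "u < 1" "(1 - u) *\<^sub>R a + u *\<^sub>R b = 0" by (auto simp: in_segment)
    have "u *\<^sub>R b \<in> K" using ab(2) u by (intro convex_cone_scaleR[OF K]) auto
    moreover have "u *\<^sub>R b = - ((1 - u) *\<^sub>R a)" using u(3) by (rule add_eq_0_iff[THEN iffD1])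
    ultimately have "- ((1 - u) *\<^sub>R a) \<in> K" by (simp only:)
    moreover have "(1 - u) *\<^sub>R a \<in> K" using ab(1) u by (intro convex_cone_scaleR[OF K]) auto
    ultimately have a0: "(1 - u) *\<^sub>R a = 0" using pt by blast
    have "u *\<^sub>R b = 0" using u(3) unfolding a0 by simp
    with a0 show "a \<in> {0}" "b \<in> {0}" using u by auto
  qed auto
  then show ?thesis by (simp add: cone_faces_def)
qed

lemma cone_face_subface:
  assumes "F \<in> cone_faces K" "G \<in> cone_faces K" "F \<subseteq> G"
  shows "F face_of G"
  using assms by (auto simp: cone_faces_def face_of_face)

lemma cone_face_aff_dim_lt:
  assumes "F \<in> cone_faces K" "G \<in> cone_faces K" "F \<subset> G"
  shows "aff_dim F < aff_dim G"
  using face_of_aff_dim_lt[OF _ cone_face_subface[OF assms(1,2)]] assms(3) face_of_imp_convex assms(2)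
  by (auto simp: cone_faces_def)

text \<open>A chain of faces from the apex to \<open>F\<close> that gains one dimension per step is
  mapped to a strict chain, which gains at least as much.\<close>

lemma face_embedding_aff_dim_le:
  assumes K: "proper_cone K"
    and \<phi>: "\<And>F. F \<in> cone_faces K \<Longrightarrow> \<phi> F \<in> cone_faces L"
    and mono: "\<And>F G. F \<in> cone_faces K \<Longrightarrow> G \<in> cone_faces K \<Longrightarrow> F \<subset> G \<Longrightarrow> \<phi> F \<subset> \<phi> G"
    and F: "F \<in> cone_faces K"
  shows "aff_dim F \<le> aff_dim (\<phi> F)"
  using F
proof (induction "nat (aff_dim F)" arbitrary: F rule: less_induct)
  case less
  have ne: "\<phi> F \<noteq> {}" using \<phi>[OF less.prems] by (auto simp: cone_faces_def)
  show ?case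
  proof (cases "aff_dim F \<le> 0")
    case True
    then show ?thesis using ne aff_dim_negative_iff[of "\<phi> F"] by linarith
  next
    case False
    have FK: "F face_of K" using less.prems by (simp add: cone_faces_def)
    have cK: "convex_cone K" "polyhedron K" using K by (auto simp: proper_cone_def)
    have "0 \<in> F" by (rule zero_mem_cone_face[OF cK(1) less.prems])
    then have "{0} face_of F" using zero_cone_face[OF K] less.prems by (intro cone_face_subface) auto
    then obtain M where M: "M face_of F" "{0} \<subseteq> M" "aff_dim M = aff_dim F - 1"
      using polyhedron_face_of_intermediate_dim[of F "{0}" "aff_dim F - 1"]
        face_of_polyhedron_polyhedron[OF cK(2) FK] False by force
    have Mf: "M \<in> cone_faces K" using M FK face_of_trans by (auto simp: cone_faces_def)
    have "M \<subset> F" using M by (auto simp: face_of_imp_subset psubset_eq)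
    then have "aff_dim (\<phi> M) < aff_dim (\<phi> F)"
      using cone_face_aff_dim_lt \<phi> mono Mf less.prems by meson
    moreover have "aff_dim M \<le> aff_dim (\<phi> M)" using less.hyps[of M] Mf M(3) False by auto
    ultimately show ?thesis using M(3) by linarith
  qed
qed

lemma face_isomorphic_sym:
  assumes "face_isomorphic K L"
  shows "face_isomorphic L K"
proof -
  obtain \<phi> where \<phi>: "bij_betw \<phi> (cone_faces K) (cone_faces L)"
    "\<forall>F\<in>cone_faces K. \<forall>G\<in>cone_faces K. F \<subseteq> G \<longleftrightarrow> \<phi> F \<subseteq> \<phi> G"
    using assms unfolding face_isomorphic_def by blast
  let ?\<psi> = "the_inv_into (cone_faces K) \<phi>"
  have "bij_betw ?\<psi> (cone_faces L) (cone_faces K)" using \<phi>(1) by (rule bij_betw_the_inv_into)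
  moreover have "?\<psi> F \<in> cone_faces K" "\<phi> (?\<psi> F) = F" if "F \<in> cone_faces L" for F
    using that \<phi>(1) calculation by (auto simp: bij_betw_apply f_the_inv_into_f_bij_betw)
  ultimately show ?thesis unfolding face_isomorphic_def using \<phi>(2) by (intro exI[of _ ?\<psi>]) auto
qed

section \<open>Half-space descriptions and biduality of polyhedral cones\<close>

lemma polyhedral_cone_halfspaces:
  fixes K :: "'a::euclidean_space set"
  assumes "polyhedron K" "convex_cone K"
  obtains C where "finite C" "0 \<notin> C" "K = {z. \<forall>c\<in>C. 0 \<le> c \<bullet> z}"
proof -
  obtain \<F> where F: "finite \<F>" "K = \<Inter> \<F>" "\<And>h. h \<in> \<F> \<Longrightarrow> \<exists>a b. a \<noteq> 0 \<and> h = {x. a \<bullet> x \<le> b}"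
    using assms(1) unfolding polyhedron_def by metis
  then have "\<forall>h\<in>\<F>. \<exists>ab. fst ab \<noteq> 0 \<and> h = {x. fst ab \<bullet> x \<le> snd ab}" by fastforce
  then obtain ab where ab: "\<And>h. h \<in> \<F> \<Longrightarrow> fst (ab h) \<noteq> (0::'a)"
    "\<And>h. h \<in> \<F> \<Longrightarrow> h = {x. fst (ab h) \<bullet> x \<le> snd (ab h)}" by metis
  define C where "C = (\<lambda>h. - fst (ab h)) ` \<F>"
  have "K = {z. \<forall>c\<in>C. 0 \<le> c \<bullet> z}"
  proof (intro equalityI subsetI CollectI ballI)
    fix z c assume z: "z \<in> K" and "c \<in> C"
    then obtain h where h: "h \<in> \<F>" "c = - fst (ab h)" by (auto simp: C_def)
    show "0 \<le> c \<bullet> z"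
    proof (rule ccontr)
      assume "\<not> ?thesis"
      then have pos: "0 < fst (ab h) \<bullet> z" using h by simp
      \<comment> \<open>Scaling a point on which the linear part is positive violates the
        inequality, so on a cone only the homogeneous inequalities matter.\<close>
      define t where "t = (\<bar>snd (ab h)\<bar> + 1) / (fst (ab h) \<bullet> z)"
      have "t *\<^sub>R z \<in> K" using assms(2) z pos by (auto simp: t_def intro: convex_cone_scaleR)
      then have "t *\<^sub>R z \<in> h" using F(2) h(1) by blast
      then have "fst (ab h) \<bullet> (t *\<^sub>R z) \<le> snd (ab h)" using ab(2)[OF h(1)] by blast
      then show False using pos by (simp add: t_def)
    qed
  next
    fix z assume z: "z \<in> {z. \<forall>c\<in>C. 0 \<le> c \<bullet> z}"
    have "z \<in> h" if h: "h \<in> \<F>" for h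
    proof -
      have "0 \<in> K" using assms(2) by (rule convex_cone_contains_0)
      then have "0 \<in> h" using F(2) h by blast
      then have "0 \<le> snd (ab h)" using ab(2)[OF h] by (metis inner_zero_right mem_Collect_eq)
      moreover have "fst (ab h) \<bullet> z \<le> 0" using z h by (auto simp: C_def)
      ultimately have "fst (ab h) \<bullet> z \<le> snd (ab h)" by simp
      then show ?thesis using ab(2)[OF h] by blast
    qed
    then show "z \<in> K" using F(2) by blast
  qed
  moreover have "finite C" "0 \<notin> C" using F(1) ab(1) by (auto simp: C_def)
  ultimately show ?thesis using that by blast
qed

text \<open>Farkas' lemma: the finitely generated cone is closed, and a hyperplane that separates a
  point from it yields, by scaling the generators, a vector of the primal cone on which the point is
  negative.\<close>

lemma dual_cone_halfspaces:
  fixes C :: "'a::euclidean_space set"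
  assumes "finite C"
  shows "dual_cone {z. \<forall>c\<in>C. 0 \<le> c \<bullet> z} = convex_cone hull C" (is "dual_cone ?K = ?L")
proof
  have cc: "convex_cone (dual_cone ?K)"
    by (auto simp: convex_cone_iff dual_cone_def inner_add_left)
  then show "?L \<subseteq> dual_cone ?K" by (intro hull_minimal) (auto simp: dual_cone_def)
  show "dual_cone ?K \<subseteq> ?L"
  proof (rule ccontr)
    assume "\<not> ?thesis"
    then obtain a where a: "a \<in> dual_cone ?K" "a \<notin> ?L" by blast
    have "closed ?L" by (rule closed_convex_cone_hull[OF assms])
    then obtain x b where xb: "x \<bullet> a < b" "\<And>l. l \<in> ?L \<Longrightarrow> b < x \<bullet> l"
      using separating_hyperplane_closed_point[OF convex_convex_cone_hull _ a(2)] by metis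
    have b0: "b < 0" using xb(2)[OF convex_cone_hull_contains_0] by simp
    have "0 \<le> c \<bullet> x" if "c \<in> C" for c
    proof (rule ccontr)
      assume n: "\<not> ?thesis"
      define t where "t = b / (c \<bullet> x)"
      have "0 \<le> t" using n b0 by (simp add: t_def divide_nonpos_neg)
      then have "t *\<^sub>R c \<in> ?L" using that by (simp add: convex_cone_hull_mul hull_inc)
      then have "b < x \<bullet> (t *\<^sub>R c)" by (rule xb(2))
      then show False using n by (simp add: t_def inner_commute)
    qed
    then have "0 \<le> a \<bullet> x" using a(1) by (auto simp: dual_cone_def)
    then show False using xb(1) b0 by (simp add: inner_commute)
  qed
qed

lemma orthogonal_to_interior_eq_0:
  fixes K :: "'a::euclidean_space set"
  assumes "interior K \<noteq> {}" "\<And>z. z \<in> K \<Longrightarrow> a \<bullet> z = 0"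
  shows "a = 0"
proof (rule ccontr)
  assume a: "a \<noteq> 0"
  have "interior K \<subseteq> interior {x. a \<bullet> x = 0}" using assms(2) by (intro interior_mono) auto
  then show False using assms(1) interior_hyperplane[OF a, of 0] by simp
qed

text \<open>The normals of a half-space description belong to the dual cone, so they test membership
  in the bidual.\<close>

lemma dual_dual_cone:
  assumes "proper_cone K"
  shows "dual_cone (dual_cone K) = K"
proof
  have "polyhedron K" "convex_cone K" using assms by (auto simp: proper_cone_def)
  then obtain C where C: "finite C" "0 \<notin> C" "K = {z. \<forall>c\<in>C. 0 \<le> c \<bullet> z}"
    by (rule polyhedral_cone_halfspaces)
  then have "C \<subseteq> dual_cone K" by (auto simp: dual_cone_def)
  then show "dual_cone (dual_cone K) \<subseteq> K"
    unfolding C(3) by (auto simp: dual_cone_def[of "dual_cone _"] inner_commute)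
  show "K \<subseteq> dual_cone (dual_cone K)" by (auto simp: dual_cone_def inner_commute)
qed

text \<open>Duality exchanges pointedness and nonempty interior: a hyperplane that contains the dual
  cone would put a line into the bidual, which is \<open>K\<close>.\<close>

lemma proper_dual_cone:
  fixes K :: "'a::euclidean_space set"
  assumes K: "proper_cone K"
  shows "proper_cone (dual_cone K)"
proof -
  have "polyhedron K" "convex_cone K" using K by (auto simp: proper_cone_def)
  then obtain C where C: "finite C" "0 \<notin> C" "K = {z. \<forall>c\<in>C. 0 \<le> c \<bullet> z}"
    by (rule polyhedral_cone_halfspaces)
  have hull: "dual_cone K = convex_cone hull C" unfolding C(3) by (rule dual_cone_halfspaces[OF C(1)])
  have "a = 0" if "a \<in> dual_cone K" "- a \<in> dual_cone K" for a
  proof (rule orthogonal_to_interior_eq_0[of K])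
    show "a \<bullet> z = 0" if "z \<in> K" for z
    proof -
      have "0 \<le> a \<bullet> z" "0 \<le> - a \<bullet> z"
        using \<open>z \<in> K\<close> \<open>a \<in> dual_cone K\<close> \<open>- a \<in> dual_cone K\<close> unfolding dual_cone_def by blast+
      then show ?thesis by simp
    qed
  qed (use K in \<open>simp add: proper_cone_def\<close>)
  moreover have "interior (dual_cone K) \<noteq> {}"
  proof
    assume "interior (dual_cone K) = {}"
    moreover have "convex (dual_cone K)" unfolding hull by (rule convex_convex_cone_hull)
    ultimately obtain a b where ab: "a \<noteq> 0" "dual_cone K \<subseteq> {x. a \<bullet> x = b}"
      using empty_interior_subset_hyperplane by metis
    have "0 \<in> dual_cone K" by (simp add: dual_cone_def)
    then have "b = 0" using ab by auto
    then have "a \<in> dual_cone (dual_cone K)" "- a \<in> dual_cone (dual_cone K)"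
      using ab by (auto simp: dual_cone_def)
    then have "a \<in> K" "- a \<in> K" unfolding dual_dual_cone[OF K] .
    then show False using K ab(1) by (auto simp: proper_cone_def)
  qed
  ultimately show ?thesis
    unfolding proper_cone_def
    using polyhedron_convex_cone_hull[OF C(1)] convex_cone_convex_cone_hull[of C]
    unfolding hull by blast
qed

section \<open>The order-reversing correspondence between the faces of a cone and of its
  dual\<close>

lemma dual_face_cone_face:
  assumes K: "proper_cone K" and F: "F \<in> cone_faces K"
  shows "dual_face K F \<in> cone_faces (dual_cone K)"
proof -
  have FK: "F \<subseteq> K" "F \<noteq> {}" using F by (auto simp: cone_faces_def dest: face_of_imp_subset)
  have cD: "convex_cone (dual_cone K)" using proper_dual_cone[OF K] by (simp add: proper_cone_def)
  have "dual_face K F = \<Inter> ((\<lambda>z. dual_cone K \<inter> {a. z \<bullet> a = 0}) ` F)"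
    using FK(2) by (auto simp: dual_face_def inner_commute)
  moreover have "\<Inter> ((\<lambda>z. dual_cone K \<inter> {a. z \<bullet> a = 0}) ` F) face_of dual_cone K"
  proof (rule face_of_Inter)
    fix T assume "T \<in> (\<lambda>z. dual_cone K \<inter> {a. z \<bullet> a = 0}) ` F"
    then obtain z where z: "z \<in> F" "T = dual_cone K \<inter> {a. z \<bullet> a = 0}" by blast
    have "z \<in> dual_cone (dual_cone K)" using z(1) FK(1) dual_dual_cone[OF K] by blast
    then show "T face_of dual_cone K" using dual_cone_face[OF cD] z(2) by (simp add: cone_faces_def)
  qed (use FK in simp)
  moreover have "0 \<in> dual_face K F" by (simp add: dual_face_def dual_cone_def)
  ultimately have "dual_face K F face_of dual_cone K" by (simp only:)
  then show ?thesis using \<open>0 \<in> dual_face K F\<close> by (auto simp: cone_faces_def)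
qed

text \<open>Faces are exposed: a normal that cuts out \<open>F\<close> lies in the dual face and
  already determines \<open>F\<close>.\<close>

lemma dual_face_dual_face:
  assumes K: "proper_cone K" and F: "F \<in> cone_faces K"
  shows "dual_face (dual_cone K) (dual_face K F) = F"
proof
  obtain a where a: "a \<in> dual_cone K" "F = K \<inter> {x. a \<bullet> x = 0}"
    using cone_face_exposed K F unfolding proper_cone_def by metis
  then have "a \<in> dual_face K F" by (simp add: dual_face_def)
  then show "dual_face (dual_cone K) (dual_face K F) \<subseteq> F"
    using a(2) dual_dual_cone[OF K] by (auto simp: dual_face_def[of "dual_cone K"] inner_commute)
  show "F \<subseteq> dual_face (dual_cone K) (dual_face K F)"
  proof
    fix z assume "z \<in> F"
    moreover from this have "z \<in> dual_cone (dual_cone K)" using a(2) dual_dual_cone[OF K] by blast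
    ultimately show "z \<in> dual_face (dual_cone K) (dual_face K F)"
      by (simp add: dual_face_def[of "dual_cone K"]) (simp add: dual_face_def inner_commute)
  qed
qed

lemma dual_face_antimono: "F \<subseteq> G \<Longrightarrow> dual_face K G \<subseteq> dual_face K F"
  by (auto simp: dual_face_def)

lemma dual_face_subset_iff:
  assumes "proper_cone K" "F \<in> cone_faces K" "G \<in> cone_faces K"
  shows "dual_face K G \<subseteq> dual_face K F \<longleftrightarrow> F \<subseteq> G"
  using dual_face_antimono[of "dual_face K G" "dual_face K F" "dual_cone K"]
    dual_face_dual_face[OF assms(1)] assms(2,3) dual_face_antimono[of F G K] by auto

text \<open>The isomorphism is conjugated with the two order reversals, which cancel.\<close>

lemma face_isomorphic_dual_cone:
  fixes K L :: "'a::euclidean_space set"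
  assumes K: "proper_cone K" and L: "proper_cone L" and KL: "face_isomorphic K (dual_cone L)"
  shows "face_isomorphic (dual_cone K) L"
proof -
  obtain \<phi> where \<phi>: "bij_betw \<phi> (cone_faces K) (cone_faces (dual_cone L))"
    "\<forall>F\<in>cone_faces K. \<forall>G\<in>cone_faces K. F \<subseteq> G \<longleftrightarrow> \<phi> F \<subseteq> \<phi> G"
    using KL unfolding face_isomorphic_def by blast
  have bij: "bij_betw (dual_face (dual_cone M)) (cone_faces (dual_cone M)) (cone_faces M)"
    if M: "proper_cone M" for M :: "'a set"
    using dual_face_dual_face[OF M] dual_face_dual_face[OF proper_dual_cone[OF M]]
      dual_face_cone_face[OF M] dual_face_cone_face[OF proper_dual_cone[OF M]]
    by (intro bij_betwI[where g = "dual_face M"]) (auto simp: dual_dual_cone[OF M])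
  define \<psi> where "\<psi> = dual_face (dual_cone L) \<circ> \<phi> \<circ> dual_face (dual_cone K)"
  have "bij_betw \<psi> (cone_faces (dual_cone K)) (cone_faces L)"
    unfolding \<psi>_def using bij[OF K] \<phi>(1) bij[OF L] by (meson bij_betw_trans comp_assoc)
  moreover have "F \<subseteq> G \<longleftrightarrow> \<psi> F \<subseteq> \<psi> G"
    if FG: "F \<in> cone_faces (dual_cone K)" "G \<in> cone_faces (dual_cone K)" for F G
  proof -
    let ?f = "dual_face (dual_cone K) F" and ?g = "dual_face (dual_cone K) G"
    have fg: "?f \<in> cone_faces K" "?g \<in> cone_faces K"
      using bij_betw_apply[OF bij[OF K]] FG by auto
    have "F \<subseteq> G \<longleftrightarrow> ?g \<subseteq> ?f"
      using dual_face_subset_iff[OF proper_dual_cone[OF K]] FG by blast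
    also have "\<dots> \<longleftrightarrow> \<phi> ?g \<subseteq> \<phi> ?f" using \<phi>(2) fg by blast
    also have "\<dots> \<longleftrightarrow> \<psi> F \<subseteq> \<psi> G"
      using dual_face_subset_iff[OF proper_dual_cone[OF L]] bij_betw_apply[OF \<phi>(1)] fg
      by (simp add: \<psi>_def)
    finally show ?thesis .
  qed
  ultimately show ?thesis unfolding face_isomorphic_def by blast
qed

lemma aff_dim_cone_face:
  assumes "convex_cone K" "F \<in> cone_faces K"
  shows "aff_dim F = int (dim F)"
  using zero_mem_cone_face[OF assms] by (intro aff_dim_zero hull_inc)

text \<open>The dual face is orthogonal to \<open>F\<close>, which bounds its dimension from above.
  For the lower bound, climbing from \<open>F\<close> to \<open>K\<close> one dimension at a time
  makes the dual face shrink strictly at each step.\<close>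

lemma aff_dim_dual_face:
  fixes K :: "'a::euclidean_space set"
  assumes K: "proper_cone K" and F: "F \<in> cone_faces K"
  shows "aff_dim (dual_face K F) = int DIM('a) - aff_dim F"
proof (rule antisym)
  have cK: "convex_cone K" "polyhedron K" "interior K \<noteq> {}" using K by (auto simp: proper_cone_def)
  have DF: "dual_face K F \<in> cone_faces (dual_cone K)" by (rule dual_face_cone_face[OF K F])
  have cD: "convex_cone (dual_cone K)" using proper_dual_cone[OF K] by (simp add: proper_cone_def)
  have "dual_face K F \<subseteq> {y. \<forall>x\<in>span F. orthogonal x y}"
    by (auto simp: dual_face_def orthogonal_def inner_commute intro: orthogonal_to_span[unfolded orthogonal_def])
  then have "dim (dual_face K F) \<le> dim {y \<in> UNIV. \<forall>x\<in>span F. orthogonal x y}"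
    by (intro dim_subset) auto
  moreover have "dim {y \<in> UNIV. \<forall>x\<in>span F. orthogonal x y} + dim (span F) = DIM('a)"
    using dim_subspace_orthogonal_to_vectors[of "span F" UNIV] by simp
  ultimately have "dim (dual_face K F) + dim F \<le> DIM('a)" by simp
  then show "aff_dim (dual_face K F) \<le> int DIM('a) - aff_dim F"
    using aff_dim_cone_face[OF cK(1) F] aff_dim_cone_face[OF cD DF] by simp
  show "int DIM('a) - aff_dim F \<le> aff_dim (dual_face K F)"
    using F
  proof (induction "nat (int DIM('a) - aff_dim F)" arbitrary: F rule: less_induct)
    case less
    have ne: "dual_face K F \<noteq> {}"
      using dual_face_cone_face[OF K less.prems] by (auto simp: cone_faces_def)
    show ?case
    proof (cases "int DIM('a) \<le> aff_dim F")
      case True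
      then show ?thesis using ne aff_dim_negative_iff[of "dual_face K F"] by linarith
    next
      case False
      have "aff_dim K = int DIM('a)" using cK(3) by (rule aff_dim_nonempty_interior)
      then obtain M where M: "M face_of K" "F \<subseteq> M" "aff_dim M = aff_dim F + 1"
        using polyhedron_face_of_intermediate_dim[OF cK(2), of F "aff_dim F + 1"] less.prems False
        by (force simp: cone_faces_def)
      have Mf: "M \<in> cone_faces K" using M less.prems by (auto simp: cone_faces_def)
      have "F \<subset> M" using M by auto
      then have "dual_face K M \<subset> dual_face K F"
        using dual_face_subset_iff[OF K] Mf less.prems by blast
      then have "aff_dim (dual_face K M) < aff_dim (dual_face K F)"
        using cone_face_aff_dim_lt dual_face_cone_face[OF K] Mf less.prems by meson
      moreover have "int DIM('a) - aff_dim M \<le> aff_dim (dual_face K M)"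
        using less.hyps[of M] Mf M(3) False by auto
      ultimately show ?thesis using M(3) by linarith
    qed
  qed
qed

text \<open>An isomorphism of face lattices mentions no dimensions; they are recovered from chains
  of faces, in both directions.\<close>

lemma face_isomorphism_aff_dim:
  assumes K: "proper_cone K" and L: "proper_cone L"
    and \<phi>: "bij_betw \<phi> (cone_faces K) (cone_faces L)"
      "\<And>F G. F \<in> cone_faces K \<Longrightarrow> G \<in> cone_faces K \<Longrightarrow> F \<subseteq> G \<longleftrightarrow> \<phi> F \<subseteq> \<phi> G"
    and F: "F \<in> cone_faces K"
  shows "aff_dim (\<phi> F) = aff_dim F"
proof (rule antisym)
  show "aff_dim F \<le> aff_dim (\<phi> F)"
    using \<phi> by (intro face_embedding_aff_dim_le[OF K, where L=L, OF _ _ F]) (auto simp: bij_betw_apply less_le_not_le)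
  let ?\<psi> = "the_inv_into (cone_faces K) \<phi>"
  have \<psi>: "?\<psi> G \<in> cone_faces K" "\<phi> (?\<psi> G) = G" if "G \<in> cone_faces L" for G
    using that \<phi>(1) bij_betw_the_inv_into[OF \<phi>(1)] by (auto simp: bij_betw_apply f_the_inv_into_f_bij_betw)
  have "aff_dim (\<phi> F) \<le> aff_dim (?\<psi> (\<phi> F))"
  proof (rule face_embedding_aff_dim_le[OF L])
    show "?\<psi> G \<subset> ?\<psi> H" if "G \<in> cone_faces L" "H \<in> cone_faces L" "G \<subset> H" for G H
      using \<phi>(2)[of "?\<psi> G" "?\<psi> H"] \<phi>(2)[of "?\<psi> H" "?\<psi> G"] \<psi> that by auto
  qed (use \<psi> bij_betw_apply[OF \<phi>(1) F] in auto)
  also have "?\<psi> (\<phi> F) = F" using \<phi>(1) F by (simp add: bij_betw_def the_inv_into_f_f)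
  finally show "aff_dim (\<phi> F) \<le> aff_dim F" .
qed

section \<open>Transfer along a face lattice isomorphism\<close>

text \<open>A functional that supports \<open>K\<close> at \<open>z\<close> is nonnegative on the
  tangent cone at \<open>z\<close>, which only the active constraints determine.\<close>

lemma dual_cone_nonneg_at_active:
  fixes c :: "nat \<Rightarrow> 'a::euclidean_space"
  assumes J: "finite J" and K: "K = {z. \<forall>l\<in>J. 0 \<le> c l \<bullet> z}"
    and z: "z \<in> K" and a: "a \<in> dual_cone K" "a \<bullet> z = 0"
    and x: "\<And>l. l \<in> J \<Longrightarrow> c l \<bullet> z = 0 \<Longrightarrow> 0 \<le> c l \<bullet> x"
  shows "0 \<le> a \<bullet> x"
proof -
  obtain \<epsilon> where \<epsilon>: "0 < \<epsilon>" "\<And>l. l \<in> J \<Longrightarrow> 0 \<le> c l \<bullet> z + \<epsilon> * (c l \<bullet> x)"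
    using small_perturbation_nonneg[OF J, of "\<lambda>l. c l \<bullet> z" "\<lambda>l. c l \<bullet> x"] z x K by blast
  then have "z + \<epsilon> *\<^sub>R x \<in> K" by (simp add: K inner_add_right)
  then have "0 \<le> a \<bullet> (z + \<epsilon> *\<^sub>R x)" using a(1) by (simp add: dual_cone_def)
  then show ?thesis using a(2) \<epsilon>(1) by (simp add: inner_add_right zero_le_mult_iff)
qed

definition active_face :: "'a::euclidean_space set \<Rightarrow> (nat \<Rightarrow> 'a) \<Rightarrow> nat set \<Rightarrow> 'a set" where
  "active_face K c T = {x \<in> K. \<forall>l\<in>T. c l \<bullet> x = 0}"

lemma active_face_in_cone_faces:
  assumes K: "convex_cone K" and c: "\<And>l. l \<in> T \<Longrightarrow> c l \<in> dual_cone K"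
  shows "active_face K c T \<in> cone_faces K"
proof (cases "T = {}")
  case True
  then show ?thesis
    using K convex_cone_contains_0[OF K] face_of_refl[of K]
    by (auto simp: active_face_def cone_faces_def convex_cone_def)
next
  case False
  have "active_face K c T = \<Inter> ((\<lambda>l. K \<inter> {x. c l \<bullet> x = 0}) ` T)"
    using False by (auto simp: active_face_def)
  moreover have "\<Inter> ((\<lambda>l. K \<inter> {x. c l \<bullet> x = 0}) ` T) face_of K"
    using dual_cone_face[OF K] c False by (intro face_of_Inter) (auto simp: cone_faces_def)
  ultimately have "active_face K c T face_of K" by (simp only:)
  moreover have "0 \<in> active_face K c T" using convex_cone_contains_0[OF K] by (simp add: active_face_def)
  ultimately show ?thesis by (auto simp: cone_faces_def)
qed

lemma open_strictly_positive:
  fixes c :: "nat \<Rightarrow> 'a::euclidean_space"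
  assumes "finite J"
  shows "open {z. \<forall>l\<in>J. 0 < c l \<bullet> z}"
proof -
  have "{z. \<forall>l\<in>J. 0 < c l \<bullet> z} = (\<Inter>l\<in>J. {z. 0 < c l \<bullet> z})" by auto
  then show ?thesis using assms by (simp add: open_INT open_halfspace_gt)
qed

lemma rel_interior_nonempty_cone_face:
  assumes "F \<in> cone_faces K"
  obtains z where "z \<in> rel_interior F" "z \<in> F"
  using assms rel_interior_eq_empty[of F] face_of_imp_convex[of F K] rel_interior_subset[of F]
  unfolding cone_faces_def by blast

text \<open>An arbitrary realization \<open>K'\<close> obtains a description indexed by the same set
  \<open>J\<close>, where \<open>c' l\<close> exposes the image of the face cut out by
  \<open>c l\<close>. The point \<open>p\<close> guarantees that none of these faces is all of
  \<open>K\<close>. The witness \<open>z\<close> says that \<open>T\<close> is the exact set of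
  constraints active at some point, and this property is inherited by \<open>K'\<close>.\<close>

lemma face_isomorphism_transfers_halfspaces:
  fixes K :: "'a::euclidean_space set" and K' :: "'b::euclidean_space set"
  assumes J: "finite J" and K: "K = {z. \<forall>l\<in>J. 0 \<le> c l \<bullet> z}" "proper_cone K"
    and p: "\<forall>l\<in>J. 0 < c l \<bullet> p"
    and K': "proper_cone K'" and iso: "face_isomorphic K' K"
  obtains c' where "K' = {z. \<forall>l\<in>J. 0 \<le> c' l \<bullet> z}"
    "\<And>T z. T \<subseteq> J \<Longrightarrow> z \<in> K \<Longrightarrow> {l\<in>J. c l \<bullet> z = 0} = T \<Longrightarrow>
      (\<exists>z'\<in>K'. {l\<in>J. c' l \<bullet> z' = 0} = T) \<and> aff_dim (active_face K' c' T) = aff_dim (active_face K c T)"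
proof -
  have cK: "convex_cone K" "polyhedron K" and cK': "convex_cone K'" "polyhedron K'" "interior K' \<noteq> {}"
    using K(2) K' by (auto simp: proper_cone_def)
  obtain \<phi> where \<phi>1: "bij_betw \<phi> (cone_faces K) (cone_faces K')"
    and \<phi>2: "\<forall>F\<in>cone_faces K. \<forall>G\<in>cone_faces K. F \<subseteq> G \<longleftrightarrow> \<phi> F \<subseteq> \<phi> G"
    using face_isomorphic_sym[OF iso] unfolding face_isomorphic_def by blast
  note \<phi> = \<phi>1 \<phi>2[rule_format]
  have onto: "\<exists>G\<in>cone_faces K. F = \<phi> G" if "F \<in> cone_faces K'" for F
    using \<phi>(1) that by (auto simp: bij_betw_def)
  have \<phi>f: "\<phi> F \<in> cone_faces K'" if "F \<in> cone_faces K" for F using bij_betw_apply[OF \<phi>(1) that] .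
  have cd: "c l \<in> dual_cone K" if "l \<in> J" for l using that K(1) by (auto simp: dual_cone_def)
  have AF: "active_face K c T \<in> cone_faces K" if "T \<subseteq> J" for T
    using active_face_in_cone_faces[OF cK(1)] cd that by blast
  have KK: "K \<in> cone_faces K" using AF[of "{}"] by (simp add: active_face_def)
  have KK': "K' \<in> cone_faces K'" using active_face_in_cone_faces[OF cK'(1), of "{}"] by (simp add: active_face_def)
  have "\<phi> K = K'"
  proof
    show "\<phi> K \<subseteq> K'" using \<phi>f[OF KK] by (auto simp: cone_faces_def dest: face_of_imp_subset)
    obtain G where G: "G \<in> cone_faces K" "K' = \<phi> G" using onto[OF KK'] by blast
    have "G \<subseteq> K" using G by (auto simp: cone_faces_def dest: face_of_imp_subset)
    then show "K' \<subseteq> \<phi> K" using \<phi>(2)[OF G(1) KK] G(2) by blast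
  qed
  have "\<exists>a. a \<in> dual_cone K' \<and> \<phi> (active_face K c {l}) = K' \<inter> {x. a \<bullet> x = 0}" if "l \<in> J" for l
  proof -
    have "\<phi> (active_face K c {l}) \<in> cone_faces K'" using \<phi>f AF[of "{l}"] that by simp
    then show ?thesis by (rule cone_face_exposed[OF cK'(2,1)]) blast
  qed
  then obtain c' where c': "\<And>l. l \<in> J \<Longrightarrow> c' l \<in> dual_cone K'"
    "\<And>l. l \<in> J \<Longrightarrow> \<phi> (active_face K c {l}) = K' \<inter> {x. c' l \<bullet> x = 0}" by metis
  have pK: "p \<in> K" using p K(1) by (auto intro: less_imp_le)
  \<comment> \<open>A lattice isomorphism respects intersections of faces.\<close>
  have AF': "active_face K' c' T = \<phi> (active_face K c T)" if T: "T \<subseteq> J" for T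
  proof
    have A': "active_face K' c' T \<in> cone_faces K'"
      using active_face_in_cone_faces[OF cK'(1)] c'(1) T by blast
    then obtain G where G: "G \<in> cone_faces K" "active_face K' c' T = \<phi> G" using onto by blast
    have "G \<subseteq> active_face K c {l}" if l: "l \<in> T" for l
    proof -
      have "\<phi> G \<subseteq> \<phi> (active_face K c {l})"
        using c'(2)[of l] l T unfolding G(2)[symmetric] by (auto simp: active_face_def)
      then show ?thesis using \<phi>(2)[OF G(1) AF[of "{l}"]] l T by blast
    qed
    moreover have "G \<subseteq> K" using G by (auto simp: cone_faces_def dest: face_of_imp_subset)
    ultimately have "G \<subseteq> active_face K c T" by (fastforce simp: active_face_def)
    then show "active_face K' c' T \<subseteq> \<phi> (active_face K c T)" using \<phi>(2)[OF G(1) AF[OF T]] G(2) by blast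
    show "\<phi> (active_face K c T) \<subseteq> active_face K' c' T"
    proof
      fix x assume x: "x \<in> \<phi> (active_face K c T)"
      have "x \<in> K'" using x \<phi>f[OF AF[OF T]] by (auto simp: cone_faces_def dest: face_of_imp_subset)
      moreover have "c' l \<bullet> x = 0" if l: "l \<in> T" for l
      proof -
        have "active_face K c T \<subseteq> active_face K c {l}" using l by (auto simp: active_face_def)
        then have "\<phi> (active_face K c T) \<subseteq> \<phi> (active_face K c {l})"
          using \<phi>(2)[OF AF[OF T] AF[of "{l}"]] l T by blast
        then show ?thesis using x c'(2)[of l] l T by blast
      qed
      ultimately show "x \<in> active_face K' c' T" by (simp add: active_face_def)
    qed
  qed
  have sub_iff: "F \<subseteq> active_face K c {l} \<longleftrightarrow> \<phi> F \<subseteq> active_face K' c' {l}" if "F \<in> cone_faces K" "l \<in> J" for F l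
    using AF'[of "{l}"] \<phi>(2)[OF that(1) AF[of "{l}"]] that(2) by auto
  \<comment> \<open>Some constraint is active at a relative interior point of a proper face, and
    then it is active on the whole face.\<close>
  have in_facet: "\<exists>l\<in>J. F \<subseteq> active_face K c {l}" if F: "F \<in> cone_faces K" "F \<noteq> K" for F
  proof -
    obtain q where q: "q \<in> rel_interior F" "q \<in> F" using rel_interior_nonempty_cone_face[OF F(1)] .
    have FK: "F face_of K" "F \<subseteq> K" using F(1) by (auto simp: cone_faces_def dest: face_of_imp_subset)
    have "\<exists>l\<in>J. c l \<bullet> q = 0"
    proof (rule ccontr)
      assume "\<not> ?thesis"
      then have "\<forall>l\<in>J. 0 < c l \<bullet> q" using q(2) FK(2) K(1) by (force simp: less_le)
      moreover have "{z. \<forall>l\<in>J. 0 < c l \<bullet> z} \<subseteq> interior K"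
        using K(1) by (intro interior_maximal open_strictly_positive[OF J]) (auto intro: less_imp_le)
      ultimately have "q \<in> interior K" by blast
      then have "F \<inter> interior K \<noteq> {}" using q(2) by blast
      then show False using face_of_disjoint_interior[OF FK(1) F(2)] by blast
    qed
    then obtain l where l: "l \<in> J" "c l \<bullet> q = 0" by blast
    have "active_face K c {l} face_of K" using AF[of "{l}"] l(1) by (simp add: cone_faces_def)
    moreover have "q \<in> active_face K c {l}" using l q FK(2) by (auto simp: active_face_def)
    ultimately have "F \<subseteq> active_face K c {l}" using subset_of_face_of[of _ K F] FK(2) q(1) by blast
    then show ?thesis using l(1) by blast
  qed
  have "K' = {z. \<forall>l\<in>J. 0 \<le> c' l \<bullet> z}"
  proof
    show "K' \<subseteq> {z. \<forall>l\<in>J. 0 \<le> c' l \<bullet> z}" using c'(1) by (auto simp: dual_cone_def)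
    show "{z. \<forall>l\<in>J. 0 \<le> c' l \<bullet> z} \<subseteq> K'"
    proof (rule ccontr)
      assume "\<not> ?thesis"
      then obtain z where z: "\<forall>l\<in>J. 0 \<le> c' l \<bullet> z" "z \<notin> K'" by blast
      obtain q where q: "q \<in> interior K'" using cK'(3) by blast
      have qK: "q \<in> K'" using q interior_subset by blast
      have q_pos: "0 < c' l \<bullet> q" if l: "l \<in> J" for l
      proof (rule ccontr)
        assume "\<not> ?thesis"
        then have "c' l \<bullet> q = 0" using c'(1)[OF l] qK by (fastforce simp: dual_cone_def)
        then have "q \<in> \<phi> (active_face K c {l})" using c'(2)[OF l] qK by blast
        moreover have "\<phi> (active_face K c {l}) face_of K'" using \<phi>f AF[of "{l}"] l by (auto simp: cone_faces_def)
        ultimately have "\<phi> (active_face K c {l}) = K'" using face_of_disjoint_interior[of _ K'] q by blast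
        then have "K \<subseteq> active_face K c {l}"
          using \<phi>(2)[OF KK AF[of "{l}"]] l \<open>\<phi> K = K'\<close> by auto
        then show False using pK p l by (force simp: active_face_def)
      qed
      \<comment> \<open>The segment from an interior point to \<open>z\<close> leaves
        \<open>K'\<close> in a proper face, where some \<open>c' l\<close> vanishes. But
        \<open>c' l\<close> is positive at \<open>q\<close> and nonnegative at \<open>z\<close>, so
        the exit point is \<open>z\<close> itself.\<close>
      have "closed_segment q z \<inter> frontier K' \<noteq> {}"
        using z(2) qK by (intro connected_Int_frontier) auto
      then obtain y where y: "y \<in> closed_segment q z" "y \<in> frontier K'" by blast
      have yK: "y \<in> K'" using y(2) polyhedron_imp_closed[OF cK'(2)] frontier_subset_closed by blast
      have "rel_frontier K' = frontier K'" using cK'(3) by (rule rel_frontier_nonempty_interior)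
      then obtain F where F: "F face_of K'" "F \<noteq> K'" "y \<in> F"
        using y(2) rel_frontier_of_polyhedron_alt[OF cK'(2)] by blast
      then have "F \<in> cone_faces K'" by (auto simp: cone_faces_def)
      then obtain G where G: "G \<in> cone_faces K" "F = \<phi> G" using onto by blast
      have "G \<noteq> K" using G(2) F(2) \<open>\<phi> K = K'\<close> by blast
      then obtain l where l: "l \<in> J" "G \<subseteq> active_face K c {l}" using in_facet G(1) by blast
      then have "F \<subseteq> active_face K' c' {l}" using sub_iff G by blast
      then have cy: "c' l \<bullet> y = 0" using F(3) by (auto simp: active_face_def)
      obtain u where u: "0 \<le> u" "u \<le> 1" "y = (1 - u) *\<^sub>R q + u *\<^sub>R z" using y(1) by (auto simp: in_segment)
      have "(1 - u) * (c' l \<bullet> q) + u * (c' l \<bullet> z) = 0" using cy u(3) by (simp add: inner_add_right)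
      moreover have "0 \<le> (1 - u) * (c' l \<bullet> q)" "0 \<le> u * (c' l \<bullet> z)"
        using u q_pos[OF l(1)] z(1) l(1) by (auto intro!: mult_nonneg_nonneg)
      ultimately have "(1 - u) * (c' l \<bullet> q) = 0" by linarith
      then have "u = 1" using q_pos[OF l(1)] by simp
      then show False using u(3) yK z(2) by simp
    qed
  qed
  moreover have "(\<exists>z'\<in>K'. {l\<in>J. c' l \<bullet> z' = 0} = T) \<and>
      aff_dim (active_face K' c' T) = aff_dim (active_face K c T)"
    if T: "T \<subseteq> J" and z: "z \<in> K" "{l\<in>J. c l \<bullet> z = 0} = T" for T z
  proof
    let ?F = "active_face K c T"
    show "aff_dim (active_face K' c' T) = aff_dim ?F"
      using face_isomorphism_aff_dim[OF K(2) K' \<phi> AF[OF T]] AF'[OF T] by simp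
    \<comment> \<open>At a relative interior point of the image face, only constraints active on the
      entire face are active.\<close>
    obtain z' where z': "z' \<in> rel_interior (\<phi> ?F)" "z' \<in> \<phi> ?F"
      using rel_interior_nonempty_cone_face[OF \<phi>f[OF AF[OF T]]] .
    have FK': "\<phi> ?F \<subseteq> K'" using \<phi>f[OF AF[OF T]] by (auto simp: cone_faces_def dest: face_of_imp_subset)
    have "c' l \<bullet> z' = 0 \<longleftrightarrow> l \<in> T" if l: "l \<in> J" for l
    proof
      assume "l \<in> T"
      then show "c' l \<bullet> z' = 0" using z'(2) AF'[OF T] by (auto simp: active_face_def)
    next
      assume "c' l \<bullet> z' = 0"
      then have "active_face K' c' {l} \<inter> rel_interior (\<phi> ?F) \<noteq> {}"
        using z' FK' by (auto simp: active_face_def)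
      moreover have "active_face K' c' {l} face_of K'"
        using AF'[of "{l}"] \<phi>f AF[of "{l}"] l by (auto simp: cone_faces_def)
      ultimately have "\<phi> ?F \<subseteq> active_face K' c' {l}" using subset_of_face_of FK' by blast
      then have "?F \<subseteq> active_face K c {l}" using sub_iff[OF AF[OF T] l] by blast
      moreover have "z \<in> ?F" using z by (auto simp: active_face_def)
      ultimately show "l \<in> T" using l z(2) by (auto simp: active_face_def)
    qed
    then have "{l\<in>J. c' l \<bullet> z' = 0} = T" using T by blast
    then show "\<exists>z'\<in>K'. {l\<in>J. c' l \<bullet> z' = 0} = T" using z'(2) FK' by blast
  qed
  ultimately show ?thesis using that by blast
qed

text \<open>Normals point inwards here, so that avoiding and cutting both ask for a point of the
  Lorentz cone. The relative interior in \<open>strongly_cuts\<close> is exploited when passing to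
  the dual, where it yields a normal that cuts out exactly the dual face.\<close>

definition cone_scribed :: "nat \<Rightarrow> nat \<Rightarrow> (real \<times> 'a::euclidean_space) set \<Rightarrow> bool" where
  "cone_scribed i j K \<longleftrightarrow>
     (\<forall>F\<in>cone_faces K. aff_dim F = int i + 1 \<longrightarrow>
        (\<exists>a\<in>lorentz_cone \<inter> dual_cone K. F = K \<inter> {x. a \<bullet> x = 0} \<and> a \<noteq> 0)) \<and>
     (\<forall>F\<in>cone_faces K. aff_dim F = int j + 1 \<longrightarrow> (\<exists>y\<in>lorentz_cone \<inter> F. y \<noteq> 0))"

text \<open>The set \<open>T0\<close> collects the facets that contain the whole dual cyclic face in question.\<close>

lemma dual_cyclic_face_not_scribed:
  fixes k :: nat
  assumes k: "0 < k"
  shows "\<exists>m::nat>0. \<forall>(K::(real \<times> 'a::euclidean_space) set) c J T0 H i j.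
    \<not> (finite J \<and> {..<m * (4 * k)} \<union> T0 \<subseteq> J \<and> {..<m * (4 * k)} \<inter> T0 = {} \<and>
       K = {z. \<forall>l\<in>J. 0 \<le> c l \<bullet> z} \<and> proper_cone K \<and> cone_scribed i j K \<and> i < DIM('a) \<and>
       subspace H \<and> dim H \<le> 2 * k + 1 \<and>
       (\<forall>l<m * (4 * k). \<exists>h\<in>H. \<forall>x. (\<forall>t\<in>T0. c t \<bullet> x = 0) \<longrightarrow> c l \<bullet> x = h \<bullet> x) \<and>
       (\<forall>a. a \<noteq> 0 \<longrightarrow> (\<forall>x. (\<forall>t\<in>T0. c t \<bullet> x = 0) \<longrightarrow> a \<bullet> x = 0) \<longrightarrow>
          aff_dim (K \<inter> {x. a \<bullet> x = 0}) \<noteq> int i + 1) \<and>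
       (\<forall>A. pair_set k (m * (4 * k)) A \<longrightarrow>
          aff_dim (active_face K c (pair_cover A \<union> T0)) \<le> int i + 1 \<and>
          (\<exists>z\<in>K. (\<forall>t\<in>T0. c t \<bullet> z = 0) \<and> {l\<in>J. c l \<bullet> z = 0} = pair_cover A \<union> T0)) \<and>
       (\<forall>b<m * (4 * k). \<forall>b'<m * (4 * k). int j + 1 \<le> aff_dim (active_face K c ({b, b'} \<union> T0))))"
proof -
  obtain m :: nat where m0: "0 < m" and m: "\<forall>(U::(real \<times> 'a::euclidean_space) set) H v z a.
    \<not> (subspace U \<and> subspace H \<and> dim H \<le> 2 * k + 1 \<and>
      (\<forall>i<m * (4 * k). v i \<in> H) \<and>
      (\<forall>A. pair_set k (m * (4 * k)) A \<longrightarrow>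
        z A \<in> U \<and> (\<forall>i<m * (4 * k). if i \<in> pair_cover A then v i \<bullet> z A = 0 else 0 < v i \<bullet> z A) \<and>
        a A \<in> lorentz_cone \<and> (\<exists>x\<in>U. a A \<bullet> x \<noteq> 0) \<and>
        (\<forall>x\<in>U. (\<forall>i\<in>pair_cover A. 0 \<le> v i \<bullet> x) \<longrightarrow> 0 \<le> a A \<bullet> x)) \<and>
      (\<forall>i<m * (4 * k). \<forall>j<m * (4 * k). \<exists>y\<in>lorentz_cone \<inter> U. y \<noteq> 0 \<and> v i \<bullet> y = 0 \<and> v j \<bullet> y = 0))"
    using lorentz_cone_obstruction[OF k, where 'a='a] by blast
  define n where "n = m * (4 * k)"
  note m = m[folded n_def]
  have False
    if J: "finite J" "{..<n} \<union> T0 \<subseteq> J" "{..<n} \<inter> T0 = {}"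
      and K: "K = {z. \<forall>l\<in>J. 0 \<le> c l \<bullet> z}" "proper_cone K" and scr: "cone_scribed i j K" and i: "i < DIM('a)"
      and H: "subspace H" "dim H \<le> 2 * k + 1"
      and cH: "\<forall>l<n. \<exists>h\<in>H. \<forall>x. (\<forall>t\<in>T0. c t \<bullet> x = 0) \<longrightarrow> c l \<bullet> x = h \<bullet> x"
      and nondeg: "\<forall>a. a \<noteq> 0 \<longrightarrow> (\<forall>x. (\<forall>t\<in>T0. c t \<bullet> x = 0) \<longrightarrow> a \<bullet> x = 0) \<longrightarrow>
          aff_dim (K \<inter> {x. a \<bullet> x = 0}) \<noteq> int i + 1"
      and vert: "\<forall>A. pair_set k n A \<longrightarrow> aff_dim (active_face K c (pair_cover A \<union> T0)) \<le> int i + 1 \<and>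
          (\<exists>z\<in>K. (\<forall>t\<in>T0. c t \<bullet> z = 0) \<and> {l\<in>J. c l \<bullet> z = 0} = pair_cover A \<union> T0)"
      and ridge: "\<forall>b<n. \<forall>b'<n. int j + 1 \<le> aff_dim (active_face K c ({b, b'} \<union> T0))"
    for K :: "(real \<times> 'a) set" and c J T0 H i j
  proof -
    \<comment> \<open>The argument takes place in \<open>U\<close>: the hyperplane of the base of a
      pyramid, or the whole space if \<open>T0\<close> is empty.\<close>
    define U where "U = {x. \<forall>t\<in>T0. c t \<bullet> x = 0}"
    have U: "subspace U" by (auto simp: U_def subspace_def inner_add_right)
    have cK: "convex_cone K" "polyhedron K" "interior K \<noteq> {}" using K(2) by (auto simp: proper_cone_def)
    have cd: "c l \<in> dual_cone K" if "l \<in> J" for l using that K(1) by (auto simp: dual_cone_def)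
    have AF: "active_face K c T \<in> cone_faces K" if "T \<subseteq> J" for T
      using active_face_in_cone_faces[OF cK(1)] cd that by blast
    have "\<forall>l. \<exists>h. l < n \<longrightarrow> h \<in> H \<and> (\<forall>x\<in>U. c l \<bullet> x = h \<bullet> x)" using cH unfolding U_def by blast
    then obtain v where v: "\<And>l. l < n \<Longrightarrow> v l \<in> H" "\<And>l x. l < n \<Longrightarrow> x \<in> U \<Longrightarrow> c l \<bullet> x = v l \<bullet> x"
      by metis
    have pc: "pair_cover A \<subseteq> {..<n}" if "pair_set k n A" for A
      using that by (auto simp: pair_cover_def pair_set_def)
    have "\<exists>z a. z \<in> U \<and> (\<forall>l<n. if l \<in> pair_cover A then v l \<bullet> z = 0 else 0 < v l \<bullet> z) \<and>
        a \<in> lorentz_cone \<and> (\<exists>x\<in>U. a \<bullet> x \<noteq> 0) \<and>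
        (\<forall>x\<in>U. (\<forall>l\<in>pair_cover A. 0 \<le> v l \<bullet> x) \<longrightarrow> 0 \<le> a \<bullet> x)" if A: "pair_set k n A" for A
    proof -
      let ?T = "pair_cover A \<union> T0"
      have T: "?T \<subseteq> J" using pc[OF A] J(2) by blast
      obtain z where z: "z \<in> K" "\<forall>t\<in>T0. c t \<bullet> z = 0" "{l\<in>J. c l \<bullet> z = 0} = ?T" using vert[rule_format, OF A] by blast
      have zU: "z \<in> U" using z(2) by (simp add: U_def)
      have F: "active_face K c ?T face_of K" "active_face K c ?T \<noteq> {}" using AF[OF T] by (auto simp: cone_faces_def)
      have dK: "aff_dim K = int DIM('a) + 1" using aff_dim_nonempty_interior[OF cK(3)] by simp
      \<comment> \<open>The face given by \<open>A\<close> is enlarged to an \<open>i\<close>-face,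
        whose avoiding hyperplane then supports \<open>K\<close> at \<open>z\<close> as
        well.\<close>
      obtain M where M: "M face_of K" "active_face K c ?T \<subseteq> M" "aff_dim M = int i + 1"
        using polyhedron_face_of_intermediate_dim[OF cK(2) F, of "int i + 1"] vert[rule_format, OF A] dK i by auto
      have "M \<in> cone_faces K" using M F by (auto simp: cone_faces_def)
      then obtain a where a: "a \<in> lorentz_cone" "a \<in> dual_cone K" "M = K \<inter> {x. a \<bullet> x = 0}" "a \<noteq> 0"
        using scr M(3) unfolding cone_scribed_def by blast
      have "z \<in> active_face K c ?T" using z by (auto simp: active_face_def)
      then have az: "a \<bullet> z = 0" using M(2) a(3) by blast
      have "\<exists>x\<in>U. a \<bullet> x \<noteq> 0" using nondeg a(4) M(3) unfolding a(3) U_def by blast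
      moreover have "if l \<in> pair_cover A then v l \<bullet> z = 0 else 0 < v l \<bullet> z" if l: "l < n" for l
      proof -
        have "l \<in> J" "l \<notin> T0" using l J(2,3) by auto
        then have "c l \<bullet> z = 0 \<longleftrightarrow> l \<in> pair_cover A" "0 \<le> c l \<bullet> z" using z K(1) by blast+
        then show ?thesis using v(2)[OF l zU] by auto
      qed
      moreover have "0 \<le> a \<bullet> x" if x: "x \<in> U" "\<forall>l\<in>pair_cover A. 0 \<le> v l \<bullet> x" for x
      proof (rule dual_cone_nonneg_at_active[OF J(1) K(1) z(1) a(2) az])
        fix l assume "l \<in> J" "c l \<bullet> z = 0"
        then consider "l \<in> T0" | "l \<in> pair_cover A" using z(3) by blast
        then show "0 \<le> c l \<bullet> x"
        proof cases
          case 1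
          then show ?thesis using x(1) by (simp add: U_def)
        next
          case 2
          then show ?thesis using x v(2)[of l x] pc[OF A] by fastforce
        qed
      qed
      ultimately show ?thesis using zU a(1) by blast
    qed
    then have "\<forall>A. \<exists>z a. pair_set k n A \<longrightarrow> (z \<in> U \<and> (\<forall>l<n. if l \<in> pair_cover A then v l \<bullet> z = 0 else 0 < v l \<bullet> z) \<and>
        a \<in> lorentz_cone \<and> (\<exists>x\<in>U. a \<bullet> x \<noteq> 0) \<and>
        (\<forall>x\<in>U. (\<forall>l\<in>pair_cover A. 0 \<le> v l \<bullet> x) \<longrightarrow> 0 \<le> a \<bullet> x))" by blast
    then obtain z a where za: "\<And>A. pair_set k n A \<Longrightarrow> z A \<in> U \<and> (\<forall>l<n. if l \<in> pair_cover A then v l \<bullet> z A = 0 else 0 < v l \<bullet> z A) \<and>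
        a A \<in> lorentz_cone \<and> (\<exists>x\<in>U. a A \<bullet> x \<noteq> 0) \<and>
        (\<forall>x\<in>U. (\<forall>l\<in>pair_cover A. 0 \<le> v l \<bullet> x) \<longrightarrow> 0 \<le> a A \<bullet> x)" by metis
    have "\<exists>y\<in>lorentz_cone \<inter> U. y \<noteq> 0 \<and> v b \<bullet> y = 0 \<and> v b' \<bullet> y = 0" if b: "b < n" "b' < n" for b b'
    proof -
      let ?F = "active_face K c ({b, b'} \<union> T0)"
      have F: "?F \<in> cone_faces K" using AF[of "{b, b'} \<union> T0"] b J(2) by auto
      have FK: "?F face_of K" using F by (simp add: cone_faces_def)
      have "{0} face_of ?F"
        using zero_cone_face[OF K(2)] F zero_mem_cone_face[OF cK(1) F] by (intro cone_face_subface) auto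
      moreover have "aff_dim {0::real \<times> 'a} \<le> int j + 1" by simp
      \<comment> \<open>The intersection of the two facets within \<open>U\<close> is large enough
        to contain a \<open>j\<close>-face, which has a nonzero point in the Lorentz cone.\<close>
      ultimately obtain M where M: "M face_of ?F" "{0} \<subseteq> M" "aff_dim M = int j + 1"
        using polyhedron_face_of_intermediate_dim[OF face_of_polyhedron_polyhedron[OF cK(2) FK]]
          ridge[rule_format, OF b] by blast
      have "M \<in> cone_faces K" using M FK face_of_trans by (auto simp: cone_faces_def)
      then obtain y where y: "y \<in> lorentz_cone" "y \<in> M" "y \<noteq> 0" using scr M(3) unfolding cone_scribed_def by blast
      have "y \<in> ?F" using M(1) y(2) face_of_imp_subset by blast
      then have yU: "y \<in> U" and "c b \<bullet> y = 0" "c b' \<bullet> y = 0" by (auto simp: active_face_def U_def)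
      then show ?thesis using y v(2)[OF b(1) yU] v(2)[OF b(2) yU] by (intro bexI[of _ y]) auto
    qed
    then have y: "\<forall>b<n. \<forall>b'<n. \<exists>y\<in>lorentz_cone \<inter> U. y \<noteq> 0 \<and> v b \<bullet> y = 0 \<and> v b' \<bullet> y = 0"
      by blast
    show False
    proof (rule notE[OF m[rule_format, of U H v z a]], intro conjI)
      show "\<forall>i<n. v i \<in> H" using v(1) by blast
      show "\<forall>A. pair_set k n A \<longrightarrow>
        z A \<in> U \<and> (\<forall>i<n. if i \<in> pair_cover A then v i \<bullet> z A = 0 else 0 < v i \<bullet> z A) \<and>
        a A \<in> lorentz_cone \<and> (\<exists>x\<in>U. a A \<bullet> x \<noteq> 0) \<and>
        (\<forall>x\<in>U. (\<forall>i\<in>pair_cover A. 0 \<le> v i \<bullet> x) \<longrightarrow> 0 \<le> a A \<bullet> x)"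
        by (intro allI impI) (rule za)
    qed (fact U H y)+
  qed
  note main = this
  show ?thesis
    by (intro exI[of _ m] conjI m0 allI notI, fold n_def, elim conjE) (rule main; assumption)
qed

text \<open>The equations in \<open>T\<close> define a subspace of codimension at most
  \<open>card T\<close>. Near \<open>z\<close> the other constraints are strict, so the face
  contains a nonempty relatively open part of this subspace.\<close>

lemma aff_dim_active_face_ge:
  fixes c :: "nat \<Rightarrow> 'a::euclidean_space"
  assumes J: "finite J" and K: "K = {z. \<forall>l\<in>J. 0 \<le> c l \<bullet> z}"
    and T: "{l\<in>J. c l \<bullet> z = 0} = T" and z: "z \<in> K"
  shows "int DIM('a) - int (card T) \<le> aff_dim (active_face K c T)"
proof -
  define S where "S = {x. \<forall>l\<in>T. c l \<bullet> x = 0}"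
  have fT: "finite T" using T J by (auto intro: finite_subset[of _ J])
  have S: "subspace S" by (auto simp: S_def subspace_def inner_add_right)
  have "S = {y \<in> UNIV. \<forall>x\<in>span (c ` T). orthogonal x y}"
  proof (intro equalityI subsetI CollectI conjI UNIV_I ballI)
    fix y x assume "y \<in> S" "x \<in> span (c ` T)"
    then have "orthogonal y x"
      by (intro orthogonal_to_span[of x "c ` T"]) (auto simp: S_def orthogonal_def inner_commute)
    then show "orthogonal x y" by (simp add: orthogonal_commute)
  next
    fix y assume "y \<in> {y \<in> UNIV. \<forall>x\<in>span (c ` T). orthogonal x y}"
    then show "y \<in> S" by (auto simp: S_def orthogonal_def span_base)
  qed
  then have "dim S + dim (span (c ` T)) = DIM('a)"
    using dim_subspace_orthogonal_to_vectors[of "span (c ` T)" UNIV] by simp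
  moreover have "dim (span (c ` T)) \<le> card T"
    using dim_le_card'[of "c ` T"] card_image_le[OF fT, of c] fT by simp
  ultimately have dS: "int DIM('a) - int (card T) \<le> aff_dim S"
    using aff_dim_subspace[OF S] by linarith
  define W where "W = S \<inter> {x. \<forall>l\<in>J - T. 0 < c l \<bullet> x}"
  have "z \<in> W"
    using z T unfolding W_def S_def K by (auto simp: less_le)
  moreover have "openin (top_of_set S) W"
    unfolding W_def using open_strictly_positive[of "J - T" c] J by (intro openin_open_Int) auto
  ultimately have "aff_dim W = aff_dim S" using aff_dim_openin subspace_imp_affine[OF S] by blast
  moreover have "W \<subseteq> active_face K c T"
  proof
    fix x assume "x \<in> W"
    then have "\<forall>l\<in>J. 0 \<le> c l \<bullet> x" "\<forall>l\<in>T. c l \<bullet> x = 0" by (auto simp: W_def S_def) (metis DiffI less_eq_real_def)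
    then show "x \<in> active_face K c T" by (simp add: active_face_def K)
  qed
  ultimately show ?thesis using dS aff_dim_subset[of W "active_face K c T"] by simp
qed

section \<open>Spherical polytopes and their cones\<close>

lemma spherical_dpolytope_proper_cone:
  fixes Q :: "'a::euclidean_space set"
  assumes Q: "spherical_dpolytope d Q" and d: "DIM('a) = d + 1"
  shows "proper_cone (convex_cone hull Q)" "convex_cone hull Q \<inter> sphere 0 1 = Q"
proof -
  have sp: "spherical_polytope Q" and ad: "aff_dim (convex_cone hull Q) = int d + 1"
    using Q by (auto simp: spherical_dpolytope_def)
  have "interior (convex_cone hull Q) \<noteq> {}"
  proof
    assume "interior (convex_cone hull Q) = {}"
    then obtain a b where ab: "a \<noteq> 0" "convex_cone hull Q \<subseteq> {x. a \<bullet> x = b}"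
      using empty_interior_subset_hyperplane[OF convex_convex_cone_hull] by metis
    then have "aff_dim (convex_cone hull Q) \<le> int DIM('a) - 1"
      using aff_dim_subset[OF ab(2)] aff_dim_hyperplane[OF ab(1), of b] by simp
    then show False using ad d by simp
  qed
  then show "proper_cone (convex_cone hull Q)"
    unfolding proper_cone_def
    using spherical_polytope_cone(1)[OF sp] spherical_polytope_cone(3)[OF sp] convex_cone_convex_cone_hull[of Q]
    by blast
  show "convex_cone hull Q \<inter> sphere 0 1 = Q" by (rule spherical_polytope_cone(2)[OF sp])
qed

lemma proper_cone_spherical_dpolytope:
  fixes K :: "'a::euclidean_space set"
  assumes K: "proper_cone K" and d: "DIM('a) = d + 1"
  shows "spherical_dpolytope d (K \<inter> sphere 0 1)"
proof -
  have cK: "polyhedron K" "convex_cone K" "interior K \<noteq> {}"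
    and pt: "\<And>x. x \<in> K \<Longrightarrow> - x \<in> K \<Longrightarrow> x = 0"
    using K by (auto simp: proper_cone_def)
  obtain C where C: "finite C" "0 \<notin> C" "K = {z. \<forall>c\<in>C. 0 \<le> c \<bullet> z}"
    using polyhedral_cone_halfspaces[OF cK(1,2)] .
  have "K \<inter> sphere 0 1 = sphere 0 1 \<inter> (\<Inter>a\<in>uminus ` C. hemisphere a)"
    by (auto simp: C(3) hemisphere_def)
  moreover have "finite (uminus ` C)" "0 \<notin> uminus ` C" using C by auto
  moreover have "\<forall>x\<in>K \<inter> sphere 0 1. - x \<notin> K \<inter> sphere 0 1" using pt by fastforce
  ultimately have "spherical_polytope (K \<inter> sphere 0 1)" unfolding spherical_polytope_def by blast
  moreover have "aff_dim K = int d + 1" using aff_dim_nonempty_interior[OF cK(3)] d by simp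
  ultimately show ?thesis
    using convex_cone_hull_Int_sphere[OF cK(2)] by (simp add: spherical_dpolytope_def)
qed

lemma cone_face_of_sphere:
  assumes "convex_cone K" "G \<in> cone_faces K"
  shows "convex_cone hull (G \<inter> sphere 0 1) = G"
  by (rule convex_cone_hull_Int_sphere[OF cone_face_convex_cone[OF assms]])

lemma convex_cone_hull_spherical_face:
  assumes K: "proper_cone (convex_cone hull Q)" and F: "F \<in> spherical_faces Q"
  shows "convex_cone hull F \<in> cone_faces (convex_cone hull Q)" "convex_cone hull F \<inter> sphere 0 1 = F"
proof -
  obtain G where G: "F = G \<inter> sphere 0 1" "G face_of convex_cone hull Q"
    using F by (auto simp: spherical_faces_def)
  \<comment> \<open>The empty spherical face is represented by the apex.\<close>
  have "\<exists>G\<in>cone_faces (convex_cone hull Q). F = G \<inter> sphere 0 1"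
  proof (cases "G = {}")
    case True
    then show ?thesis using G zero_cone_face[OF K] by (intro bexI[of _ "{0}"]) auto
  next
    case False
    then show ?thesis using G by (auto simp: cone_faces_def)
  qed
  then obtain G where G: "G \<in> cone_faces (convex_cone hull Q)" "F = G \<inter> sphere 0 1" by blast
  have "convex_cone hull F = G"
    unfolding G(2) by (rule cone_face_of_sphere[OF convex_cone_convex_cone_hull G(1)])
  then show "convex_cone hull F \<in> cone_faces (convex_cone hull Q)" "convex_cone hull F \<inter> sphere 0 1 = F"
    using G by simp_all
qed

lemma bij_betw_spherical_faces:
  assumes K: "proper_cone (convex_cone hull Q)"
  shows "bij_betw (\<lambda>G. G \<inter> sphere 0 1) (cone_faces (convex_cone hull Q)) (spherical_faces Q)"
    and "bij_betw (\<lambda>F. convex_cone hull F) (spherical_faces Q) (cone_faces (convex_cone hull Q))"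
proof -
  have *: "(\<lambda>G. G \<inter> sphere 0 1) \<in> cone_faces (convex_cone hull Q) \<rightarrow> spherical_faces Q"
    "(\<lambda>F. convex_cone hull F) \<in> spherical_faces Q \<rightarrow> cone_faces (convex_cone hull Q)"
    using convex_cone_hull_spherical_face(1)[OF K] by (auto simp: cone_faces_def spherical_faces_def)
  show "bij_betw (\<lambda>G. G \<inter> sphere 0 1) (cone_faces (convex_cone hull Q)) (spherical_faces Q)"
    using * cone_face_of_sphere[OF convex_cone_convex_cone_hull] convex_cone_hull_spherical_face(2)[OF K]
    by (rule bij_betwI)
  show "bij_betw (\<lambda>F. convex_cone hull F) (spherical_faces Q) (cone_faces (convex_cone hull Q))"
    using *(2,1) convex_cone_hull_spherical_face(2)[OF K] cone_face_of_sphere[OF convex_cone_convex_cone_hull]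
    by (rule bij_betwI)
qed

lemma isomorphic_face_lattices_face_isomorphic:
  assumes Q: "proper_cone (convex_cone hull Q)" and P: "proper_cone (convex_cone hull P)"
    and QP: "isomorphic_face_lattices Q P"
  shows "face_isomorphic (convex_cone hull Q) (convex_cone hull P)"
proof -
  obtain f where f: "bij_betw f (spherical_faces Q) (spherical_faces P)"
    "\<forall>F\<in>spherical_faces Q. \<forall>G\<in>spherical_faces Q. F \<subseteq> G \<longleftrightarrow> f F \<subseteq> f G"
    using QP unfolding isomorphic_face_lattices_def by blast
  let ?s = "\<lambda>G. G \<inter> sphere 0 1" and ?t = "\<lambda>F. convex_cone hull F"
  have bQ: "bij_betw ?s (cone_faces (?t Q)) (spherical_faces Q)"
    and tP: "bij_betw ?t (spherical_faces P) (cone_faces (?t P))"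
    and tsP: "\<And>F. F \<in> spherical_faces P \<Longrightarrow> ?s (?t F) = F"
    using bij_betw_spherical_faces(1)[OF Q] bij_betw_spherical_faces(2)[OF P]
      convex_cone_hull_spherical_face(2)[OF P] by this+
  define \<phi> where "\<phi> = ?t \<circ> f \<circ> ?s"
  have "bij_betw \<phi> (cone_faces (?t Q)) (cone_faces (?t P))"
    using bij_betw_trans[OF bij_betw_trans[OF bQ f(1)] tP] by (simp add: \<phi>_def comp_assoc)
  moreover have "F \<subseteq> G \<longleftrightarrow> \<phi> F \<subseteq> \<phi> G" if FG: "F \<in> cone_faces (?t Q)" "G \<in> cone_faces (?t Q)" for F G
  proof -
    have sF: "?s F \<in> spherical_faces Q" "?s G \<in> spherical_faces Q"
      using bij_betw_apply[OF bQ] FG by blast+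
    have fF: "f (?s F) \<in> spherical_faces P" "f (?s G) \<in> spherical_faces P"
      using bij_betw_apply[OF f(1)] sF by blast+
    have "F \<subseteq> G \<longleftrightarrow> ?s F \<subseteq> ?s G"
    proof
      assume "?s F \<subseteq> ?s G"
      then have "?t (?s F) \<subseteq> ?t (?s G)" by (rule hull_mono)
      then show "F \<subseteq> G"
        unfolding cone_face_of_sphere[OF convex_cone_convex_cone_hull FG(1)]
          cone_face_of_sphere[OF convex_cone_convex_cone_hull FG(2)] .
    qed blast
    also have "\<dots> \<longleftrightarrow> f (?s F) \<subseteq> f (?s G)" by (rule f(2)[rule_format, OF sF])
    also have "\<dots> \<longleftrightarrow> ?t (f (?s F)) \<subseteq> ?t (f (?s G))"
    proof
      assume "?t (f (?s F)) \<subseteq> ?t (f (?s G))"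
      then have "?s (?t (f (?s F))) \<subseteq> ?s (?t (f (?s G)))" by (rule Int_mono) (rule order_refl)
      then show "f (?s F) \<subseteq> f (?s G)" unfolding tsP[OF fF(1)] tsP[OF fF(2)] .
    qed (rule hull_mono)
    finally show ?thesis by (simp add: \<phi>_def)
  qed
  ultimately show ?thesis unfolding face_isomorphic_def by (intro exI[of _ \<phi>]) simp
qed

section \<open>The cap as a section of the Lorentz cone, and polarity\<close>

lemma light_cap_eq: "light_cap = lorentz_cone \<inter> sphere 0 (1::real)"
proof -
  have s: "(\<Sum>k\<in>UNIV. (snd x $ k)\<^sup>2) = (norm (snd x))\<^sup>2" for x :: "real \<times> (real ^ 'n)"
    by (simp add: norm_vec_def L2_set_def sum_nonneg)
  have "0 \<le> fst x \<and> (norm (snd x))\<^sup>2 \<le> (fst x)\<^sup>2 \<longleftrightarrow> norm (snd x) \<le> fst x" for x :: "real \<times> (real ^ 'n)"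
  proof (intro iffI conjI)
    assume "0 \<le> fst x \<and> (norm (snd x))\<^sup>2 \<le> (fst x)\<^sup>2"
    then show "norm (snd x) \<le> fst x" by (blast intro: power2_le_imp_le)
  next
    assume le: "norm (snd x) \<le> fst x"
    then show "0 \<le> fst x" by (rule order_trans[OF norm_ge_zero])
    show "(norm (snd x))\<^sup>2 \<le> (fst x)\<^sup>2" using le by (intro power_mono) auto
  qed
  then show ?thesis unfolding light_cap_def lorentz_cone_def s by auto
qed

text \<open>The other half of self-duality: the boundary vector
  \<open>(norm (snd a), - snd a)\<close> is the critical test.\<close>

lemma lorentz_cone_contains_normal:
  fixes a :: "real \<times> 'a::real_inner"
  assumes "\<And>x. x \<in> lorentz_cone \<Longrightarrow> 0 \<le> a \<bullet> x"
  shows "a \<in> lorentz_cone"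
proof (cases "snd a = 0")
  case True
  have "0 \<le> a \<bullet> (1, 0)" by (rule assms) (simp add: lorentz_cone_def)
  then show ?thesis using True by (simp add: lorentz_cone_def inner_prod_def)
next
  case False
  have "0 \<le> a \<bullet> (norm (snd a), - snd a)" by (rule assms) (simp add: lorentz_cone_def)
  then have "norm (snd a) * norm (snd a) \<le> fst a * norm (snd a)"
    by (simp add: inner_prod_def power2_norm_eq_inner[symmetric] power2_eq_square)
  then show ?thesis using False by (simp add: lorentz_cone_def)
qed

text \<open>Polarity: a normal that cuts out \<open>F\<close> and avoids the cap is a point of the
  Lorentz cone in the dual face, and a point of the cone in the relative interior of
  \<open>F\<close> is a normal that cuts out the dual face. Duality sends dimension
  \<open>j + 1\<close> of a cone face to \<open>d - j\<close>, hence the index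
  \<open>d - 1 - j\<close>.\<close>

lemma cone_scribed_if_strongly_scribed:
  fixes Q :: "(real \<times> (real ^ 'n::finite)) set"
  assumes Q: "spherical_dpolytope CARD('n) Q" and scr: "strongly_scribed i j Q"
    and ij: "i \<le> j" "j \<le> CARD('n) - 1"
  shows "cone_scribed i j (convex_cone hull Q)"
    and "cone_scribed (CARD('n) - 1 - j) (CARD('n) - 1 - i) (dual_cone (convex_cone hull Q))"
proof -
  define K where "K = convex_cone hull Q"
  have K: "proper_cone K" and KQ: "K \<inter> sphere 0 1 = Q"
    using spherical_dpolytope_proper_cone[OF Q] by (auto simp: K_def)
  have cK: "convex_cone K" using K by (simp add: proper_cone_def)
  have d: "0 < CARD('n)" by simp
  have avoid: "\<exists>a\<in>lorentz_cone \<inter> dual_cone K. F = K \<inter> {x. a \<bullet> x = 0} \<and> a \<noteq> 0"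
    if F: "F \<in> cone_faces K" "aff_dim F = int i + 1" for F
  proof -
    have "F \<inter> sphere 0 1 \<in> spherical_kfaces i Q"
      using F by (auto simp: spherical_kfaces_def K_def[symmetric] cone_faces_def)
    then obtain a where a: "supporting_hyperplane a Q" "F \<inter> sphere 0 1 = great_sphere a \<inter> Q"
      "light_cap \<subseteq> hemisphere a"
      using scr unfolding strongly_scribed_def strongly_avoids_def by blast
    have a0: "a \<noteq> 0" "Q \<subseteq> hemisphere a" using a(1) by (auto simp: supporting_hyperplane_def)
    \<comment> \<open>Hemispheres are described by outer normals and dual cones by inner
      ones.\<close>
    have dual: "- a \<in> dual_cone K"
    proof -
      have "K \<subseteq> {x. a \<bullet> x \<le> 0}"
        unfolding K_def using a0(2) by (intro hull_minimal convex_cone_halfspace_le) (auto simp: hemisphere_def)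
      then show ?thesis by (auto simp: dual_cone_def)
    qed
    have "- a \<in> lorentz_cone"
    proof (rule lorentz_cone_contains_normal)
      fix x :: "real \<times> (real ^ 'n)" assume x: "x \<in> lorentz_cone"
      show "0 \<le> - a \<bullet> x"
      proof (cases "x = 0")
        case False
        then have "(1 / norm x) *\<^sub>R x \<in> light_cap"
          using x unfolding light_cap_eq by (auto simp: lorentz_cone_def field_simps)
        then have "a \<bullet> ((1 / norm x) *\<^sub>R x) \<le> 0" using a(3) by (auto simp: hemisphere_def)
        then show ?thesis using False by (simp add: divide_le_0_iff)
      qed simp
    qed
    moreover have "F = K \<inter> {x. - a \<bullet> x = 0}"
    proof -
      have G: "K \<inter> {x. - a \<bullet> x = 0} \<in> cone_faces K" using dual_cone_face[OF cK dual] by simp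
      have "F \<inter> sphere 0 1 = (K \<inter> {x. - a \<bullet> x = 0}) \<inter> sphere 0 1"
        unfolding a(2) KQ[symmetric] by (auto simp: great_sphere_def)
      then show ?thesis using cone_face_of_sphere[OF cK F(1)] cone_face_of_sphere[OF cK G] by simp
    qed
    ultimately show ?thesis using dual a0(1) by (intro bexI[of _ "- a"]) auto
  qed
  have cut: "\<exists>y\<in>lorentz_cone \<inter> rel_interior F. y \<noteq> 0"
    if F: "F \<in> cone_faces K" "aff_dim F = int j + 1" for F
  proof -
    have "F \<inter> sphere 0 1 \<in> spherical_kfaces j Q"
      using F by (auto simp: spherical_kfaces_def K_def[symmetric] cone_faces_def)
    then obtain y where y: "y \<in> spherical_relint (F \<inter> sphere 0 1)" "y \<in> light_cap"
      using scr unfolding strongly_scribed_def strongly_cuts_def by blast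
    then have "y \<in> rel_interior F" "norm y = 1" "y \<in> lorentz_cone"
      using cone_face_of_sphere[OF cK F(1)] by (auto simp: spherical_relint_def light_cap_eq)
    then show ?thesis by (intro bexI[of _ y]) auto
  qed
  show "cone_scribed i j (convex_cone hull Q)"
    unfolding cone_scribed_def K_def[symmetric] using avoid cut rel_interior_subset by blast
  have D: "proper_cone (dual_cone K)" by (rule proper_dual_cone[OF K])
  have DD: "dual_cone (dual_cone K) = K" by (rule dual_dual_cone[OF K])
  have DIM: "int DIM(real \<times> (real ^ 'n)) = int CARD('n) + 1" by simp
  show "cone_scribed (CARD('n) - 1 - j) (CARD('n) - 1 - i) (dual_cone (convex_cone hull Q))"
    unfolding cone_scribed_def K_def[symmetric] DD
  proof (intro conjI ballI impI)
    fix G assume G: "G \<in> cone_faces (dual_cone K)" "aff_dim G = int (CARD('n) - 1 - j) + 1"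
    define F where "F = dual_face (dual_cone K) G"
    have F: "F \<in> cone_faces K" using dual_face_cone_face[OF D G(1)] by (simp add: F_def DD)
    have FG: "dual_face K F = G" using dual_face_dual_face[OF D G(1)] by (simp add: F_def DD)
    have "aff_dim F = int j + 1"
      using aff_dim_dual_face[OF D G(1)] G(2) ij d unfolding F_def[symmetric] DIM by (simp add: of_nat_diff)
    then obtain y where y: "y \<in> lorentz_cone" "y \<in> rel_interior F" "y \<noteq> 0" using cut[OF F] by blast
    have yF: "y \<in> F" using y(2) rel_interior_subset by blast
    have FK: "F \<subseteq> K" using F by (auto simp: cone_faces_def dest: face_of_imp_subset)
    have "G = dual_cone K \<inter> {a. y \<bullet> a = 0}"
    proof
      show "G \<subseteq> dual_cone K \<inter> {a. y \<bullet> a = 0}"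
        unfolding FG[symmetric] using yF by (auto simp: dual_face_def inner_commute)
      show "dual_cone K \<inter> {a. y \<bullet> a = 0} \<subseteq> G"
      proof
        fix a assume a: "a \<in> dual_cone K \<inter> {a. y \<bullet> a = 0}"
        \<comment> \<open>A face that meets the relative interior of \<open>F\<close> contains
          \<open>F\<close>, so vanishing at \<open>y\<close> forces \<open>a\<close> to vanish on
          \<open>F\<close>.\<close>
        have "K \<inter> {x. a \<bullet> x = 0} face_of K" using dual_cone_face[OF cK] a by (auto simp: cone_faces_def)
        moreover have "K \<inter> {x. a \<bullet> x = 0} \<inter> rel_interior F \<noteq> {}"
          using a y(2) yF FK by (auto simp: inner_commute)
        ultimately have "F \<subseteq> K \<inter> {x. a \<bullet> x = 0}" using subset_of_face_of FK by blast
        then show "a \<in> G" unfolding FG[symmetric] using a by (auto simp: dual_face_def)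
      qed
    qed
    then show "\<exists>a\<in>lorentz_cone \<inter> K. G = dual_cone K \<inter> {x. a \<bullet> x = 0} \<and> a \<noteq> 0"
      using y yF FK by blast
  next
    fix G assume G: "G \<in> cone_faces (dual_cone K)" "aff_dim G = int (CARD('n) - 1 - i) + 1"
    define F where "F = dual_face (dual_cone K) G"
    have F: "F \<in> cone_faces K" using dual_face_cone_face[OF D G(1)] by (simp add: F_def DD)
    have FG: "dual_face K F = G" using dual_face_dual_face[OF D G(1)] by (simp add: F_def DD)
    have "aff_dim F = int i + 1"
      using aff_dim_dual_face[OF D G(1)] G(2) ij d unfolding F_def[symmetric] DIM by (simp add: of_nat_diff)
    then obtain a where a: "a \<in> lorentz_cone" "a \<in> dual_cone K" "F = K \<inter> {x. a \<bullet> x = 0}" "a \<noteq> 0"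
      using avoid[OF F] by blast
    then have "a \<in> dual_face K F" by (simp add: dual_face_def)
    then show "\<exists>y\<in>lorentz_cone \<inter> G. y \<noteq> 0" using a FG by blast
  qed
qed

section \<open>Moment cones\<close>

text \<open>The point of the homogenized moment curve with parameter \<open>l\<close>, written in
  the first \<open>2 * k + 1\<close> vectors of \<open>e\<close>.\<close>

definition moment_vec :: "(nat \<Rightarrow> 'a::real_vector) \<Rightarrow> nat \<Rightarrow> nat \<Rightarrow> 'a" where
  "moment_vec e k l = (\<Sum>r\<le>2 * k. real l ^ r *\<^sub>R e r)"

text \<open>With this encoding, pairing with \<open>moment_vec\<close> is evaluation of the
  polynomial, so incidences with facets become roots.\<close>

definition vec_of_poly :: "(nat \<Rightarrow> 'a::real_vector) \<Rightarrow> nat \<Rightarrow> real poly \<Rightarrow> 'a" where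
  "vec_of_poly e k p = (\<Sum>r\<le>2 * k. coeff p r *\<^sub>R e r)"

lemma inner_Basis_enumeration:
  fixes e :: "nat \<Rightarrow> 'a::euclidean_space"
  assumes basis: "bij_betw e {..<DIM('a)} Basis"
    and "r < DIM('a)" "s < DIM('a)"
  shows "e r \<bullet> e s = (if r = s then 1 else 0)"
proof -
  have "e r \<in> Basis" "e s \<in> Basis" using assms by (auto simp: bij_betw_def)
  moreover have "e r = e s \<longleftrightarrow> r = s" using assms by (auto simp: bij_betw_def inj_on_def)
  ultimately show ?thesis by (simp add: inner_Basis)
qed

lemma eq_0_if_coordinates_0:
  fixes e :: "nat \<Rightarrow> 'a::euclidean_space"
  assumes basis: "bij_betw e {..<DIM('a)} Basis"
    and "\<And>r. r < DIM('a) \<Longrightarrow> e r \<bullet> z = 0"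
  shows "z = 0"
proof -
  have "\<forall>u\<in>Basis. z \<bullet> u = 0"
  proof
    fix u :: 'a assume "u \<in> Basis"
    then obtain r where "r < DIM('a)" "u = e r" using basis by (auto simp: bij_betw_def)
    then show "z \<bullet> u = 0" using assms by (simp add: inner_commute)
  qed
  then show ?thesis by (simp add: euclidean_all_zero_iff)
qed

lemma moment_vec_inner:
  fixes e :: "nat \<Rightarrow> 'a::euclidean_space"
  shows "moment_vec e k l \<bullet> z = (\<Sum>r\<le>2 * k. real l ^ r * (e r \<bullet> z))"
  by (simp add: moment_vec_def inner_sum_left)

lemma inner_vec_of_poly:
  fixes e :: "nat \<Rightarrow> 'a::euclidean_space"
  assumes basis: "bij_betw e {..<DIM('a)} Basis" and k_less: "2 * k < DIM('a)"
    and "r < DIM('a)"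
  shows "e r \<bullet> vec_of_poly e k p = (if r \<le> 2 * k then coeff p r else 0)"
proof -
  have "e r \<bullet> vec_of_poly e k p = (\<Sum>s\<le>2 * k. if r = s then coeff p s else 0)"
    unfolding vec_of_poly_def inner_sum_right
    using assms k_less by (intro sum.cong) (auto simp: inner_Basis_enumeration[OF basis])
  then show ?thesis by (simp add: sum.delta)
qed

lemma moment_vec_inner_vec_of_poly:
  fixes e :: "nat \<Rightarrow> 'a::euclidean_space"
  assumes basis: "bij_betw e {..<DIM('a)} Basis" and k_less: "2 * k < DIM('a)"
    and "degree p \<le> 2 * k"
  shows "moment_vec e k l \<bullet> vec_of_poly e k p = poly p (real l)"
proof -
  have "moment_vec e k l \<bullet> vec_of_poly e k p = (\<Sum>r\<le>2 * k. coeff p r * real l ^ r)"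
    unfolding moment_vec_inner using k_less by (intro sum.cong) (auto simp: inner_vec_of_poly[OF basis k_less])
  also have "\<dots> = (\<Sum>r\<le>degree p. coeff p r * real l ^ r)"
    using assms by (intro sum.mono_neutral_right) (auto simp: coeff_eq_0 not_le)
  finally show ?thesis by (simp add: poly_altdef)
qed

lemma moment_vec_inner_eq_0:
  fixes e :: "nat \<Rightarrow> 'a::euclidean_space"
  assumes basis: "bij_betw e {..<DIM('a)} Basis" and k_less: "2 * k < DIM('a)"
    and "2 * k < r" "r < DIM('a)"
  shows "moment_vec e k l \<bullet> e r = 0"
  unfolding moment_vec_inner using assms k_less by (intro sum.neutral) (auto simp: inner_Basis_enumeration[OF basis])

text \<open>The coordinates are the coefficients of a polynomial of degree at most
  \<open>2 * k\<close> with more than \<open>2 * k\<close> roots.\<close>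

lemma coordinates_0_if_moments_0:
  fixes e :: "nat \<Rightarrow> 'a::euclidean_space"
  assumes S: "finite S" "2 * k < card S" and z: "\<And>l. l \<in> S \<Longrightarrow> moment_vec e k l \<bullet> z = 0" and r: "r \<le> 2 * k"
  shows "e r \<bullet> z = 0"
proof -
  define p where "p = (\<Sum>r\<le>2 * k. monom (e r \<bullet> z) r)"
  have root: "poly p (real l) = 0" if "l \<in> S" for l
    using z[OF that] by (simp add: p_def poly_sum poly_monom moment_vec_inner mult.commute)
  have deg: "degree p \<le> 2 * k"
    unfolding p_def by (intro degree_sum_le) (auto intro: order_trans[OF degree_monom_le])
  have "p = 0"
  proof (rule ccontr)
    assume p: "p \<noteq> 0"
    have "card S = card (real ` S)" by (simp add: card_image)
    also have "\<dots> \<le> card {x. poly p x = 0}"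
      using root p by (intro card_mono poly_roots_finite) auto
    also have "\<dots> \<le> 2 * k" using card_poly_roots_bound[OF p] deg by simp
    finally show False using S(2) by simp
  qed
  then have "coeff p r = 0" by simp
  then show ?thesis using r by (simp add: p_def coeff_sum_monom)
qed

section \<open>Polynomials that witness the vertices and the pairwise intersections of
  facets\<close>

definition pair_poly :: "nat set \<Rightarrow> real poly" where
  "pair_poly A = (\<Prod>s\<in>A. [:- real s, 1:] * [:- (real s + 1), 1:])"

text \<open>No integer lies strictly between \<open>s\<close> and \<open>s + 1\<close>, so each
  quadratic factor is nonnegative at the integers.\<close>

lemma poly_pair_poly:
  assumes "finite A"
  shows "0 \<le> poly (pair_poly A) (real l)"
    and "poly (pair_poly A) (real l) = 0 \<longleftrightarrow> l \<in> pair_cover A"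
proof -
  have e: "poly (pair_poly A) (real l) = (\<Prod>s\<in>A. (real l - real s) * (real l - (real s + 1)))"
    by (simp add: pair_poly_def poly_prod algebra_simps)
  show "0 \<le> poly (pair_poly A) (real l)"
    unfolding e
  proof (rule prod_nonneg)
    fix s assume "s \<in> A"
    show "0 \<le> (real l - real s) * (real l - (real s + 1))"
    proof (cases "l \<le> s")
      case True
      then show ?thesis by (intro mult_nonpos_nonpos) auto
    next
      case False
      then have "real s + 1 \<le> real l" by linarith
      then show ?thesis by (intro mult_nonneg_nonneg) auto
    qed
  qed
  have "(real l - real s) * (real l - (real s + 1)) = 0 \<longleftrightarrow> l = s \<or> l = Suc s" for s by auto
  then show "poly (pair_poly A) (real l) = 0 \<longleftrightarrow> l \<in> pair_cover A"
    unfolding e pair_cover_def using assms by auto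
qed

lemma degree_pair_poly:
  assumes "finite A"
  shows "degree (pair_poly A) \<le> 2 * card A"
proof -
  have "degree (pair_poly A) \<le> (\<Sum>s\<in>A. degree ([:- real s, 1:] * [:- (real s + 1), 1:]))"
    unfolding pair_poly_def using degree_prod_sum_le[OF assms] by (simp only: comp_def)
  also have "\<dots> \<le> (\<Sum>s\<in>A. 2)"
    by (intro sum_mono order_trans[OF degree_mult_le]) simp
  finally show ?thesis by simp
qed

text \<open>Its double roots at \<open>b\<close> and \<open>b'\<close> keep it nonnegative. For
  \<open>b = b'\<close> it still vanishes at that single parameter only.\<close>

definition double_poly :: "nat \<Rightarrow> nat \<Rightarrow> real poly" where
  "double_poly b b' = ([:- real b, 1:] * [:- real b', 1:])\<^sup>2"

lemma poly_double_poly: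
  "0 \<le> poly (double_poly b b') (real l)"
  "poly (double_poly b b') (real l) = 0 \<longleftrightarrow> l \<in> {b, b'}"
proof -
  have "poly (double_poly b b') (real l) = ((real l - real b) * (real l - real b'))\<^sup>2"
    by (simp add: double_poly_def power2_eq_square algebra_simps)
  then show "0 \<le> poly (double_poly b b') (real l)"
    "poly (double_poly b b') (real l) = 0 \<longleftrightarrow> l \<in> {b, b'}" by auto
qed

lemma degree_double_poly: "degree (double_poly b b') \<le> 4"
proof -
  have "degree ([:- real b, 1:] * [:- real b', 1:]) \<le> 2"
    by (rule order_trans[OF degree_mult_le]) simp
  then show ?thesis unfolding double_poly_def
    by (intro order_trans[OF degree_power_le]) simp
qed

lemma aff_dim_le_card_span:
  assumes "S \<subseteq> span B" "finite B"
  shows "aff_dim S \<le> int (card B)"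
proof -
  have "aff_dim S \<le> aff_dim (span B)" by (rule aff_dim_subset[OF assms(1)])
  also have "\<dots> = int (dim (span B))" by (rule aff_dim_subspace) simp
  also have "\<dots> \<le> int (card B)" using dim_le_card'[OF assms(2)] by simp
  finally show ?thesis .
qed

lemma dim_hyperplane_less:
  fixes a :: "'a::euclidean_space"
  assumes "a \<noteq> 0"
  shows "dim {x. a \<bullet> x = 0} < DIM('a)"
  using dim_Int_hyperplane_less[of UNIV a a] assms by (simp add: inner_commute)

text \<open>The witness is the cone over the dual cyclic polytope of dimension \<open>2 * k\<close>, or over the
  pyramid with this polytope as its base if the dimension is odd. For \<open>j \<le> 2 * k - 2\<close> the
  contradiction arises in the base, and otherwise in the quotient by the apex.\<close>

lemma moment_cone_not_scribable:
  fixes k :: nat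
  assumes k: "2 \<le> k" and D: "DIM('a::euclidean_space) = 2 * k \<or> DIM('a) = 2 * k + 1"
  shows "\<exists>K::(real \<times> 'a) set. proper_cone K \<and>
    (\<forall>(K'::(real \<times> 'a) set) i j. proper_cone K' \<longrightarrow> face_isomorphic K' K \<longrightarrow> i \<le> j \<longrightarrow>
      (j \<le> 2 * k - 2 \<or> DIM('a) = 2 * k + 1 \<and> 1 \<le> i \<and> j \<le> 2 * k - 1) \<longrightarrow> \<not> cone_scribed i j K')"
proof -
  obtain e0 :: "nat \<Rightarrow> real \<times> 'a" where "bij_betw e0 {0..<DIM(real \<times> 'a)} Basis"
    using ex_bij_betw_nat_finite[of "Basis :: (real \<times> 'a) set"] by auto
  then have basis: "bij_betw e0 {..<DIM(real \<times> 'a)} Basis" by (simp add: lessThan_atLeast0)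
  have k_less: "2 * k < DIM(real \<times> 'a)" using D by auto
  define mom where "mom = moment_vec e0 k"
  define vec_of where "vec_of = vec_of_poly e0 k"
  note mom_e_0 = moment_vec_inner_eq_0[OF basis k_less, folded mom_def]
    and e_vec_of = inner_vec_of_poly[OF basis k_less, folded vec_of_def]
    and mom_vec_of = moment_vec_inner_vec_of_poly[OF basis k_less, folded mom_def vec_of_def]
    and mom_zeros = coordinates_0_if_moments_0[of _ k e0, folded mom_def]
    and e_inner = inner_Basis_enumeration[OF basis]
  have "0 < k" using k by simp
  then obtain m :: nat where m0: "0 < m" and m: "\<forall>(K::(real \<times> 'a) set) c J T0 H i j.
    \<not> (finite J \<and> {..<m * (4 * k)} \<union> T0 \<subseteq> J \<and> {..<m * (4 * k)} \<inter> T0 = {} \<and>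
       K = {z. \<forall>l\<in>J. 0 \<le> c l \<bullet> z} \<and> proper_cone K \<and> cone_scribed i j K \<and> i < DIM('a) \<and>
       subspace H \<and> dim H \<le> 2 * k + 1 \<and>
       (\<forall>l<m * (4 * k). \<exists>h\<in>H. \<forall>x. (\<forall>t\<in>T0. c t \<bullet> x = 0) \<longrightarrow> c l \<bullet> x = h \<bullet> x) \<and>
       (\<forall>a. a \<noteq> 0 \<longrightarrow> (\<forall>x. (\<forall>t\<in>T0. c t \<bullet> x = 0) \<longrightarrow> a \<bullet> x = 0) \<longrightarrow>
          aff_dim (K \<inter> {x. a \<bullet> x = 0}) \<noteq> int i + 1) \<and>
       (\<forall>A. pair_set k (m * (4 * k)) A \<longrightarrow>
          aff_dim (active_face K c (pair_cover A \<union> T0)) \<le> int i + 1 \<and>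
          (\<exists>z\<in>K. (\<forall>t\<in>T0. c t \<bullet> z = 0) \<and> {l\<in>J. c l \<bullet> z = 0} = pair_cover A \<union> T0)) \<and>
       (\<forall>b<m * (4 * k). \<forall>b'<m * (4 * k). int j + 1 \<le> aff_dim (active_face K c ({b, b'} \<union> T0))))"
    using dual_cyclic_face_not_scribed[OF \<open>0 < k\<close>, where 'a='a]
    by (elim exE conjE) (rule that, assumption+)
  define n where "n = m * (4 * k)"
  note m = m[folded n_def]
  have "1 * (4 * k) \<le> n" unfolding n_def using m0 by (intro mult_le_mono1) simp
  then have n: "2 * k < n" using k by linarith
  \<comment> \<open>The index \<open>n\<close> belongs to the base of the pyramid and exists only in
    odd dimension.\<close>
  define X where "X = (if DIM('a) = 2 * k then {} else {n})"
  define J where "J = {..<n} \<union> X"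
  \<comment> \<open>The default 0 lets the even case share all formulas with the pyramid.\<close>
  define e' where "e' = (if X = {} then 0 else e0 (2 * k + 1))"
  define c where "c l = (if l < n then mom l else e')" for l
  define K where "K = {z. \<forall>l\<in>J. 0 \<le> c l \<bullet> z}"
  \<comment> \<open>A polynomial at height \<open>t\<close> above the base: \<open>t = 0\<close>
    gives the base, and \<open>w 0 1\<close> is the apex of the pyramid.\<close>
  define w where "w p t = vec_of p + t *\<^sub>R e'" for p t
  have J: "finite J" by (simp add: J_def X_def)
  have Xn: "l \<notin> {..<n}" if "l \<in> X" for l using that by (auto simp: X_def split: if_splits)
  have cardX: "DIM(real \<times> 'a) = 2 * k + 1 + card X" using D by (auto simp: X_def)
  have e'_vec: "e' \<bullet> vec_of p = 0" for p using D by (auto simp: e'_def X_def e_vec_of)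
  have mom_e': "mom l \<bullet> e' = 0" for l using D by (auto simp: e'_def X_def mom_e_0)
  have e'1: "e' \<bullet> e' = 1" if "l \<in> X" for l using that D by (auto simp: e'_def X_def e_inner split: if_splits)
  have cw: "c l \<bullet> w p t = poly p (real l)" if "l < n" "degree p \<le> 2 * k" for l p t
    using that mom_e' by (simp add: c_def w_def inner_add_right mom_vec_of)
  have cX: "c l = e'" if "l \<in> X" for l using Xn[OF that] by (simp add: c_def)
  have cwX: "c l \<bullet> w p t = t" if "l \<in> X" for l p t
    using that e'1[OF that] by (simp add: cX w_def inner_add_right e'_vec)
  have wK: "w p t \<in> K" if "degree p \<le> 2 * k" "\<And>l. 0 \<le> poly p (real l)" "0 \<le> t" for p t
    using that cw cwX by (auto simp: K_def J_def)
  have wz: "{l\<in>J. c l \<bullet> w p t = 0} = {l. l < n \<and> poly p (real l) = 0} \<union> (if t = 0 then X else {})"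
    if "degree p \<le> 2 * k" for p t
    using that cw cwX Xn by (auto simp: J_def)
  have coord: "z = 0" if "\<And>r. r \<le> 2 * k \<Longrightarrow> e0 r \<bullet> z = 0" "e' \<bullet> z = 0" for z
  proof (rule eq_0_if_coordinates_0[OF basis])
    fix r assume "r < DIM(real \<times> 'a)"
    then have "r \<le> 2 * k \<or> X \<noteq> {} \<and> r = 2 * k + 1" using D by (auto simp: X_def)
    then show "e0 r \<bullet> z = 0"
    proof (elim disjE conjE)
      assume "X \<noteq> {}" "r = 2 * k + 1"
      then have "e0 r = e'" by (simp add: e'_def)
      then show ?thesis using that(2) by simp
    qed (rule that(1))
  qed
  have pos: "\<forall>l\<in>J. 0 < c l \<bullet> w 1 1" using cw[of _ 1 1] cwX by (auto simp: J_def)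
  have K: "proper_cone K"
    unfolding proper_cone_def
  proof (intro conjI ballI impI)
    have eq: "K = (\<Inter>l\<in>J. {z. 0 \<le> c l \<bullet> z})" by (auto simp: K_def)
    show "polyhedron K" unfolding eq using J polyhedron_halfspace_ge by (intro polyhedron_Inter) auto
    show "convex_cone K" unfolding eq using convex_cone_halfspace_ge by (intro convex_cone_Inter) auto
    have "{z. \<forall>l\<in>J. 0 < c l \<bullet> z} \<subseteq> interior K"
      by (intro interior_maximal open_strictly_positive[OF J]) (auto simp: K_def intro: less_imp_le)
    then show "interior K \<noteq> {}" using pos by blast
    fix z assume z: "z \<in> K" "- z \<in> K"
    have cz: "c l \<bullet> z = 0" if "l \<in> J" for l using z that by (force simp: K_def)
    show "z = 0"
    proof (rule coord)
      have "mom l \<bullet> z = 0" if "l < n" for l using cz[of l] that by (simp add: c_def J_def)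
      then show "e0 r \<bullet> z = 0" if "r \<le> 2 * k" for r
        using mom_zeros[of "{..<n}" z r] n that by simp
      show "e' \<bullet> z = 0"
      proof (cases "X = {}")
        case False
        then obtain l where "l \<in> X" by blast
        then show ?thesis using cz[of l] cX by (simp add: J_def)
      qed (simp add: e'_def)
    qed
  qed
  \<comment> \<open>The \<open>2 * k\<close> roots and the value at the further parameter
    \<open>n\<close> determine the polynomial part, which is therefore a multiple of
    \<open>pair_poly A\<close>.\<close>
  have vert_span: "z = (mom n \<bullet> z / poly (pair_poly A) (real n)) *\<^sub>R vec_of (pair_poly A) + (e' \<bullet> z) *\<^sub>R e'"
    if A: "pair_set k n A" and z: "\<forall>l\<in>pair_cover A. mom l \<bullet> z = 0" for z A
  proof -
    have fA: "finite A" "card A = k" using A by (auto simp: pair_set_def)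
    have nA: "n \<notin> pair_cover A" using A by (auto simp: pair_set_def pair_cover_def)
    have deg: "degree (pair_poly A) \<le> 2 * k" using degree_pair_poly[OF fA(1)] fA(2) by simp
    define u where "u = z - (mom n \<bullet> z / poly (pair_poly A) (real n)) *\<^sub>R vec_of (pair_poly A) - (e' \<bullet> z) *\<^sub>R e'"
    have mu: "mom l \<bullet> u = 0" if "l \<in> insert n (pair_cover A)" for l
      using that z poly_pair_poly(2)[OF fA(1)] nA
      by (auto simp: u_def inner_diff_right mom_e' mom_vec_of[OF deg])
    have "u = 0"
    proof (rule coord)
      have fin: "finite (pair_cover A)" using fA(1) by (simp add: pair_cover_def)
      have "2 * k < card (insert n (pair_cover A))" using card_pair_cover[OF A] nA fin by simp
      then show "e0 r \<bullet> u = 0" if "r \<le> 2 * k" for r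
        using mom_zeros[of "insert n (pair_cover A)" u r] mu that fin by blast
      have "(e' \<bullet> z) * (e' \<bullet> e') = e' \<bullet> z"
      proof (cases "X = {}")
        case False
        then show ?thesis using e'1 by auto
      qed (simp add: e'_def)
      then show "e' \<bullet> u = 0" by (simp add: u_def inner_diff_right e'_vec)
    qed
    then show ?thesis by (simp add: u_def algebra_simps)
  qed
  have "\<not> cone_scribed i j K'"
    if K': "proper_cone K'" and iso: "face_isomorphic K' K" and ij: "i \<le> j"
      and range: "j \<le> 2 * k - 2 \<or> DIM('a) = 2 * k + 1 \<and> 1 \<le> i \<and> j \<le> 2 * k - 1"
    for K' :: "(real \<times> 'a) set" and i j
  proof
    assume scr: "cone_scribed i j K'"
    obtain c' where K'c: "K' = {z. \<forall>l\<in>J. 0 \<le> c' l \<bullet> z}"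
      and tr: "\<And>T z. T \<subseteq> J \<Longrightarrow> z \<in> K \<Longrightarrow> {l\<in>J. c l \<bullet> z = 0} = T \<Longrightarrow>
        (\<exists>z'\<in>K'. {l\<in>J. c' l \<bullet> z' = 0} = T) \<and> aff_dim (active_face K' c' T) = aff_dim (active_face K c T)"
      using face_isomorphism_transfers_halfspaces[OF J K_def K pos K' iso] by blast
    have nonzero: "c' l \<noteq> 0" if l: "l \<in> J" for l
    proof -
      obtain z' where "{l\<in>J. c' l \<bullet> z' = 0} = {}"
        using tr[of "{}" "w 1 1"] wK[of 1 1] pos by (auto simp: less_le)
      then show ?thesis using l by auto
    qed
    \<comment> \<open>With \<open>T0 = X\<close> the face is a ray in the base; with
      \<open>T0 = {}\<close> the direction of the apex may add one dimension.\<close>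
    have vert: "aff_dim (active_face K' c' (pair_cover A \<union> T0)) \<le> 1 + int (card (X - T0)) \<and>
        (\<exists>z\<in>K'. (\<forall>t\<in>T0. c' t \<bullet> z = 0) \<and> {l\<in>J. c' l \<bullet> z = 0} = pair_cover A \<union> T0)"
      if A: "pair_set k n A" and T0: "T0 = X \<or> T0 = {}" for A T0
    proof -
      have fA: "finite A" "card A = k" using A by (auto simp: pair_set_def)
      have deg: "degree (pair_poly A) \<le> 2 * k" using degree_pair_poly[OF fA(1)] fA(2) by simp
      have pc: "pair_cover A \<subseteq> {..<n}" using A by (auto simp: pair_set_def pair_cover_def)
      define t :: real where "t = (if T0 = X then 0 else 1)"
      have z: "w (pair_poly A) t \<in> K" using wK[OF deg] poly_pair_poly(1)[OF fA(1)] by (simp add: t_def)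
      have zT: "{l\<in>J. c l \<bullet> w (pair_poly A) t = 0} = pair_cover A \<union> T0"
        unfolding wz[OF deg] using poly_pair_poly(2)[OF fA(1)] pc T0 by (auto simp: t_def)
      have TJ: "pair_cover A \<union> T0 \<subseteq> J" using zT by blast
      note tr1 = tr[OF TJ z zT]
      have "active_face K c (pair_cover A \<union> T0) \<subseteq> span (insert (vec_of (pair_poly A)) (if X - T0 = {} then {} else {e'}))"
      proof
        fix z assume z: "z \<in> active_face K c (pair_cover A \<union> T0)"
        have "\<forall>l\<in>pair_cover A. mom l \<bullet> z = 0"
        proof
          fix l assume l: "l \<in> pair_cover A"
          then have "c l \<bullet> z = 0" "l < n" using z pc by (auto simp: active_face_def)
          then show "mom l \<bullet> z = 0" by (simp add: c_def)
        qed
        then have zeq: "z = (mom n \<bullet> z / poly (pair_poly A) (real n)) *\<^sub>R vec_of (pair_poly A) + (e' \<bullet> z) *\<^sub>R e'"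
          by (rule vert_span[OF A])
        have "(e' \<bullet> z) *\<^sub>R e' \<in> span (insert (vec_of (pair_poly A)) (if X - T0 = {} then {} else {e'}))"
        proof (cases "X - T0 = {}")
          case True
          have "e' \<bullet> z = 0"
          proof (cases "X = {}")
            case False
            then obtain l where "l \<in> X" "l \<in> T0" using True by blast
            then show ?thesis using z cX by (auto simp: active_face_def)
          qed (simp add: e'_def)
          then show ?thesis by (simp add: span_zero)
        qed (auto intro: span_scale span_base)
        then show "z \<in> span (insert (vec_of (pair_poly A)) (if X - T0 = {} then {} else {e'}))"
          by (subst zeq) (intro span_add span_scale[OF span_base[OF insertI1]])
      qed
      then have "aff_dim (active_face K c (pair_cover A \<union> T0))
          \<le> int (card (insert (vec_of (pair_poly A)) (if X - T0 = {} then {} else {e'})))"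
        by (rule aff_dim_le_card_span) simp
      also have "\<dots> \<le> 1 + int (card (X - T0))"
        using T0 by (auto simp: X_def card_insert_if split: if_splits)
      finally show ?thesis using tr1 by auto
    qed
    \<comment> \<open>At most \<open>2 + card T0\<close> equations hold in a space of dimension
      \<open>2 * k + 1 + card X\<close>.\<close>
    have ridge: "2 * int k - 1 + int (card X) - int (card T0) \<le> aff_dim (active_face K' c' ({b, b'} \<union> T0))"
      if b: "b < n" "b' < n" and T0: "T0 = X \<or> T0 = {}" for b b' T0
    proof -
      have deg: "degree (double_poly b b') \<le> 2 * k" using degree_double_poly[of b b'] k by linarith
      define t :: real where "t = (if T0 = X then 0 else 1)"
      have z: "w (double_poly b b') t \<in> K" using wK[OF deg] poly_double_poly(1) by (simp add: t_def)
      have zT: "{l\<in>J. c l \<bullet> w (double_poly b b') t = 0} = {b, b'} \<union> T0"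
        unfolding wz[OF deg] poly_double_poly(2) using b T0 by (auto simp: t_def)
      have TJ: "{b, b'} \<union> T0 \<subseteq> J" using zT by blast
      obtain z' where z': "z' \<in> K'" "{l\<in>J. c' l \<bullet> z' = 0} = {b, b'} \<union> T0" using tr[OF TJ z zT] by blast
      have "card ({b, b'} \<union> T0) \<le> card {b, b'} + card T0" by (rule card_Un_le)
      also have "\<dots> \<le> 2 + card T0" by (simp add: card_insert_if)
      finally show ?thesis using aff_dim_active_face_ge[OF J K'c z'(2,1), unfolded cardX] by simp
    qed
    show False
    proof (cases "j \<le> 2 * k - 2")
      case True
      define U where "U = {x. \<forall>t\<in>X. c' t \<bullet> x = 0}"
      have U: "subspace U" by (auto simp: U_def subspace_def inner_add_right)
      have dU: "dim U \<le> 2 * k + 1"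
      proof (cases "X = {}")
        case True
        then show ?thesis using dim_subset_UNIV[of U] cardX by simp
      next
        case False
        then have "X = {n}" by (simp add: X_def split: if_splits)
        then show ?thesis using dim_hyperplane_less[OF nonzero[of n]] cardX by (simp add: U_def J_def)
      qed
      show False
      proof (rule notE[OF m[rule_format, of J X K' c' i j U]], intro conjI)
        show "finite J" "K' = {z. \<forall>l\<in>J. 0 \<le> c' l \<bullet> z}" "proper_cone K'" "cone_scribed i j K'"
          "subspace U" "dim U \<le> 2 * k + 1" by (fact J K'c K' scr U dU)+
        show "{..<n} \<union> X \<subseteq> J" "{..<n} \<inter> X = {}" using Xn by (auto simp: J_def)
        show "i < DIM('a)" using True ij D k by linarith
        show "\<forall>l<n. \<exists>h\<in>U. \<forall>x. (\<forall>t\<in>X. c' t \<bullet> x = 0) \<longrightarrow> c' l \<bullet> x = h \<bullet> x"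
        proof (intro allI impI)
          fix l
          obtain h g where hg: "h \<in> span U" "\<And>x. x \<in> span U \<Longrightarrow> orthogonal g x" "c' l = h + g"
            using orthogonal_subspace_decomp_exists[of U "c' l"] by metis
          have sU: "span U = U" using U by (simp only: span_eq_iff)
          show "\<exists>h\<in>U. \<forall>x. (\<forall>t\<in>X. c' t \<bullet> x = 0) \<longrightarrow> c' l \<bullet> x = h \<bullet> x"
            using hg unfolding sU
            by (intro bexI[of _ h]) (auto simp: U_def inner_add_left orthogonal_def)
        qed
        show "\<forall>a. a \<noteq> 0 \<longrightarrow> (\<forall>x. (\<forall>t\<in>X. c' t \<bullet> x = 0) \<longrightarrow> a \<bullet> x = 0) \<longrightarrow>
            aff_dim (K' \<inter> {x. a \<bullet> x = 0}) \<noteq> int i + 1"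
        proof (intro allI impI)
          fix a assume a: "a \<noteq> 0" "\<forall>x. (\<forall>t\<in>X. c' t \<bullet> x = 0) \<longrightarrow> a \<bullet> x = 0"
          have X: "X = {n}"
          proof (rule ccontr)
            assume "X \<noteq> {n}"
            then have "X = {}" by (auto simp: X_def split: if_splits)
            then have "a \<bullet> a = 0" using a(2) by blast
            then show False using a(1) by simp
          qed
          have cn: "c' n \<noteq> 0" using nonzero[of n] X by (simp add: J_def)
          \<comment> \<open>A functional that vanishes on the hyperplane of the base is a multiple
            of \<open>c' n\<close>, so it cuts out the base, whose dimension exceeds that of an
            \<open>i\<close>-face.\<close>
          define \<mu> where "\<mu> = (a \<bullet> c' n) / (c' n \<bullet> c' n)"
          define a' where "a' = a - \<mu> *\<^sub>R c' n"
          have ca': "c' n \<bullet> a' = 0" using cn by (simp add: a'_def \<mu>_def inner_diff_right inner_commute)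
          then have "\<forall>t\<in>X. c' t \<bullet> a' = 0" using X by simp
          then have "a \<bullet> a' = 0" using a(2) by blast
          then have "a' \<bullet> a' = 0" using ca' by (simp add: a'_def inner_diff_left)
          then have al: "a = \<mu> *\<^sub>R c' n" by (simp add: a'_def)
          then have "K' \<inter> {x. a \<bullet> x = 0} = active_face K' c' {n}"
            using a(1) by (auto simp: active_face_def)
          moreover have "int DIM(real \<times> 'a) - int (card {n}) \<le> aff_dim (active_face K' c' {n})"
          proof -
            have "w 1 0 \<in> K" by (rule wK) auto
            moreover have "{l\<in>J. c l \<bullet> w 1 0 = 0} = {n}" using wz[of 1 0] X by simp
            ultimately obtain z' where "z' \<in> K'" "{l\<in>J. c' l \<bullet> z' = 0} = {n}"
              using tr[of "{n}" "w 1 0"] X by (auto simp: J_def)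
            then show ?thesis using aff_dim_active_face_ge[OF J K'c] by blast
          qed
          ultimately show "aff_dim (K' \<inter> {x. a \<bullet> x = 0}) \<noteq> int i + 1"
            using cardX X True ij k by simp
        qed
        show "\<forall>A. pair_set k n A \<longrightarrow> aff_dim (active_face K' c' (pair_cover A \<union> X)) \<le> int i + 1 \<and>
          (\<exists>z\<in>K'. (\<forall>t\<in>X. c' t \<bullet> z = 0) \<and> {l\<in>J. c' l \<bullet> z = 0} = pair_cover A \<union> X)"
          using vert[of _ X] by force
        show "\<forall>b<n. \<forall>b'<n. int j + 1 \<le> aff_dim (active_face K' c' ({b, b'} \<union> X))"
        proof (intro allI impI)
          fix b b' assume "b < n" "b' < n"
          then show "int j + 1 \<le> aff_dim (active_face K' c' ({b, b'} \<union> X))"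
            using ridge[of b b' X] True k by simp
        qed
      qed
    next
      case False
      then have r: "DIM('a) = 2 * k + 1" "1 \<le> i" "j \<le> 2 * k - 1" using range by auto
      then have X: "X = {n}" by (simp add: X_def)
      \<comment> \<open>The apex lies on all facets except the base, so its image \<open>q\<close>
        is orthogonal to their normals, which thus live in a hyperplane.\<close>
      have "w 0 1 \<in> K" by (rule wK) auto
      moreover have "{l\<in>J. c l \<bullet> w 0 1 = 0} = {..<n}" using wz[of 0 1] by auto
      ultimately obtain q where q: "q \<in> K'" "{l\<in>J. c' l \<bullet> q = 0} = {..<n}"
        using tr[of "{..<n}" "w 0 1"] by (auto simp: J_def)
      have "n \<in> J" using X by (simp add: J_def)
      then have q0: "q \<noteq> 0" using q(2) by force
      define H where "H = {x. q \<bullet> x = 0}"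
      have H: "subspace H" by (auto simp: H_def subspace_def inner_add_right)
      have dH: "dim H \<le> 2 * k + 1" using dim_hyperplane_less[OF q0] r(1) by (simp add: H_def)
      show False
      proof (rule notE[OF m[rule_format, of J "{}" K' c' i j H]], intro conjI)
        show "finite J" "K' = {z. \<forall>l\<in>J. 0 \<le> c' l \<bullet> z}" "proper_cone K'" "cone_scribed i j K'"
          "subspace H" "dim H \<le> 2 * k + 1" by (fact J K'c K' scr H dH)+
        show "{..<n} \<union> {} \<subseteq> J" "{..<n} \<inter> {} = {}" by (auto simp: J_def)
        show "i < DIM('a)" using r ij by linarith
        show "\<forall>l<n. \<exists>h\<in>H. \<forall>x. (\<forall>t\<in>{}. c' t \<bullet> x = 0) \<longrightarrow> c' l \<bullet> x = h \<bullet> x"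
        proof (intro allI impI)
          fix l assume "l < n"
          then have "c' l \<bullet> q = 0" using q(2) by blast
          then have "c' l \<in> H" by (simp add: H_def inner_commute)
          then show "\<exists>h\<in>H. \<forall>x. (\<forall>t\<in>{}. c' t \<bullet> x = 0) \<longrightarrow> c' l \<bullet> x = h \<bullet> x" by blast
        qed
        show "\<forall>a. a \<noteq> 0 \<longrightarrow> (\<forall>x. (\<forall>t\<in>{}. c' t \<bullet> x = 0) \<longrightarrow> a \<bullet> x = 0) \<longrightarrow>
            aff_dim (K' \<inter> {x. a \<bullet> x = 0}) \<noteq> int i + 1"
          by (metis empty_iff inner_eq_zero_iff)
        show "\<forall>A. pair_set k n A \<longrightarrow> aff_dim (active_face K' c' (pair_cover A \<union> {})) \<le> int i + 1 \<and>
          (\<exists>z\<in>K'. (\<forall>t\<in>{}. c' t \<bullet> z = 0) \<and> {l\<in>J. c' l \<bullet> z = 0} = pair_cover A \<union> {})"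
        proof (intro allI impI)
          \<comment> \<open>These faces contain the apex and have affine dimension at most 2, which
            is where \<open>1 \<le> i\<close> enters.\<close>
          fix A assume "pair_set k n A"
          then show "aff_dim (active_face K' c' (pair_cover A \<union> {})) \<le> int i + 1 \<and>
            (\<exists>z\<in>K'. (\<forall>t\<in>{}. c' t \<bullet> z = 0) \<and> {l\<in>J. c' l \<bullet> z = 0} = pair_cover A \<union> {})"
            using vert[of A "{}"] X r(2) by auto
        qed
        show "\<forall>b<n. \<forall>b'<n. int j + 1 \<le> aff_dim (active_face K' c' ({b, b'} \<union> {}))"
        proof (intro allI impI)
          fix b b' assume "b < n" "b' < n"
          then show "int j + 1 \<le> aff_dim (active_face K' c' ({b, b'} \<union> {}))"
            using ridge[of b b' "{}"] r(3) k X by simp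
        qed
      qed
    qed
  qed
  then show ?thesis using K by (intro exI[of _ K]) blast
qed

section \<open>Choice between the cone and its dual\<close>

theorem theorem5:
  fixes d i j :: nat
  assumes "d = CARD('n::finite)"
    and "3 < d"
    and "i \<le> j" and "j \<le> d - 1"
    and "even d \<Longrightarrow> j - i \<le> d - 2"
    and "odd d \<Longrightarrow> j - i \<le> d - 3"
  shows "\<exists>P :: (real \<times> (real ^ 'n)) set.
           spherical_dpolytope d P \<and> \<not> strongly_scribable i j P"
proof -
  define k where "k = d div 2"
  have k: "2 \<le> k" using assms(2) by (auto simp: k_def)
  have dk: "d = 2 * k \<or> d = 2 * k + 1" by (auto simp: k_def)
  have D: "DIM(real ^ 'n) = d" using assms(1) by simp
  then have D1: "DIM(real \<times> (real ^ 'n)) = d + 1" by simp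
  define direct where "direct i j \<longleftrightarrow> j \<le> 2 * k - 2 \<or> d = 2 * k + 1 \<and> 1 \<le> i \<and> j \<le> 2 * k - 1" for i j :: nat
  obtain K :: "(real \<times> (real ^ 'n)) set" where K: "proper_cone K"
    and nscr: "\<And>(K' :: (real \<times> (real ^ 'n)) set) i j. proper_cone K' \<Longrightarrow> face_isomorphic K' K \<Longrightarrow>
      i \<le> j \<Longrightarrow> direct i j \<Longrightarrow> \<not> cone_scribed i j K'"
    using moment_cone_not_scribable[OF k, where 'a = "real ^ 'n"] dk unfolding D direct_def by blast
  have polytope: "spherical_dpolytope d (L \<inter> sphere 0 1)" "convex_cone hull (L \<inter> sphere 0 1) = L"
    if "proper_cone L" for L :: "(real \<times> (real ^ 'n)) set"
    using proper_cone_spherical_dpolytope[OF that D1] convex_cone_hull_Int_sphere that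
    by (auto simp: proper_cone_def)
  have iso: "proper_cone (convex_cone hull Q)" "face_isomorphic (convex_cone hull Q) L"
    if "spherical_dpolytope CARD('n) Q" "isomorphic_face_lattices Q (L \<inter> sphere 0 1)" "proper_cone L"
    for Q L :: "(real \<times> (real ^ 'n)) set"
  proof -
    show Q: "proper_cone (convex_cone hull Q)"
      using spherical_dpolytope_proper_cone(1)[OF that(1)] by simp
    show "face_isomorphic (convex_cone hull Q) L"
      using isomorphic_face_lattices_face_isomorphic[OF Q _ that(2)] polytope(2)[OF that(3)] that(3) by simp
  qed
  show ?thesis
  proof (cases "direct i j")
    case True
    have "\<not> strongly_scribable i j (K \<inter> sphere 0 1)"
    proof
      assume "strongly_scribable i j (K \<inter> sphere 0 1)"
      then obtain Q :: "(real \<times> (real ^ 'n)) set" where Q: "spherical_dpolytope CARD('n) Q" "isomorphic_face_lattices Q (K \<inter> sphere 0 1)"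
        "strongly_scribed i j Q" unfolding strongly_scribable_def by blast
      show False
        using nscr[OF iso[OF Q(1,2) K] assms(3) True] cone_scribed_if_strongly_scribed(1)[OF Q(1,3) assms(3)]
          assms(1,4) by simp
    qed
    then show ?thesis using polytope(1)[OF K] by blast
  next
    case False
    \<comment> \<open>If \<open>d\<close> is even, \<open>j = d - 1\<close> and the bound on
      \<open>j - i\<close> gives \<open>1 \<le> i\<close>. If \<open>d\<close> is odd, the bound
      excludes \<open>i = 0\<close> with \<open>j = d - 2\<close>, so again
      \<open>j = d - 1\<close>, and it gives \<open>2 \<le> i\<close>.\<close>
    have "d - 1 - i \<le> 2 * k - 2"
      using dk
    proof
      assume d: "d = 2 * k"
      then show ?thesis using False assms(3-5) k unfolding direct_def by simp
    next
      assume d: "d = 2 * k + 1"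
      then show ?thesis using False assms(3,4,6) k unfolding direct_def by auto
    qed
    then have dir: "direct (d - 1 - j) (d - 1 - i)" "d - 1 - j \<le> d - 1 - i"
      using assms(3) by (auto simp: direct_def)
    have DK: "proper_cone (dual_cone K)" by (rule proper_dual_cone[OF K])
    have "\<not> strongly_scribable i j (dual_cone K \<inter> sphere 0 1)"
    proof
      assume "strongly_scribable i j (dual_cone K \<inter> sphere 0 1)"
      then obtain Q :: "(real \<times> (real ^ 'n)) set" where Q: "spherical_dpolytope CARD('n) Q"
        "isomorphic_face_lattices Q (dual_cone K \<inter> sphere 0 1)" "strongly_scribed i j Q"
        unfolding strongly_scribable_def by blast
      note pQ = iso(1)[OF Q(1,2) DK]
      have "face_isomorphic (dual_cone (convex_cone hull Q)) K"
        by (rule face_isomorphic_dual_cone[OF pQ K iso(2)[OF Q(1,2) DK]])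
      then show False
        using nscr[OF proper_dual_cone[OF pQ] _ dir(2,1)]
          cone_scribed_if_strongly_scribed(2)[OF Q(1,3) assms(3)] assms(1,4) by simp
    qed
    then show ?thesis using polytope(1)[OF DK] by blast
  qed
qed

end
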